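(* Let $\mathcal Q=\{Q_j\}_{j\in J}=\{T_jQ\}_{j\in J}$ be a structured admissible covering of $\mathbb{R}^d\setminus\{0\}$ with associated square-root system $\{\phi_j\}_{j\in J}$ (see context), and let $K_a$ be a cube in $\mathbb{R}^d$ (aligned with the coordinate axes) of side-length $2a$ with $Q\subseteq K_a$. Define $$e_{n,j}(\xi)=(2a)^{-d/2}|T_j|^{-1/2}\chi_{K_a}(T_j^{-1}\xi)e^{i\frac{\pi}{a}n\cdot T_j^{-1}\xi},\qquad \hat\eta_{n,j}=\phi_je_{n,j},\qquad n\in\mathbb{Z}^d,\ j\in J.$$ Then $\{\eta_{n,j}\}_{n\in\mathbb{Z}^d,j\in J}$ is a tight frame for $L_2(\mathbb{R}^d)$: for all $f\in L_2(\mathbb{R}^d)$, $$\sum_{j\in J}\sum_{n\in\mathbb{Z}^d}|\langle f,\eta_{n,j}\rangle|^2=\|f\|_{L_2}^2,\qquad \hat f=\sum_{j\in J}\sum_{n\in\mathbb{Z}^d}\langle\hat f,\hat\eta_{n,j}\rangle\hat\eta_{n,j}.$$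
   Context: Fourier transform: $\hat f(\xi)=\mathcal F f(\xi)=(2\pi)^{-d/2}\int f(x)e^{-ix\cdot\xi}\,dx$, extended to $L_2(\mathbb{R}^d)$. An admissible covering of $\mathbb{R}^d\setminus\{0\}$ is a family $\{Q_j\}_{j\in J}$ of measurable subsets of $\mathbb{R}^d\setminus\{0\}$ with union $\mathbb{R}^d\setminus\{0\}$ and $\sup_j\#\{i:Q_i\cap Q_j\ne\emptyset\}<\infty$. A structured admissible covering: $J$ nonempty countable, $T_j=A_j\cdot+b_j$ ($j\in J$) invertible affine maps of $\mathbb{R}^d$, $P\subset Q\subset\mathbb{R}^d\setminus\{0\}$ bounded open sets with $P$ compactly contained in $Q$, such that $\{T_jP\}_{j}$ and $\{Q_j\}_j:=\{T_jQ\}_{j}$ are admissible coverings of $\mathbb{R}^d\setminus\{0\}$, and there is a constant $K_0$ such that $T_jQ\cap T_kQ\ne\emptyset$ implies $\|A_k^{-1}A_j\|_{\ell_\infty}\le K_0$ (maximum of absolute values of entries). $|T_j|:=|\det A_j|$. Square-root system: fix a non-negative $\Phi\in C^\infty(\mathbb{R}^d)$ with $\Phi=1$ on $P$, $\mathrm{supp}\,\Phi\subset Q$; set $g_j(\xi)=\Phi(T_j^{-1}\xi)$ and $\phi_j=g_j/\sqrt{\sum_{k\in J}g_k^2}$. Then $\mathrm{supp}\,\phi_j\subset Q_j$ and $\sum_j\phi_j^2=1$ on $\mathbb{R}^d\setminus\{0\}$. *)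

theory Defs
  imports "HOL-Analysis.Analysis"
begin

definition L2 :: "(real ^ 'd \<Rightarrow> complex) set" where
  "L2 = {f. f \<in> borel_measurable lebesgue \<and> integrable lebesgue (\<lambda>x. (norm (f x))\<^sup>2)}"

definition L2_inner :: "(real ^ 'd \<Rightarrow> complex) \<Rightarrow> (real ^ 'd \<Rightarrow> complex) \<Rightarrow> complex" where
  "L2_inner f g = (LINT x|lebesgue. f x * cnj (g x))"

definition L2_norm :: "(real ^ 'd \<Rightarrow> complex) \<Rightarrow> real" where
  "L2_norm f = sqrt (LINT x|lebesgue. (norm (f x))\<^sup>2)"

text \<open>The membership conditions are needed because the Bochner integral of a non-integrable
  function is 0, so that \<^const>\<open>L2_norm\<close> is meaningful only on \<^const>\<open>L2\<close>.\<close>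

definition L2_tendsto ::
  "('i \<Rightarrow> real ^ 'd \<Rightarrow> complex) \<Rightarrow> (real ^ 'd \<Rightarrow> complex) \<Rightarrow> 'i filter \<Rightarrow> bool" where
  "L2_tendsto u f F \<longleftrightarrow>
     f \<in> L2 \<and> eventually (\<lambda>i. u i \<in> L2) F \<and>
     ((\<lambda>i. L2_norm (\<lambda>x. u i x - f x)) \<longlongrightarrow> 0) F"

definition fourier_integral :: "(real ^ 'd \<Rightarrow> complex) \<Rightarrow> real ^ 'd \<Rightarrow> complex" where
  "fourier_integral f \<xi> =
     of_real ((2 * pi) powr (- real CARD('d) / 2)) *
     (LINT x|lebesgue. f x * exp (- \<i> * of_real (x \<bullet> \<xi>)))"

text \<open>The continuous extension of the Fourier integral from the dense subspace of integrable
  functions in \<^const>\<open>L2\<close>. As \<^const>\<open>L2\<close> consists of functions and not of classes, the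
  transform is determined almost everywhere only.\<close>

definition has_L2_fourier :: "(real ^ 'd \<Rightarrow> complex) \<Rightarrow> (real ^ 'd \<Rightarrow> complex) \<Rightarrow> bool" where
  "has_L2_fourier f F \<longleftrightarrow>
     (\<exists>u :: nat \<Rightarrow> real ^ 'd \<Rightarrow> complex.
        (\<forall>k. integrable lebesgue (u k)) \<and>
        L2_tendsto u f sequentially \<and>
        L2_tendsto (\<lambda>k. fourier_integral (u k)) F sequentially)"

definition fourier_L2 :: "(real ^ 'd \<Rightarrow> complex) \<Rightarrow> real ^ 'd \<Rightarrow> complex" where
  "fourier_L2 f = (SOME F. has_L2_fourier f F)"

definition inv_fourier_L2 :: "(real ^ 'd \<Rightarrow> complex) \<Rightarrow> real ^ 'd \<Rightarrow> complex" where
  "inv_fourier_L2 F = (SOME f. f \<in> L2 \<and> (AE \<xi> in lebesgue. fourier_L2 f \<xi> = F \<xi>))"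

primrec C_k :: "nat \<Rightarrow> (real ^ 'd \<Rightarrow> real) \<Rightarrow> bool" where
  "C_k 0 f \<longleftrightarrow> continuous_on UNIV f"
| "C_k (Suc k) f \<longleftrightarrow>
     (\<forall>x. f differentiable (at x)) \<and> (\<forall>v. C_k k (\<lambda>x. frechet_derivative f (at x) v))"

definition C_infinity :: "(real ^ 'd \<Rightarrow> real) \<Rightarrow> bool" where
  "C_infinity f \<longleftrightarrow> (\<forall>k. C_k k f)"

definition admissible_covering :: "'j set \<Rightarrow> ('j \<Rightarrow> (real ^ 'd) set) \<Rightarrow> bool" where
  "admissible_covering J Q \<longleftrightarrow>
     (\<forall>j\<in>J. Q j \<in> sets lebesgue \<and> Q j \<subseteq> - {0}) \<and>
     (\<Union>j\<in>J. Q j) = - {0} \<and>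
     (\<exists>N :: nat. \<forall>j\<in>J. finite {i \<in> J. Q i \<inter> Q j \<noteq> {}} \<and> card {i \<in> J. Q i \<inter> Q j \<noteq> {}} \<le> N)"

definition affine_map :: "real ^ 'd ^ 'd \<Rightarrow> real ^ 'd \<Rightarrow> real ^ 'd \<Rightarrow> real ^ 'd" where
  "affine_map A b x = A *v x + b"

definition max_entry :: "real ^ 'd ^ 'd \<Rightarrow> real" where
  "max_entry M = Max (range (\<lambda>(i, l). \<bar>M $ i $ l\<bar>))"

definition structured_admissible_covering ::
  "'j set \<Rightarrow> ('j \<Rightarrow> real ^ 'd ^ 'd) \<Rightarrow> ('j \<Rightarrow> real ^ 'd) \<Rightarrow> (real ^ 'd) set \<Rightarrow> (real ^ 'd) set \<Rightarrow> bool"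
  where
  "structured_admissible_covering J A b P Q \<longleftrightarrow>
     J \<noteq> {} \<and> countable J \<and>
     (\<forall>j\<in>J. invertible (A j)) \<and>
     open P \<and> bounded P \<and> open Q \<and> bounded Q \<and> P \<subseteq> Q \<and> Q \<subseteq> - {0} \<and>
     compact (closure P) \<and> closure P \<subseteq> Q \<and>
     admissible_covering J (\<lambda>j. affine_map (A j) (b j) ` P) \<and>
     admissible_covering J (\<lambda>j. affine_map (A j) (b j) ` Q) \<and>
     (\<exists>K0. \<forall>j\<in>J. \<forall>k\<in>J.
        affine_map (A j) (b j) ` Q \<inter> affine_map (A k) (b k) ` Q \<noteq> {} \<longrightarrow>
        max_entry (matrix_inv (A k) ** A j) \<le> K0)"

definition bump_function :: "(real ^ 'd) set \<Rightarrow> (real ^ 'd) set \<Rightarrow> (real ^ 'd \<Rightarrow> real) \<Rightarrow> bool" where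
  "bump_function P Q \<Phi> \<longleftrightarrow>
     C_infinity \<Phi> \<and> (\<forall>x. 0 \<le> \<Phi> x) \<and> (\<forall>x\<in>P. \<Phi> x = 1) \<and> closure {x. \<Phi> x \<noteq> 0} \<subseteq> Q"

definition dilated_bump ::
  "('j \<Rightarrow> real ^ 'd ^ 'd) \<Rightarrow> ('j \<Rightarrow> real ^ 'd) \<Rightarrow> (real ^ 'd \<Rightarrow> real) \<Rightarrow> 'j \<Rightarrow> real ^ 'd \<Rightarrow> real" where
  "dilated_bump A b \<Phi> j \<xi> = \<Phi> (inv (affine_map (A j) (b j)) \<xi>)"

text \<open>At the origin all the bumps vanish, and the quotient below is 0 by the convention
  \<open>x / 0 = 0\<close>.\<close>

definition sqrt_system ::
  "'j set \<Rightarrow> ('j \<Rightarrow> real ^ 'd ^ 'd) \<Rightarrow> ('j \<Rightarrow> real ^ 'd) \<Rightarrow> (real ^ 'd \<Rightarrow> real) \<Rightarrow> 'j \<Rightarrow> real ^ 'd \<Rightarrow> real"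
  where
  "sqrt_system J A b \<Phi> j \<xi> =
     dilated_bump A b \<Phi> j \<xi> / sqrt (\<Sum>\<^sub>\<infinity>k\<in>J. (dilated_bump A b \<Phi> k \<xi>)\<^sup>2)"

text \<open>The closed axis-parallel cube with centre \<open>c\<close> and side-length \<open>2 * a\<close>.\<close>

definition cube :: "real ^ 'd \<Rightarrow> real \<Rightarrow> (real ^ 'd) set" where
  "cube c a = cbox (c - vec a) (c + vec a)"

definition local_exponential ::
  "('j \<Rightarrow> real ^ 'd ^ 'd) \<Rightarrow> ('j \<Rightarrow> real ^ 'd) \<Rightarrow> real ^ 'd \<Rightarrow> real \<Rightarrow> int ^ 'd \<Rightarrow> 'j \<Rightarrow> real ^ 'd \<Rightarrow> complex"
  where
  "local_exponential A b c a n j \<xi> =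
     of_real ((2 * a) powr (- real CARD('d) / 2) * \<bar>det (A j)\<bar> powr (- 1 / 2) *
       indicator (cube c a) (inv (affine_map (A j) (b j)) \<xi>)) *
     exp (\<i> * of_real (pi / a * ((\<chi> i. real_of_int (n $ i)) \<bullet> inv (affine_map (A j) (b j)) \<xi>)))"

definition eta_hat ::
  "'j set \<Rightarrow> ('j \<Rightarrow> real ^ 'd ^ 'd) \<Rightarrow> ('j \<Rightarrow> real ^ 'd) \<Rightarrow> (real ^ 'd \<Rightarrow> real) \<Rightarrow> real ^ 'd \<Rightarrow> real \<Rightarrow>
    int ^ 'd \<Rightarrow> 'j \<Rightarrow> real ^ 'd \<Rightarrow> complex"
  where
  "eta_hat J A b \<Phi> c a n j \<xi> =
     of_real (sqrt_system J A b \<Phi> j \<xi>) * local_exponential A b c a n j \<xi>"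

definition eta ::
  "'j set \<Rightarrow> ('j \<Rightarrow> real ^ 'd ^ 'd) \<Rightarrow> ('j \<Rightarrow> real ^ 'd) \<Rightarrow> (real ^ 'd \<Rightarrow> real) \<Rightarrow> real ^ 'd \<Rightarrow> real \<Rightarrow>
    int ^ 'd \<Rightarrow> 'j \<Rightarrow> real ^ 'd \<Rightarrow> complex"
  where
  "eta J A b \<Phi> c a n j = inv_fourier_L2 (eta_hat J A b \<Phi> c a n j)"

end

theory Submission imports Defs
begin

text \<open>For fixed \<open>j\<close>, the exponentials \<open>e\<^bsub>n,j\<^esub>\<close> form an orthonormal basis of
  \<open>L\<^sub>2(T\<^sub>j K\<^sub>a)\<close>, and this set contains the support of \<open>\<phi>\<^sub>j\<close>. Hence summing the squared
  coefficients over \<open>n\<close> gives \<open>\<parallel>F \<phi>\<^sub>j\<parallel>\<^sup>2\<close>, and summing over \<open>j\<close> gives \<open>\<parallel>F\<parallel>\<^sup>2\<close> because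
  \<open>\<Sum>\<^sub>j \<phi>\<^sub>j\<^sup>2 = 1\<close>. The Fourier transform is a surjective isometry, so this transfers to the
  \<open>\<eta>\<^bsub>n,j\<^esub>\<close>; a family satisfying Parseval's identity reconstructs every function.

  Plancherel's theorem is itself deduced from Parseval's identity for multiple Fourier series: for
  \<open>f\<close> supported in a period cell and every shift \<open>\<theta>\<close>, the squares of the Fourier transform at the
  points \<open>\<theta> + n\<close> sum up to a multiple of \<open>\<parallel>f\<parallel>\<^sup>2\<close>, and integrating over \<open>\<theta>\<close> in the unit cube
  gives the integral over the whole space.\<close>

section \<open>Affine change of variables\<close>

text \<open>The completeness of the exponentials carries the weight. It is proved on the torus,
  embedded in C^d by \<open>torus_map\<close>: by Stone-Weierstrass a function with vanishing
  coefficients annihilates every continuous function of the torus, and inverting the embedding by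
  \<open>Arg\<close> off the seam leads from these to open subsets of the cell. Shifting the
  frequency lattice by theta is the same as modulating f, which leaves the norm of f alone; this is
  why the sum of squares does not depend on theta. Surjectivity of the transform comes from its
  adjoint, which the multiplication formula identifies as another Fourier transform up to
  conjugations. The exponentials are orthonormal only within one scale j. Supports for different j
  may overlap, so the whole family need not be orthogonal, and reconstruction rests on Parseval's
  identity alone: it bounds the synthesis of finitely many coefficients by their l2 norm. Functions
  are not identified when they agree almost everywhere, so transforms and their inverses are
  choices, and facts about them pass through uniqueness almost everywhere.\<close>

lemma lborel_distr_linear:
  fixes S :: "real ^ 'd \<Rightarrow> real ^ 'd"
  assumes "linear S" "inj S"
    and cb: "\<And>a b. measure lebesgue (S ` cbox a b) = measure lebesgue (cbox a b)"
  shows "lborel = distr lborel borel S"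
proof (rule lborel_eqI)
  have surj: "surj S" using assms linear_injective_imp_surjective by blast
  obtain h where h: "linear h" "\<And>x. h (S x) = x" "\<And>x. S (h x) = x"
    using linear_injective_isomorphism[OF assms(1,2)] by blast
  have [measurable]: "S \<in> borel_measurable borel"
    using assms(1) by (intro borel_measurable_continuous_onI linear_continuous_on linear_conv_bounded_linear[THEN iffD1])
  fix l u :: "real ^ 'd" assume lu: "\<And>b. b \<in> Basis \<Longrightarrow> l \<bullet> b \<le> u \<bullet> b"
  have eq: "S -` box l u = h ` box l u"
  proof
    show "S -` box l u \<subseteq> h ` box l u" using h(2) by (metis image_eqI subsetI vimageD)
  qed (use h(3) in auto)
  have "h ` box l u \<in> lmeasurable"
  proof (rule bounded_set_imp_lmeasurable)
    show "bounded (h ` box l u)"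
      by (intro bounded_linear_image bounded_box) (use h linear_conv_bounded_linear in blast)
    have "S -` box l u \<in> sets borel" by (rule measurable_sets_borel[of S borel]) auto
    then show "h ` box l u \<in> sets lebesgue" by (simp add: eq)
  qed
  \<comment> \<open>The criterion extends factor 1 from boxes to all measurable sets of finite
    measure. It is applied to the preimage of a box, which need not be a box.\<close>
  from measure_linear_sufficient[OF assms(1) this, of 1] cb
  have "measure lebesgue (h ` box l u) = measure lebesgue (S ` h ` box l u)" by simp
  also have "S ` h ` box l u = box l u" by (simp add: image_image h(3))
  finally have m: "measure lebesgue (S -` box l u) = measure lebesgue (box l u)" by (simp add: eq)
  have "emeasure (distr lborel borel S) (box l u) = emeasure lborel (S -` box l u)"
    by (simp add: emeasure_distr)
  also have "\<dots> = emeasure lebesgue (S -` box l u)"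
    using measurable_sets_borel[of S borel "box l u"] by (subst emeasure_completion) auto
  also have "\<dots> = measure lebesgue (S -` box l u)"
    using \<open>h ` box l u \<in> lmeasurable\<close> by (simp add: emeasure_eq_measure2 eq)
  also have "\<dots> = emeasure lebesgue (box l u)"
    unfolding m by (rule emeasure_eq_measure2[symmetric]) simp
  also have "\<dots> = (\<Prod>b\<in>Basis. (u - l) \<bullet> b)"
    using lu by simp
  finally show "emeasure (distr lborel borel S) (box l u) = (\<Prod>b\<in>Basis. (u - l) \<bullet> b)" .
qed simp

text \<open>The change of variables theorems of \<^theory>\<open>HOL-Analysis.Change_Of_Vars\<close> are restricted to
  well-ordered index types, which \<open>'d\<close> need not be.\<close>

lemma nn_integral_lborel_matrix:
  fixes A :: "real ^ 'd ^ 'd"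
  assumes "det A \<noteq> 0" "h \<in> borel_measurable borel"
  shows "(\<integral>\<^sup>+x. h x \<partial>lborel) = \<bar>det A\<bar> * (\<integral>\<^sup>+x. h (A *v x) \<partial>lborel)"
proof -
  have [measurable]: "(*v) M \<in> borel_measurable borel" for M :: "real ^ 'd ^ 'd"
    by (intro borel_measurable_continuous_onI linear_continuous_on matrix_vector_mul_bounded_linear)
  have lin: "linear ((*v) M)" for M :: "real ^ 'd ^ 'd" by (rule matrix_vector_mul_linear)
  \<comment> \<open>Transpositions and shears have determinant of absolute value 1, so for them it
    is enough that boxes keep their volume; a scaling factor arises only for diagonal
    matrices.\<close>
  have unimod: "(\<integral>\<^sup>+x. h x \<partial>lborel) = \<bar>det M\<bar> * (\<integral>\<^sup>+x. h (M *v x) \<partial>lborel)"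
    if "\<bar>det M\<bar> = 1" "\<And>a b. measure lebesgue ((*v) M ` cbox a b) = measure lebesgue (cbox a b)"
       "h \<in> borel_measurable borel" for M :: "real ^ 'd ^ 'd" and h
  proof -
    have "inj ((*v) M)" using that(1) by (simp add: inj_matrix_vector_mult invertible_det_nz)
    then have "lborel = distr lborel borel ((*v) M)"
      using lborel_distr_linear[OF lin] that(2) by blast
    then have "(\<integral>\<^sup>+x. h x \<partial>lborel) = (\<integral>\<^sup>+x. h x \<partial>distr lborel borel ((*v) M))" by simp
    also have "\<dots> = (\<integral>\<^sup>+x. h (M *v x) \<partial>lborel)"
      using that(3) by (subst nn_integral_distr) auto
    finally show ?thesis using that by simp
  qed
  have "\<forall>h. det A \<noteq> 0 \<longrightarrow> h \<in> borel_measurable borel \<longrightarrow>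
    (\<integral>\<^sup>+x. h x \<partial>lborel) = \<bar>det A\<bar> * (\<integral>\<^sup>+x. h (A *v x) \<partial>lborel)"
  \<comment> \<open>Determinants multiply along products and a zero row contradicts
    \<open>det A \<noteq> 0\<close>; what remains are diagonal matrices, transpositions of two
    coordinates and shears.\<close>
  proof (induction A rule: induct_matrix_elementary_alt)
    case (1 A B)
    show ?case
    proof (intro allI impI)
      fix h :: "real ^ 'd \<Rightarrow> ennreal" assume d: "det (A ** B) \<noteq> 0" and [measurable]: "h \<in> borel_measurable borel"
      have "(\<integral>\<^sup>+x. h x \<partial>lborel) = \<bar>det A\<bar> * (\<integral>\<^sup>+x. h (A *v x) \<partial>lborel)"
        using d by (intro 1(1)[rule_format]) (auto simp: det_mul)
      also have "(\<integral>\<^sup>+x. h (A *v x) \<partial>lborel) = \<bar>det B\<bar> * (\<integral>\<^sup>+x. h (A *v (B *v x)) \<partial>lborel)"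
        using d by (intro 1(2)[rule_format]) (auto simp: det_mul)
      finally show "(\<integral>\<^sup>+x. h x \<partial>lborel) = \<bar>det (A ** B)\<bar> * (\<integral>\<^sup>+x. h ((A ** B) *v x) \<partial>lborel)"
        by (simp add: det_mul abs_mult matrix_vector_mul_assoc ennreal_mult mult.assoc)
    qed
  next
    case (2 A i)
    then show ?case by (simp add: det_zero_row)
  next
    case (3 A)
    show ?case
    proof (intro allI impI)
      fix h :: "real ^ 'd \<Rightarrow> ennreal" assume d: "det A \<noteq> 0" and [measurable]: "h \<in> borel_measurable borel"
      define c where "c v = (A *v v) \<bullet> v" for v
      have dA: "det A = (\<Prod>i\<in>UNIV. A $ i $ i)" using 3 det_diagonal by blast
      then have nz: "A $ i $ i \<noteq> 0" for i using d by simp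
      have Ax: "A *v x = (\<chi> i. A $ i $ i * x $ i)" for x
      proof -
        have "(\<Sum>j\<in>UNIV. A $ i $ j * x $ j) = (\<Sum>j\<in>UNIV. if j = i then A $ i $ i * x $ i else 0)" for i
          using 3 by (intro sum.cong) auto
        then show ?thesis by (simp add: matrix_vector_mult_def vec_eq_iff)
      qed
      have c: "c (axis i 1) = A $ i $ i" for i
        by (simp add: c_def Ax inner_axis)
      have BU: "(Basis :: (real ^ 'd) set) = range (\<lambda>i. axis i 1)" by (auto simp: Basis_vec_def)
      have inj: "inj (\<lambda>i::'d. axis i (1::real))" by (simp add: inj_on_def axis_eq_axis)
      have T: "0 + (\<Sum>j\<in>Basis. (c j * (x \<bullet> j)) *\<^sub>R j) = A *v x" for x
      proof -
        have "(\<Sum>i\<in>UNIV. A $ i $ i * x $ i * axis i 1 $ k) = (\<Sum>i\<in>UNIV. if i = k then A $ k $ k * x $ k else 0)" for k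
          by (intro sum.cong) (auto simp: axis_def)
        then show ?thesis
          unfolding BU sum.reindex[OF inj] by (simp add: Ax c vec_eq_iff inner_axis)
      qed
      have P: "(\<Prod>j\<in>Basis. \<bar>c j\<bar>) = \<bar>det A\<bar>"
        unfolding BU prod.reindex[OF inj] dA by (simp add: c abs_prod)
      have cnz: "c j \<noteq> 0" if "j \<in> Basis" for j
        using that c nz by (auto simp: BU)
      have "lborel = density (distr lborel borel ((*v) A)) (\<lambda>_. \<bar>det A\<bar>)"
        using lborel_affine_euclidean[of c 0, OF cnz] unfolding T P by simp
      then have "(\<integral>\<^sup>+x. h x \<partial>lborel) = (\<integral>\<^sup>+x. h x \<partial>density (distr lborel borel ((*v) A)) (\<lambda>_. \<bar>det A\<bar>))" by simp
      also have "\<dots> = \<bar>det A\<bar> * (\<integral>\<^sup>+x. h (A *v x) \<partial>lborel)"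
        by (simp add: nn_integral_density nn_integral_cmult nn_integral_distr)
      finally show "(\<integral>\<^sup>+x. h x \<partial>lborel) = \<bar>det A\<bar> * (\<integral>\<^sup>+x. h (A *v x) \<partial>lborel)" .
    qed
  next
    case (4 m n)
    let ?M = "(\<chi> i j. mat 1 $ i $ Transposition.transpose m n j) :: real ^ 'd ^ 'd"
    have d: "\<bar>det ?M\<bar> = 1"
      by (simp add: det_permute_columns permutes_swap_id sign_swap_id 4 abs_mult)
    have Mv: "?M *v v = (\<chi> i. v $ Transposition.transpose m n i)" for v :: "real ^ 'd"
    proof -
      have "(\<Sum>j\<in>UNIV. (if i = Transposition.transpose m n j then 1 else 0) * v $ j) =
          (\<Sum>j\<in>UNIV. if j = Transposition.transpose m n i then v $ j else 0)" for i
        by (intro sum.cong) (auto simp: transpose_eq_iff)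
      then show ?thesis by (simp add: matrix_vector_mult_def vec_eq_iff mat_def)
    qed
    have "measure lebesgue ((*v) ?M ` cbox a b) = measure lebesgue (cbox a b)" for a b :: "real ^ 'd"
    proof (cases "cbox a b = {}")
      case False
      \<comment> \<open>A transposition of coordinates is its own inverse, so one inclusion between
        images of boxes, applied twice, gives equality.\<close>
      have inv: "?M *v (?M *v v) = v" for v
        unfolding Mv by (simp add: vec_eq_iff)
      have *: "x \<in> cbox a b \<Longrightarrow> ?M *v x \<in> cbox (?M *v a) (?M *v b)" for x a b
        by (simp add: Mv mem_box_cart)
      have im: "(*v) ?M ` cbox a b = cbox (?M *v a) (?M *v b)"
      proof
        show "(*v) ?M ` cbox a b \<subseteq> cbox (?M *v a) (?M *v b)" using * by blast
        show "cbox (?M *v a) (?M *v b) \<subseteq> (*v) ?M ` cbox a b"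
        proof
          fix x assume "x \<in> cbox (?M *v a) (?M *v b)"
          then have "?M *v x \<in> cbox a b" using *[of x "?M *v a" "?M *v b"] unfolding inv by blast
          then show "x \<in> (*v) ?M ` cbox a b" by (rule image_eqI[rotated]) (rule inv[symmetric])
        qed
      qed
      have "(\<Prod>i\<in>UNIV. (b - a) $ Transposition.transpose m n i) = (\<Prod>i\<in>UNIV. (b - a) $ i)"
        by (rule prod.permute[OF permutes_swap_id, symmetric, unfolded o_def]) auto
      moreover have "cbox (?M *v a) (?M *v b) \<noteq> {}" using False im by (metis image_is_empty)
      ultimately show ?thesis
        using False unfolding im by (simp add: content_cbox_cart) (simp add: Mv)
    qed simp
    with unimod[OF d] show ?case by blast
  next
    case (5 m n)
    let ?M = "(\<chi> i j. of_bool (i = m \<and> j = n \<or> i = j)) :: real ^ 'd ^ 'd"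
    have Mv: "?M *v v = (\<chi> i. if i = m then v $ m + v $ n else v $ i)" for v :: "real ^ 'd"
    proof -
      have "(\<Sum>j\<in>UNIV. of_bool (i = m \<and> j = n \<or> i = j) * v $ j) =
          (\<Sum>j\<in>UNIV. (if j = i then v $ j else 0) + (if i = m then (if j = n then v $ j else 0) else 0))" for i
        using 5 by (intro sum.cong) auto
      then show ?thesis by (simp add: matrix_vector_mult_def vec_eq_iff sum.distrib)
    qed
    have "?M = (\<chi> k. if k = m then row m (mat 1) + 1 *s row n (mat 1) else row k (mat 1))"
      using 5 by (auto simp: vec_eq_iff mat_def row_def)
    then have d: "\<bar>det ?M\<bar> = 1"
      using det_row_operation[OF 5, of "mat 1 :: real ^ 'd ^ 'd" 1] by simp
    have "measure lebesgue ((*v) ?M ` cbox a b) = measure lebesgue (cbox a b)" for a b :: "real ^ 'd"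
    proof (cases "cbox a b = {}")
      case False
      \<comment> \<open>The volume formula for sheared boxes wants a nonnegative lower corner in
        coordinate \<open>n\<close>. Translating by \<open>v\<close> moves that coordinate to 0, and
        the shear turns a translation into another translation.\<close>
      define v where "v = axis n (a $ n)"
      have cb: "cbox a b = (+) v ` cbox (a - v) (b - v)"
        using cbox_translation[of v "a - v" "b - v"] by simp
      then have "(*v) ?M ` cbox a b = (+) (?M *v v) ` (*v) ?M ` cbox (a - v) (b - v)"
        by (simp add: image_image matrix_vector_right_distrib)
      then have "measure lebesgue ((*v) ?M ` cbox a b) = measure lebesgue ((*v) ?M ` cbox (a - v) (b - v))"
        by (simp only: measure_translation)
      also have "\<dots> = measure lebesgue (cbox (a - v) (b - v))"
        unfolding Mv using 5 False cb
        by (intro measure_shear_interval) (auto simp: v_def)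
      also have "\<dots> = measure lebesgue (cbox a b)"
        unfolding cb by (simp only: measure_translation)
      finally show ?thesis .
    qed simp
    with unimod[OF d] show ?case by blast
  qed
  with assms show ?thesis by blast
qed

lemma lborel_affine_matrix:
  fixes A :: "real ^ 'd ^ 'd"
  assumes "det A \<noteq> 0"
  shows "lborel = density (distr lborel borel (\<lambda>x. A *v x + t)) (\<lambda>_. \<bar>det A\<bar>)"
proof (rule measure_eqI)
  fix X :: "(real ^ 'd) set" assume "X \<in> sets lborel"
  then have [measurable]: "X \<in> sets borel" by simp
  have [measurable]: "(*v) A \<in> borel_measurable borel"
    by (intro borel_measurable_continuous_onI linear_continuous_on matrix_vector_mul_bounded_linear)
  have "emeasure lborel X = (\<integral>\<^sup>+x. indicator X x \<partial>distr lborel borel ((+) t))"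
    by (simp add: lborel_distr_plus)
  also have "\<dots> = (\<integral>\<^sup>+x. indicator X (t + x) \<partial>lborel)"
    by (subst nn_integral_distr) auto
  also have "\<dots> = \<bar>det A\<bar> * (\<integral>\<^sup>+x. indicator X (t + A *v x) \<partial>lborel)"
    using assms by (intro nn_integral_lborel_matrix) auto
  also have "\<dots> = emeasure (density (distr lborel borel (\<lambda>x. A *v x + t)) (\<lambda>_. \<bar>det A\<bar>)) X"
    by (subst emeasure_density) (auto simp: nn_integral_cmult nn_integral_distr add.commute simp del: nn_integral_indicator)
  finally show "emeasure lborel X = emeasure (density (distr lborel borel (\<lambda>x. A *v x + t)) (\<lambda>_. \<bar>det A\<bar>)) X" .
qed simp

text \<open>To pass to the completion, preimages of null sets must be null. The image of Lebesgue
  measure under the affine map is Lebesgue measure divided by |det A|, so both have the same null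
  sets.\<close>

lemma
  fixes A :: "real ^ 'd ^ 'd"
  assumes "det A \<noteq> 0"
  shows lebesgue_affine_matrix:
      "lebesgue = density (distr lebesgue lebesgue (\<lambda>x. A *v x + t)) (\<lambda>_. \<bar>det A\<bar>)"
    and measurable_affine_matrix: "(\<lambda>x. A *v x + t) \<in> lebesgue \<rightarrow>\<^sub>M lebesgue"
proof -
  let ?T = "\<lambda>x. A *v x + t"
  have "(*v) A \<in> borel_measurable borel"
    by (intro borel_measurable_continuous_onI linear_continuous_on matrix_vector_mul_bounded_linear)
  then have [measurable]: "?T \<in> borel \<rightarrow>\<^sub>M borel" by measurable
  { fix X :: "(real ^ 'd) set" assume X: "X \<in> sets borel"
    have "emeasure lborel X = 0 \<longleftrightarrow> emeasure (density (distr lborel borel ?T) (\<lambda>_. \<bar>det A\<bar>)) X = 0"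
      using lborel_affine_matrix[OF assms, of t] by simp
    also have "\<dots> \<longleftrightarrow> emeasure (distr lebesgue lborel ?T) X = 0"
      using X assms by (simp add: distr_completion emeasure_density nn_integral_cmult cong: distr_cong)
    finally have "emeasure lborel X = 0 \<longleftrightarrow> emeasure (distr lebesgue lborel ?T) X = 0" . }
  then have eq: "null_sets lborel = null_sets (distr lebesgue lborel ?T)"
    by (auto simp: null_sets_def)
  show "?T \<in> lebesgue \<rightarrow>\<^sub>M lebesgue"
    by (simp add: completion.measurable_completion2 eq measurable_completion)
  have "lebesgue = completion (density (distr lborel borel ?T) (\<lambda>_. \<bar>det A\<bar>))"
    using lborel_affine_matrix[OF assms, of t] by simp
  also have "\<dots> = density (completion (distr lebesgue lborel ?T)) (\<lambda>_. \<bar>det A\<bar>)"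
    using assms by (auto intro!: always_eventually completion_density_eq simp: distr_completion cong: distr_cong)
  also have "\<dots> = density (distr lebesgue lebesgue ?T) (\<lambda>_. \<bar>det A\<bar>)"
    by (subst completion.completion_distr_eq) (auto simp: eq measurable_completion)
  finally show "lebesgue = density (distr lebesgue lebesgue ?T) (\<lambda>_. \<bar>det A\<bar>)" .
qed

lemma nn_integral_lebesgue_affine:
  fixes A :: "real ^ 'd ^ 'd"
  assumes "det A \<noteq> 0" and [measurable]: "h \<in> borel_measurable lebesgue"
  shows "(\<integral>\<^sup>+x. h x \<partial>lebesgue) = \<bar>det A\<bar> * (\<integral>\<^sup>+x. h (A *v x + t) \<partial>lebesgue)"
proof -
  note [measurable] = measurable_affine_matrix[OF assms(1)]
  have "(\<integral>\<^sup>+x. h x \<partial>lebesgue) =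
      (\<integral>\<^sup>+x. h x \<partial>density (distr lebesgue lebesgue (\<lambda>x. A *v x + t)) (\<lambda>_. \<bar>det A\<bar>))"
    using lebesgue_affine_matrix[OF assms(1), of t] by simp
  also have "\<dots> = \<bar>det A\<bar> * (\<integral>\<^sup>+x. h (A *v x + t) \<partial>lebesgue)"
    by (simp add: nn_integral_density nn_integral_cmult nn_integral_distr)
  finally show ?thesis .
qed

lemma
  fixes A :: "real ^ 'd ^ 'd" and h :: "real ^ 'd \<Rightarrow> complex"
  assumes "det A \<noteq> 0" and [measurable]: "h \<in> borel_measurable lebesgue"
  shows integral_lebesgue_affine:
      "(LINT x|lebesgue. h x) = \<bar>det A\<bar> * (LINT x|lebesgue. h (A *v x + t))"
    and integrable_lebesgue_affine:
      "integrable lebesgue h \<longleftrightarrow> integrable lebesgue (\<lambda>x. h (A *v x + t))"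
proof -
  note [measurable] = measurable_affine_matrix[OF assms(1)]
  have "(LINT x|lebesgue. h x) =
      (LINT x|density (distr lebesgue lebesgue (\<lambda>x. A *v x + t)) (\<lambda>_. \<bar>det A\<bar>). h x)"
    using lebesgue_affine_matrix[OF assms(1), of t] by simp
  also have "\<dots> = \<bar>det A\<bar> * (LINT x|lebesgue. h (A *v x + t))"
    by (subst integral_density) (auto simp: integral_distr scaleR_conv_of_real)
  finally show "(LINT x|lebesgue. h x) = \<bar>det A\<bar> * (LINT x|lebesgue. h (A *v x + t))" .
  have "integrable lebesgue h \<longleftrightarrow>
      integrable (density (distr lebesgue lebesgue (\<lambda>x. A *v x + t)) (\<lambda>_. \<bar>det A\<bar>)) h"
    using lebesgue_affine_matrix[OF assms(1), of t] by simp
  also have "\<dots> \<longleftrightarrow> integrable lebesgue (\<lambda>x. h (A *v x + t))"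
  proof -
    have "integrable lebesgue (\<lambda>x. h (A *v x + t))" if "integrable lebesgue (\<lambda>x. \<bar>det A\<bar> *\<^sub>R h (A *v x + t))"
      using integrable_scaleR_right[OF that, of "1 / \<bar>det A\<bar>"] assms(1) by simp
    then show ?thesis
      by (subst integrable_density) (auto simp: integrable_distr_eq)
  qed
  finally show "integrable lebesgue h \<longleftrightarrow> integrable lebesgue (\<lambda>x. h (A *v x + t))" .
qed

section \<open>The space of square-integrable functions\<close>

lemma sigma_finite_lebesgue: "sigma_finite_measure (lebesgue :: 'a::euclidean_space measure)"
proof
  obtain A :: "'a set set" where A: "countable A" "A \<subseteq> sets lborel" "\<Union>A = space lborel" "\<forall>a\<in>A. emeasure lborel a \<noteq> \<infinity>"
    using lborel.sigma_finite_countable by blast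
  then show "\<exists>A::'a set set. countable A \<and> A \<subseteq> sets lebesgue \<and> \<Union> A = space lebesgue \<and> (\<forall>a\<in>A. emeasure lebesgue a \<noteq> \<infinity>)"
    by (intro exI[of _ A]) (auto simp: subset_iff)
qed

lemma borel_measurable_cnj[measurable (raw)]:
  "f \<in> borel_measurable M \<Longrightarrow> (\<lambda>x. cnj (f x)) \<in> borel_measurable M"
  by (rule measurable_compose[of f M borel]) (auto intro!: borel_measurable_continuous_onI continuous_intros)

lemma L2_measurable[measurable_dest]: "f \<in> L2 \<Longrightarrow> f \<in> borel_measurable lebesgue"
  by (simp add: L2_def)

lemma L2_integrable: "f \<in> L2 \<Longrightarrow> integrable lebesgue (\<lambda>x. (cmod (f x))\<^sup>2)"
  by (simp add: L2_def)

lemma L2I: "f \<in> borel_measurable lebesgue \<Longrightarrow> integrable lebesgue (\<lambda>x. (cmod (f x))\<^sup>2) \<Longrightarrow> f \<in> L2"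
  by (simp add: L2_def)

lemma L2_bound:
  assumes "f \<in> L2" and [measurable]: "g \<in> borel_measurable lebesgue"
    and "\<And>x. cmod (g x) \<le> C * cmod (f x)"
  shows "g \<in> L2"
proof (rule L2I)
  show "integrable lebesgue (\<lambda>x. (cmod (g x))\<^sup>2)"
  proof (rule Bochner_Integration.integrable_bound[OF integrable_mult_right[OF L2_integrable[OF assms(1)], of "C\<^sup>2"]])
    show "AE x in lebesgue. norm ((cmod (g x))\<^sup>2) \<le> norm (C\<^sup>2 * (cmod (f x))\<^sup>2)"
      using assms(3) power_mono[OF assms(3) norm_ge_zero, of _ 2] by (simp add: power_mult_distrib)
  qed measurable
qed fact

lemma L2_zero: "(\<lambda>x. 0) \<in> L2"
  by (simp add: L2_def)

lemma L2_cmult: "f \<in> L2 \<Longrightarrow> (\<lambda>x. c * f x) \<in> L2"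
  by (rule L2_bound[of f _ "cmod c"]) (auto simp: norm_mult)

lemma L2_cnj: "f \<in> L2 \<Longrightarrow> (\<lambda>x. cnj (f x)) \<in> L2"
  by (rule L2_bound[of f _ 1]) auto

lemma L2_add:
  assumes "f \<in> L2" "g \<in> L2" shows "(\<lambda>x. f x + g x) \<in> L2"
proof (rule L2I)
  note [measurable] = assms[THEN L2_measurable]
  show "(\<lambda>x. f x + g x) \<in> borel_measurable lebesgue" by measurable
  show "integrable lebesgue (\<lambda>x. (cmod (f x + g x))\<^sup>2)"
  proof (rule Bochner_Integration.integrable_bound[where f = "\<lambda>x. 2 * (cmod (f x))\<^sup>2 + 2 * (cmod (g x))\<^sup>2"])
    show "AE x in lebesgue. norm ((cmod (f x + g x))\<^sup>2) \<le> norm (2 * (cmod (f x))\<^sup>2 + 2 * (cmod (g x))\<^sup>2)"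
    proof (rule AE_I2)
      fix x
      have "(cmod (f x + g x))\<^sup>2 \<le> (cmod (f x) + cmod (g x))\<^sup>2"
        by (intro power_mono norm_triangle_ineq) simp
      also have "\<dots> \<le> 2 * (cmod (f x))\<^sup>2 + 2 * (cmod (g x))\<^sup>2"
        using sum_squares_bound[of "cmod (f x)" "cmod (g x)"] by (simp add: power2_sum)
      finally show "norm ((cmod (f x + g x))\<^sup>2) \<le> norm (2 * (cmod (f x))\<^sup>2 + 2 * (cmod (g x))\<^sup>2)" by simp
    qed
  qed (use assms in \<open>auto intro!: L2_integrable\<close>)
qed

lemma L2_diff: "f \<in> L2 \<Longrightarrow> g \<in> L2 \<Longrightarrow> (\<lambda>x. f x - g x) \<in> L2"
  using L2_add[of f "\<lambda>x. (-1) * g x"] L2_cmult[of g "-1"] by simp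

lemma L2_sum: "(\<And>i. i \<in> S \<Longrightarrow> f i \<in> L2) \<Longrightarrow> (\<lambda>x. \<Sum>i\<in>S. f i x) \<in> L2"
  by (induction S rule: infinite_finite_induct) (auto intro: L2_zero L2_add)

lemma L2_mult_integrable:
  assumes "f \<in> L2" "g \<in> L2" shows "integrable lebesgue (\<lambda>x. f x * g x)"
proof (rule Bochner_Integration.integrable_bound[where f = "\<lambda>x. (cmod (f x))\<^sup>2 + (cmod (g x))\<^sup>2"])
  note [measurable] = assms[THEN L2_measurable]
  show "(\<lambda>x. f x * g x) \<in> borel_measurable lebesgue" by measurable
  show "AE x in lebesgue. norm (f x * g x) \<le> norm ((cmod (f x))\<^sup>2 + (cmod (g x))\<^sup>2)"
  proof (rule AE_I2)
    fix x
    have "0 \<le> cmod (f x) * cmod (g x)" by simp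
    moreover have "2 * (cmod (f x) * cmod (g x)) \<le> (cmod (f x))\<^sup>2 + (cmod (g x))\<^sup>2"
      using sum_squares_bound[of "cmod (f x)" "cmod (g x)"] by (simp add: mult.assoc)
    ultimately have "cmod (f x) * cmod (g x) \<le> (cmod (f x))\<^sup>2 + (cmod (g x))\<^sup>2" by linarith
    then show "norm (f x * g x) \<le> norm ((cmod (f x))\<^sup>2 + (cmod (g x))\<^sup>2)"
      by (simp add: norm_mult)
  qed
qed (use assms in \<open>auto intro!: L2_integrable\<close>)

lemma L2_inner_integrable: "f \<in> L2 \<Longrightarrow> g \<in> L2 \<Longrightarrow> integrable lebesgue (\<lambda>x. f x * cnj (g x))"
  using L2_mult_integrable[OF _ L2_cnj] .

lemma L2_inner_diff_left:
  "f \<in> L2 \<Longrightarrow> g \<in> L2 \<Longrightarrow> h \<in> L2 \<Longrightarrow> L2_inner (\<lambda>x. f x - g x) h = L2_inner f h - L2_inner g h"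
  by (simp add: L2_inner_def left_diff_distrib L2_inner_integrable)

lemma L2_inner_cmult_left: "L2_inner (\<lambda>x. c * f x) h = c * L2_inner f h"
  by (simp add: L2_inner_def mult.assoc)

lemma L2_inner_commute: "L2_inner g f = cnj (L2_inner f g)"
  unfolding L2_inner_def by (subst Bochner_Integration.integral_cnj[symmetric]) (simp add: mult.commute)

lemma L2_inner_sum_left:
  "(\<And>i. i \<in> S \<Longrightarrow> f i \<in> L2) \<Longrightarrow> h \<in> L2 \<Longrightarrow> L2_inner (\<lambda>x. \<Sum>i\<in>S. f i x) h = (\<Sum>i\<in>S. L2_inner (f i) h)"
  unfolding L2_inner_def sum_distrib_right by (intro Bochner_Integration.integral_sum L2_inner_integrable)

lemma L2_inner_AE_cong:
  assumes [measurable]: "f \<in> borel_measurable lebesgue" "f' \<in> borel_measurable lebesgue"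
    "g \<in> borel_measurable lebesgue" "g' \<in> borel_measurable lebesgue"
    and "AE x in lebesgue. f x = f' x" "AE x in lebesgue. g x = g' x"
  shows "L2_inner f g = L2_inner f' g'"
proof -
  have [measurable]: "cnj \<in> borel_measurable borel"
    by (intro borel_measurable_continuous_onI continuous_intros)
  show ?thesis unfolding L2_inner_def
    by (rule integral_cong_AE) (use assms(5,6) in \<open>auto elim: AE_mp\<close>)
qed

lemma L2_norm_nonneg[simp]: "0 \<le> L2_norm f"
  by (simp add: L2_norm_def)

lemma L2_norm_sq: "(L2_norm f)\<^sup>2 = (LINT x|lebesgue. (cmod (f x))\<^sup>2)"
  by (simp add: L2_norm_def)

lemma L2_norm_sq_inner: "of_real ((L2_norm f)\<^sup>2) = L2_inner f f"
  unfolding L2_norm_sq L2_inner_def by (simp flip: integral_complex_of_real add: complex_norm_square[symmetric])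

lemma L2_nn_integral: "f \<in> L2 \<Longrightarrow> (\<integral>\<^sup>+x. ennreal ((cmod (f x))\<^sup>2) \<partial>lebesgue) = ennreal ((L2_norm f)\<^sup>2)"
  unfolding L2_norm_sq by (intro nn_integral_eq_integral L2_integrable) auto

text \<open>The hypothesis is on the nonnegative integral because a Bochner integral is 0 on a
  function that is not integrable, so a bound on it would not give membership in
  \<open>L2\<close>.\<close>

lemma L2_nn_integralI:
  assumes [measurable]: "f \<in> borel_measurable lebesgue"
    and "(\<integral>\<^sup>+x. ennreal ((cmod (f x))\<^sup>2) \<partial>lebesgue) \<le> ennreal (C\<^sup>2)" "0 \<le> C"
  shows "f \<in> L2" "L2_norm f \<le> C"
proof -
  have "(\<integral>\<^sup>+x. ennreal ((cmod (f x))\<^sup>2) \<partial>lebesgue) < \<infinity>"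
    using assms(2) by (simp add: le_less_trans less_top)
  then show L: "f \<in> L2"
    by (intro L2I integrableI_bounded) auto
  then have "(L2_norm f)\<^sup>2 \<le> C\<^sup>2"
    using assms(2) unfolding L2_nn_integral[OF L] by simp
  then show "L2_norm f \<le> C" using assms(3) power2_le_imp_le by blast
qed

text \<open>This law of cosines is how equality and closeness are proved later: once both norms are
  known, only the real part of an inner product is left to compute.\<close>

lemma L2_norm_diff_sq:
  assumes "f \<in> L2" "g \<in> L2"
  shows "(L2_norm (\<lambda>x. f x - g x))\<^sup>2 = (L2_norm f)\<^sup>2 - 2 * Re (L2_inner f g) + (L2_norm g)\<^sup>2"
proof -
  have "complex_of_real ((L2_norm (\<lambda>x. f x - g x))\<^sup>2) = L2_inner f (\<lambda>x. f x - g x) - L2_inner g (\<lambda>x. f x - g x)"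
    unfolding L2_norm_sq_inner by (intro L2_inner_diff_left L2_diff assms)
  also have "\<dots> = cnj (L2_inner f f - L2_inner g f) - cnj (L2_inner f g - L2_inner g g)"
    by (simp only: L2_inner_commute[of _ "\<lambda>x. f x - g x"] L2_inner_diff_left[OF assms assms(1)] L2_inner_diff_left[OF assms assms(2)])
  also have "\<dots> = complex_of_real ((L2_norm f)\<^sup>2) - (L2_inner f g + cnj (L2_inner f g)) + complex_of_real ((L2_norm g)\<^sup>2)"
    unfolding L2_norm_sq_inner using L2_inner_commute[of f g] L2_inner_commute[of f f] L2_inner_commute[of g g] by simp
  also have "\<dots> = complex_of_real ((L2_norm f)\<^sup>2 - 2 * Re (L2_inner f g) + (L2_norm g)\<^sup>2)"
    by (simp add: complex_add_cnj)
  finally show ?thesis by (simp only: of_real_eq_iff)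
qed

lemma L2_norm_cmult: "L2_norm (\<lambda>x. c * f x) = cmod c * L2_norm f"
  by (simp add: L2_norm_def norm_mult power_mult_distrib real_sqrt_mult)

lemma L2_norm_minus_commute: "L2_norm (\<lambda>x. f x - g x) = L2_norm (\<lambda>x. g x - f x)"
  by (simp add: L2_norm_def norm_minus_commute)

lemma L2_norm_uminus[simp]: "L2_norm (\<lambda>x. - f x) = L2_norm f"
  by (simp add: L2_norm_def)

lemma L2_norm_cnj: "L2_norm (\<lambda>x. cnj (f x)) = L2_norm f"
  by (simp add: L2_norm_def)

lemma L2_norm_eq_0:
  assumes "f \<in> L2" "L2_norm f = 0" shows "AE x in lebesgue. f x = 0"
  using assms integral_nonneg_eq_0_iff_AE[OF L2_integrable[OF assms(1)]] by (simp add: L2_norm_def)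

lemma L2_Cauchy_Schwarz:
  assumes "f \<in> L2" "g \<in> L2"
  shows "cmod (L2_inner f g) \<le> L2_norm f * L2_norm g"
proof -
  note [measurable] = assms[THEN L2_measurable]
  let ?I = "\<integral>\<^sup>+x. ennreal (cmod (f x)) * ennreal (cmod (g x)) \<partial>lebesgue"
  have "ennreal (cmod (L2_inner f g)) \<le> (\<integral>\<^sup>+x. ennreal (cmod (f x * cnj (g x))) \<partial>lebesgue)"
    unfolding L2_inner_def by (intro integral_norm_bound_ennreal L2_inner_integrable assms)
  also have "\<dots> = ?I" by (simp add: norm_mult ennreal_mult)
  finally have "(ennreal (cmod (L2_inner f g)))\<^sup>2 \<le> ?I\<^sup>2"
    by (intro power_mono) auto
  also have "\<dots> \<le> (\<integral>\<^sup>+x. ennreal (cmod (f x)) ^ 2 \<partial>lebesgue) * (\<integral>\<^sup>+x. ennreal (cmod (g x)) ^ 2 \<partial>lebesgue)"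
    by (rule Cauchy_Schwarz_nn_integral) measurable
  also have "\<dots> = ennreal ((L2_norm f * L2_norm g)\<^sup>2)"
    using assms by (simp add: ennreal_power L2_nn_integral ennreal_mult power_mult_distrib)
  finally have "(cmod (L2_inner f g))\<^sup>2 \<le> (L2_norm f * L2_norm g)\<^sup>2"
    by (simp add: ennreal_power)
  then show ?thesis by (rule power2_le_imp_le) simp
qed

lemma L2_norm_triangle_diff:
  assumes "f \<in> L2" "g \<in> L2"
  shows "L2_norm (\<lambda>x. f x - g x) \<le> L2_norm f + L2_norm g"
proof (rule power2_le_imp_le)
  have "- Re (L2_inner f g) \<le> L2_norm f * L2_norm g"
    using L2_Cauchy_Schwarz[OF assms] abs_Re_le_cmod[of "L2_inner f g"] by linarith
  then show "(L2_norm (\<lambda>x. f x - g x))\<^sup>2 \<le> (L2_norm f + L2_norm g)\<^sup>2"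
    unfolding L2_norm_diff_sq[OF assms] by (simp add: power2_sum)
qed simp

lemma L2_norm_triangle3:
  assumes "f \<in> L2" "g \<in> L2" "h \<in> L2"
  shows "L2_norm (\<lambda>x. f x - h x) \<le> L2_norm (\<lambda>x. f x - g x) + L2_norm (\<lambda>x. h x - g x)"
  using L2_norm_triangle_diff[of "\<lambda>x. f x - g x" "\<lambda>x. h x - g x"] assms by (simp add: L2_diff)

section \<open>Convergence in the L2 norm\<close>

lemma L2_tendsto_norm:
  assumes "L2_tendsto u f F"
  shows "((\<lambda>i. L2_norm (u i)) \<longlongrightarrow> L2_norm f) F"
proof -
  have "eventually (\<lambda>i. norm (L2_norm (u i) - L2_norm f) \<le> L2_norm (\<lambda>x. u i x - f x)) F"
    using assms unfolding L2_tendsto_def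
  proof (elim conjE, elim eventually_mono)
    fix i assume "f \<in> L2" "u i \<in> L2"
    then show "norm (L2_norm (u i) - L2_norm f) \<le> L2_norm (\<lambda>x. u i x - f x)"
      using L2_norm_triangle3[OF _ _ L2_zero, of "u i" f] L2_norm_triangle3[OF _ _ L2_zero, of f "u i"]
      by (simp add: L2_norm_minus_commute[of f "u i"])
  qed
  then have "((\<lambda>i. L2_norm (u i) - L2_norm f) \<longlongrightarrow> 0) F"
    by (rule Lim_null_comparison) (use assms in \<open>auto simp: L2_tendsto_def\<close>)
  then show ?thesis by (simp add: LIM_zero_iff)
qed

lemma L2_tendsto_inner:
  assumes "L2_tendsto u f F" "L2_tendsto v g F"
  shows "((\<lambda>i. L2_inner (u i) (v i)) \<longlongrightarrow> L2_inner f g) F"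
proof -
  have fg: "f \<in> L2" "g \<in> L2" using assms by (auto simp: L2_tendsto_def)
  have "eventually (\<lambda>i. u i \<in> L2 \<and> v i \<in> L2) F"
    using assms unfolding L2_tendsto_def by (auto intro: eventually_conj)
  then have "eventually (\<lambda>i. norm (L2_inner (u i) (v i) - L2_inner f g) \<le>
      L2_norm (\<lambda>x. u i x - f x) * L2_norm (v i) + L2_norm f * L2_norm (\<lambda>x. v i x - g x)) F"
  proof (rule eventually_mono)
    fix i assume i: "u i \<in> L2 \<and> v i \<in> L2"
    have "L2_inner (u i) (v i) - L2_inner f g = L2_inner (\<lambda>x. u i x - f x) (v i) + cnj (L2_inner (\<lambda>x. v i x - g x) f)"
      using i fg by (simp add: L2_inner_diff_left L2_inner_commute[of f])
    also have "norm \<dots> \<le> L2_norm (\<lambda>x. u i x - f x) * L2_norm (v i) + L2_norm (\<lambda>x. v i x - g x) * L2_norm f"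
      using i fg by (intro norm_triangle_le add_mono) (auto intro!: L2_Cauchy_Schwarz L2_diff)
    finally show "norm (L2_inner (u i) (v i) - L2_inner f g) \<le>
      L2_norm (\<lambda>x. u i x - f x) * L2_norm (v i) + L2_norm f * L2_norm (\<lambda>x. v i x - g x)"
      by (simp add: mult.commute)
  qed
  moreover have "((\<lambda>i. L2_norm (\<lambda>x. u i x - f x) * L2_norm (v i) + L2_norm f * L2_norm (\<lambda>x. v i x - g x)) \<longlongrightarrow> 
      0 * L2_norm g + L2_norm f * 0) F"
    using assms by (intro tendsto_intros L2_tendsto_norm) (auto simp: L2_tendsto_def)
  ultimately have "((\<lambda>i. L2_inner (u i) (v i) - L2_inner f g) \<longlongrightarrow> 0) F"
    by (simp only: add_0 mult_zero_left mult_zero_right) (erule Lim_null_comparison)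
  then show ?thesis by (simp add: LIM_zero_iff)
qed

lemma L2_tendsto_cmult:
  assumes "L2_tendsto u f F" shows "L2_tendsto (\<lambda>i x. c * u i x) (\<lambda>x. c * f x) F"
  unfolding L2_tendsto_def
proof (intro conjI)
  show "eventually (\<lambda>i. (\<lambda>x. c * u i x) \<in> L2) F"
    using assms unfolding L2_tendsto_def by (auto elim!: eventually_mono intro: L2_cmult)
  have "((\<lambda>i. cmod c * L2_norm (\<lambda>x. u i x - f x)) \<longlongrightarrow> cmod c * 0) F"
    using assms by (intro tendsto_intros) (auto simp: L2_tendsto_def)
  then show "((\<lambda>i. L2_norm (\<lambda>x. c * u i x - c * f x)) \<longlongrightarrow> 0) F"
    by (simp add: L2_norm_cmult flip: right_diff_distrib)
qed (use assms in \<open>auto simp: L2_tendsto_def intro: L2_cmult\<close>)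

lemma L2_tendsto_diff:
  assumes "L2_tendsto u f F" "L2_tendsto v g F"
  shows "L2_tendsto (\<lambda>i x. u i x - v i x) (\<lambda>x. f x - g x) F"
  unfolding L2_tendsto_def
proof (intro conjI)
  have ev: "eventually (\<lambda>i. u i \<in> L2 \<and> v i \<in> L2) F"
    using assms unfolding L2_tendsto_def by (auto intro: eventually_conj)
  then show "eventually (\<lambda>i. (\<lambda>x. u i x - v i x) \<in> L2) F"
    by (rule eventually_mono) (auto intro: L2_diff)
  show "(\<lambda>x. f x - g x) \<in> L2"
    using assms by (auto simp: L2_tendsto_def intro: L2_diff)
  have "eventually (\<lambda>i. norm (L2_norm (\<lambda>x. u i x - v i x - (f x - g x))) \<le> L2_norm (\<lambda>x. u i x - f x) + L2_norm (\<lambda>x. v i x - g x)) F"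
    using ev
  proof (rule eventually_mono)
    fix i assume i: "u i \<in> L2 \<and> v i \<in> L2"
    have eq: "(\<lambda>x. u i x - v i x - (f x - g x)) = (\<lambda>x. (u i x - f x) - (v i x - g x))" by auto
    show "norm (L2_norm (\<lambda>x. u i x - v i x - (f x - g x))) \<le> L2_norm (\<lambda>x. u i x - f x) + L2_norm (\<lambda>x. v i x - g x)"
      unfolding eq using i assms L2_norm_triangle_diff[of "\<lambda>x. u i x - f x" "\<lambda>x. v i x - g x"]
      by (auto simp: L2_tendsto_def L2_diff)
  qed
  moreover have "((\<lambda>i. L2_norm (\<lambda>x. u i x - f x) + L2_norm (\<lambda>x. v i x - g x)) \<longlongrightarrow> 0 + 0) F"
    using assms by (intro tendsto_intros) (auto simp: L2_tendsto_def)
  ultimately show "((\<lambda>i. L2_norm (\<lambda>x. u i x - v i x - (f x - g x))) \<longlongrightarrow> 0) F"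
    by (simp only: add_0 mult_zero_left mult_zero_right) (erule Lim_null_comparison)
qed

lemma L2_tendsto_cnj:
  assumes "L2_tendsto u f F" shows "L2_tendsto (\<lambda>i x. cnj (u i x)) (\<lambda>x. cnj (f x)) F"
  using assms L2_norm_cnj[of "\<lambda>x. u i x - f x" for i] unfolding L2_tendsto_def
  by (auto intro: L2_cnj elim!: eventually_mono)

section \<open>Fatou's lemma and completeness of L2\<close>

lemma L2_Fatou:
  assumes [measurable]: "\<And>k. u k \<in> borel_measurable lebesgue" "f \<in> borel_measurable lebesgue"
    and lim: "AE x in lebesgue. (\<lambda>k. u k x) \<longlonglongrightarrow> f x"
    and bd: "eventually (\<lambda>k. u k \<in> L2 \<and> L2_norm (u k) \<le> C) sequentially"
    and C: "0 \<le> C"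
  shows "f \<in> L2" "L2_norm f \<le> C"
proof -
  have "(\<integral>\<^sup>+x. ennreal ((cmod (f x))\<^sup>2) \<partial>lebesgue) = (\<integral>\<^sup>+x. liminf (\<lambda>k. ennreal ((cmod (u k x))\<^sup>2)) \<partial>lebesgue)"
  proof (rule nn_integral_cong_AE, use lim in eventually_elim)
    case (elim x)
    then have "(\<lambda>k. ennreal ((cmod (u k x))\<^sup>2)) \<longlonglongrightarrow> ennreal ((cmod (f x))\<^sup>2)"
      by (intro tendsto_intros)
    then show ?case by (rule lim_imp_Liminf[OF trivial_limit_sequentially, symmetric])
  qed
  also have "\<dots> \<le> liminf (\<lambda>k. \<integral>\<^sup>+x. ennreal ((cmod (u k x))\<^sup>2) \<partial>lebesgue)"
    by (rule nn_integral_liminf) measurable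
  \<comment> \<open>The bound holds only from some index on, which is enough for the upper
    limit.\<close>
  also have "\<dots> \<le> limsup (\<lambda>k. \<integral>\<^sup>+x. ennreal ((cmod (u k x))\<^sup>2) \<partial>lebesgue)"
    by (rule Liminf_le_Limsup) simp
  also have "\<dots> \<le> ennreal (C\<^sup>2)"
    by (rule Limsup_bounded, use bd in eventually_elim) (auto simp: L2_nn_integral intro!: ennreal_leI power_mono)
  finally have *: "(\<integral>\<^sup>+x. ennreal ((cmod (f x))\<^sup>2) \<partial>lebesgue) \<le> ennreal (C\<^sup>2)" .
  show "f \<in> L2" "L2_norm f \<le> C"
    using L2_nn_integralI[OF _ * C] by auto
qed

text \<open>The space has infinite measure, so the \<open>d k\<close> need not be integrable and
  their L1 norms cannot be summed. Their squares can: with the weight 2^k the integrals are at most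
  2^k 4^(-k) = 2^(-k), so the weighted sum of squares is finite almost everywhere.\<close>

lemma L2_summable_differences_convergent:
  assumes "\<And>k. d k \<in> L2" "\<And>k. L2_norm (d k) \<le> (1/2) ^ k"
  shows "AE x in lebesgue. summable (\<lambda>k. d k x)"
proof -
  note [measurable] = assms(1)[THEN L2_measurable]
  have "(\<integral>\<^sup>+x. (\<Sum>k. ennreal (2 ^ k * (cmod (d k x))\<^sup>2)) \<partial>lebesgue) = (\<Sum>k. \<integral>\<^sup>+x. ennreal (2 ^ k * (cmod (d k x))\<^sup>2) \<partial>lebesgue)"
    by (intro nn_integral_suminf) measurable
  also have "\<dots> \<le> (\<Sum>k. ennreal ((1/2) ^ k))"
  proof (intro suminf_le)
    fix k
    have "(\<integral>\<^sup>+x. ennreal (2 ^ k * (cmod (d k x))\<^sup>2) \<partial>lebesgue) = ennreal (2 ^ k * (L2_norm (d k))\<^sup>2)"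
      by (subst ennreal_mult) (auto simp: nn_integral_cmult L2_nn_integral assms(1) ennreal_mult)
    also have "\<dots> \<le> ennreal (2 ^ k * ((1/2) ^ k)\<^sup>2)"
      by (intro ennreal_leI mult_left_mono power_mono assms) auto
    also have "2 ^ k * ((1/2) ^ k)\<^sup>2 = (1/2 :: real) ^ k"
      by (simp add: power2_eq_square field_simps)
    finally show "(\<integral>\<^sup>+x. ennreal (2 ^ k * (cmod (d k x))\<^sup>2) \<partial>lebesgue) \<le> ennreal ((1/2) ^ k)" .
  qed auto
  also have "\<dots> = ennreal (\<Sum>k. (1/2) ^ k)"
    by (intro suminf_ennreal2) (auto intro: summable_geometric)
  also have "\<dots> < \<infinity>" by simp
  finally have "AE x in lebesgue. (\<Sum>k. ennreal (2 ^ k * (cmod (d k x))\<^sup>2)) \<noteq> \<infinity>"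
    by (intro nn_integral_PInf_AE) auto
  then show ?thesis
  proof eventually_elim
    case (elim x)
    then have s: "summable (\<lambda>k. 2 ^ k * (cmod (d k x))\<^sup>2)"
      by (intro summable_suminf_not_top) auto
    show ?case
    proof (rule summable_comparison_test'[of "\<lambda>k. (1/2) ^ k + 2 ^ k * (cmod (d k x))\<^sup>2" 0])
      show "summable (\<lambda>k. (1/2) ^ k + 2 ^ k * (cmod (d k x))\<^sup>2)"
        by (intro summable_add s summable_geometric) auto
      fix k
      \<comment> \<open>AM-GM: \<open>t \<le> q + t\<^sup>2 / q\<close> with \<open>q = 2^-k\<close>\<close>
      have "0 \<le> ((1/2) ^ k - cmod (d k x))\<^sup>2" by simp
      then have "2 * (1/2) ^ k * cmod (d k x) \<le> ((1/2) ^ k)\<^sup>2 + (cmod (d k x))\<^sup>2"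
        by (simp add: power2_diff)
      then have "2 ^ k * (2 * (1/2) ^ k * cmod (d k x)) \<le> 2 ^ k * (((1/2) ^ k)\<^sup>2 + (cmod (d k x))\<^sup>2)"
        by (intro mult_left_mono) auto
      moreover have "2 ^ k * (2 * (1/2) ^ k * cmod (d k x)) = 2 * cmod (d k x)"
          "2 ^ k * ((1/2) ^ k)\<^sup>2 = (1/2 :: real) ^ k"
        by (simp_all add: power2_eq_square field_simps)
      ultimately have "2 * cmod (d k x) \<le> (1/2) ^ k + 2 ^ k * (cmod (d k x))\<^sup>2"
        by (simp add: distrib_left)
      then show "norm (d k x) \<le> (1/2) ^ k + 2 ^ k * (cmod (d k x))\<^sup>2"
        using norm_ge_zero[of "d k x"] by linarith
    qed
  qed
qed

text \<open>Riesz-Fischer: a subsequence with geometrically small steps converges almost everywhere,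
  and Fatou's lemma shows that its pointwise limit is also the limit in norm of the whole
  sequence.\<close>

theorem L2_complete:
  assumes u: "\<And>k. u k \<in> L2"
    and Cauchy: "\<And>e. 0 < e \<Longrightarrow> \<exists>N. \<forall>m\<ge>N. \<forall>n\<ge>N. L2_norm (\<lambda>x. u m x - u n x) \<le> e"
  obtains f where "L2_tendsto u f sequentially"
proof -
  note [measurable] = u[THEN L2_measurable]
  have "\<exists>N. \<forall>m\<ge>N. \<forall>n\<ge>N. L2_norm (\<lambda>x. u m x - u n x) \<le> (1/2) ^ k" for k
    by (rule Cauchy) simp
  then obtain N where N: "\<And>k m n. m \<ge> N k \<Longrightarrow> n \<ge> N k \<Longrightarrow> L2_norm (\<lambda>x. u m x - u n x) \<le> (1/2) ^ k"
    by metis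
  \<comment> \<open>The sum dominates \<open>N k\<close> and makes \<open>r\<close> monotone; the
    added \<open>k\<close> forces \<open>r\<close> to infinity, so that the bounds valid beyond an
    index \<open>M\<close> eventually hold along \<open>r\<close>.\<close>
  define r where "r k = (\<Sum>i\<le>k. N i) + k" for k
  have rN: "r k \<ge> N k" for k unfolding r_def by (induction k) auto
  have rmono: "r k \<le> r (Suc k)" for k by (simp add: r_def)
  have rk: "r k \<ge> k" for k by (simp add: r_def)
  define d where "d k x = u (r (Suc k)) x - u (r k) x" for k x
  have "AE x in lebesgue. summable (\<lambda>k. d k x)"
  proof (rule L2_summable_differences_convergent)
    show "d k \<in> L2" for k unfolding d_def by (intro L2_diff u)
    show "L2_norm (d k) \<le> (1/2) ^ k" for k
      unfolding d_def by (intro N) (use rN[of k] rmono[of k] in auto)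
  qed
  define f where "f x = lim (\<lambda>k. u (r k) x)" for x
  have [measurable]: "f \<in> borel_measurable lebesgue"
    unfolding f_def by (intro borel_measurable_lim_metric) measurable
  have lim: "AE x in lebesgue. (\<lambda>k. u (r k) x) \<longlonglongrightarrow> f x"
    using \<open>AE x in lebesgue. summable (\<lambda>k. d k x)\<close>
  proof eventually_elim
    case (elim x)
    then have "convergent (\<lambda>k. \<Sum>i<k. d i x)" by (simp add: summable_iff_convergent)
    moreover have "(\<Sum>i<k. d i x) = u (r k) x - u (r 0) x" for k
      unfolding d_def by (rule sum_lessThan_telescope)
    ultimately have "convergent (\<lambda>k. u (r k) x)" by (simp add: convergent_diff_const_right_iff)
    then show ?case unfolding f_def by (simp add: convergent_LIMSEQ_iff)
  qed
  \<comment> \<open>Keep \<open>m\<close> fixed and let the second index run along the subsequence: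
    the Cauchy bound survives in the limit.\<close>
  have fat: "(\<lambda>x. u m x - f x) \<in> L2 \<and> L2_norm (\<lambda>x. u m x - f x) \<le> e" 
    if "e > 0" "\<forall>m\<ge>M. \<forall>n\<ge>M. L2_norm (\<lambda>x. u m x - u n x) \<le> e" "m \<ge> M" for e M m
  proof -
    have l: "AE x in lebesgue. (\<lambda>k. u m x - u (r k) x) \<longlonglongrightarrow> u m x - f x"
      using lim by eventually_elim (intro tendsto_intros)
    have e: "eventually (\<lambda>k. (\<lambda>x. u m x - u (r k) x) \<in> L2 \<and> L2_norm (\<lambda>x. u m x - u (r k) x) \<le> e) sequentially"
      using eventually_ge_at_top[of M]
    proof eventually_elim
      case (elim k)
      then show ?case using that u rk[of k] by (auto intro: L2_diff)
    qed
    show ?thesis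
      using L2_Fatou[OF _ _ l e] that(1) by auto
  qed
  have "f \<in> L2"
  proof -
    obtain M where M: "\<forall>m\<ge>M. \<forall>n\<ge>M. L2_norm (\<lambda>x. u m x - u n x) \<le> 1" using Cauchy[of 1] by auto
    have "(\<lambda>x. u M x - f x) \<in> L2" using fat[OF _ M] by auto
    from L2_diff[OF u[of M] this] show ?thesis by simp
  qed
  moreover have "(\<lambda>m. L2_norm (\<lambda>x. u m x - f x)) \<longlonglongrightarrow> 0"
  proof (rule LIMSEQ_I)
    fix e :: real assume "e > 0"
    then obtain M where M: "\<forall>m\<ge>M. \<forall>n\<ge>M. L2_norm (\<lambda>x. u m x - u n x) \<le> e/2" using Cauchy[of "e/2"] by auto
    show "\<exists>M. \<forall>m\<ge>M. norm (L2_norm (\<lambda>x. u m x - f x) - 0) < e"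
      using fat[OF _ M] \<open>e > 0\<close> by (intro exI[of _ M]) fastforce
  qed
  ultimately show ?thesis using that u by (auto simp: L2_tendsto_def)
qed

section \<open>Completeness of the exponentials on a period cell\<close>

definition int_vec :: "int ^ 'd \<Rightarrow> real ^ 'd" where
  "int_vec n = (\<chi> i. real_of_int (n $ i))"

lemma int_vec_simps[simp]:
  "int_vec n $ i = of_int (n $ i)" "int_vec 0 = 0" "int_vec (m + n) = int_vec m + int_vec n"
  "int_vec (- n) = - int_vec n" "int_vec (m - n) = int_vec m - int_vec n"
  by (simp_all add: int_vec_def vec_eq_iff)

definition echar :: "int ^ 'd \<Rightarrow> real ^ 'd \<Rightarrow> complex" where
  "echar n y = cis (int_vec n \<bullet> y)"

lemma echar_simps[simp]:
  "echar 0 y = 1" "cmod (echar n y) = 1"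
  by (simp_all add: echar_def)

lemma echar_add: "echar (m + n) y = echar m y * echar n y"
  by (simp add: echar_def inner_add_left cis_mult)

lemma cnj_echar: "cnj (echar n y) = echar (- n) y"
  by (simp add: echar_def cis_cnj)

lemma continuous_on_echar[continuous_intros]: "continuous_on S (echar n)"
  unfolding echar_def[abs_def] cis_conv_exp by (intro continuous_intros)

lemma borel_measurable_echar[measurable]: "echar n \<in> borel_measurable borel"
  by (intro borel_measurable_continuous_onI continuous_intros)

lemma borel_measurable_lebesgue_echar[measurable]: "echar n \<in> borel_measurable lebesgue"
  by (simp add: measurable_completion)

inductive_set trig_poly :: "(real ^ 'd \<Rightarrow> complex) set" where
  char: "echar n \<in> trig_poly"
| add: "p \<in> trig_poly \<Longrightarrow> q \<in> trig_poly \<Longrightarrow> (\<lambda>y. p y + q y) \<in> trig_poly"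
| cmult: "p \<in> trig_poly \<Longrightarrow> (\<lambda>y. c * p y) \<in> trig_poly"

lemma trig_poly_const: "(\<lambda>y. c) \<in> trig_poly"
  using trig_poly.cmult[OF trig_poly.char[of 0], of c] by simp

lemma trig_poly_mult:
  assumes "p \<in> trig_poly" "q \<in> trig_poly" shows "(\<lambda>y. p y * q y) \<in> trig_poly"
  using assms(1)
proof induction
  case (char n)
  show ?case using assms(2)
  proof induction
    case (char m)
    then show ?case using trig_poly.char[of "n + m"] by (simp add: echar_add[abs_def])
  next
    case (add p q)
    then show ?case using trig_poly.add by (simp add: distrib_left)
  next
    case (cmult p c)
    from trig_poly.cmult[OF cmult(2), of c] show ?case by (simp add: mult.left_commute)
  qed
next
  case (add p q)
  then show ?case using trig_poly.add by (simp add: distrib_right)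
next
  case (cmult p c)
  from trig_poly.cmult[OF cmult(2), of c] show ?case by (simp add: mult.assoc)
qed

lemma trig_poly_sum: "(\<And>i. i \<in> S \<Longrightarrow> p i \<in> trig_poly) \<Longrightarrow> (\<lambda>y. \<Sum>i\<in>S. p i y) \<in> trig_poly"
  by (induction S rule: infinite_finite_induct) (auto intro: trig_poly_const trig_poly.add)

text \<open>Represents a point modulo 2 pi in each coordinate by a point of a compact subset of C^d.
  Periodic functions thus become functions on a compact set of a Euclidean space, where
  Stone-Weierstrass provides polynomials in the real coordinates.\<close>

definition torus_map :: "real ^ 'd \<Rightarrow> complex ^ 'd" where
  "torus_map y = (\<chi> i. cis (y $ i))"

lemma continuous_on_torus_map[continuous_intros]: "continuous_on S torus_map"
  unfolding torus_map_def[abs_def] cis_conv_exp by (intro continuous_intros continuous_on_vec_lambda)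

lemma torus_map_measurable[measurable]: "torus_map \<in> borel_measurable borel"
  by (intro borel_measurable_continuous_onI continuous_intros)

lemma torus_map_measurable_lebesgue[measurable]: "torus_map \<in> borel_measurable lebesgue"
  by (simp add: measurable_completion)

lemma int_vec_axis_inner: "int_vec (axis i k) \<bullet> y = of_int k * y $ i"
proof -
  have "(\<Sum>j\<in>UNIV. real_of_int (axis i k $ j) * y $ j) = (\<Sum>j\<in>UNIV. if j = i then of_int k * y $ i else 0)"
    by (intro sum.cong) (auto simp: axis_def)
  then show ?thesis by (simp add: inner_vec_def)
qed

lemma trig_poly_cos_sin:
  "(\<lambda>y. complex_of_real (cos (y $ i))) \<in> trig_poly" "(\<lambda>y. complex_of_real (sin (y $ i))) \<in> trig_poly"
proof -
  have e: "echar (axis i k) y = cis (of_int k * y $ i)" for k y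
    by (simp add: echar_def int_vec_axis_inner)
  have "(\<lambda>y. 1/2 * (echar (axis i 1) y + echar (axis i (-1)) y)) \<in> trig_poly"
    by (intro trig_poly.intros)
  also have "(\<lambda>y. 1/2 * (echar (axis i 1) y + echar (axis i (-1)) y)) = (\<lambda>y. complex_of_real (cos (y $ i)))"
    by (auto simp: e complex_eq_iff fun_eq_iff)
  finally show "(\<lambda>y. complex_of_real (cos (y $ i))) \<in> trig_poly" .
  have "(\<lambda>y. (- \<i>/2) * (echar (axis i 1) y + (-1) * echar (axis i (-1)) y)) \<in> trig_poly"
    by (intro trig_poly.intros)
  also have "(\<lambda>y. (- \<i>/2) * (echar (axis i 1) y + (-1) * echar (axis i (-1)) y)) = (\<lambda>y. complex_of_real (sin (y $ i)))"
    by (auto simp: e complex_eq_iff fun_eq_iff)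
  finally show "(\<lambda>y. complex_of_real (sin (y $ i))) \<in> trig_poly" .
qed

lemma real_polynomial_trig_poly:
  assumes "real_polynomial_function q"
  shows "(\<lambda>y. complex_of_real (q (torus_map y))) \<in> trig_poly"
  using assms
proof induction
  case (linear f)
  interpret bounded_linear f by fact
  \<comment> \<open>Over the reals the coordinates of C^d are the real and imaginary parts, which
    \<open>torus_map\<close> turns into cosines and sines.\<close>
  have "f z = (\<Sum>i\<in>UNIV. Re (z $ i) * f (axis i 1) + Im (z $ i) * f (axis i \<i>))" for z
  proof -
    have "z = (\<Sum>i\<in>UNIV. Re (z $ i) *\<^sub>R axis i 1 + Im (z $ i) *\<^sub>R axis i \<i>)"
    proof -
      have "(\<Sum>i\<in>UNIV. Re (z $ i) *\<^sub>R axis i 1 $ k + Im (z $ i) *\<^sub>R axis i \<i> $ k) = (\<Sum>i\<in>UNIV. if i = k then z $ k else 0)" for k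
        by (intro sum.cong) (auto simp: axis_def complex_eq_iff)
      then show ?thesis by (simp add: vec_eq_iff)
    qed
    then have "f z = f (\<Sum>i\<in>UNIV. Re (z $ i) *\<^sub>R axis i 1 + Im (z $ i) *\<^sub>R axis i \<i>)" by simp
    then show ?thesis by (simp add: sum add scaleR)
  qed
  note f = this
  have "(\<lambda>y. \<Sum>i\<in>UNIV. complex_of_real (f (axis i 1)) * complex_of_real (cos (y $ i)) + 
       complex_of_real (f (axis i \<i>)) * complex_of_real (sin (y $ i))) \<in> trig_poly"
    by (intro trig_poly_sum trig_poly.add trig_poly.cmult trig_poly_cos_sin)
  then show ?case
    by (subst f) (simp add: torus_map_def mult.commute)
next
  case (const c)
  then show ?case by (simp add: trig_poly_const)
next
  case (add f g)
  then show ?case using trig_poly.add by simp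
next
  case (mult f g)
  then show ?case using trig_poly_mult by simp
qed

lemma trig_poly_bounded:
  "p \<in> trig_poly \<Longrightarrow> continuous_on UNIV p \<and> (\<exists>B. \<forall>y. cmod (p y) \<le> B)"
proof (induction rule: trig_poly.induct)
  case (char n)
  then show ?case by (auto intro!: continuous_intros)
next
  case (add p q)
  then obtain B C where B: "\<And>y. cmod (p y) \<le> B" and C: "\<And>y. cmod (q y) \<le> C" by blast
  have "cmod (p y + q y) \<le> B + C" for y
    using norm_triangle_ineq[of "p y" "q y"] B[of y] C[of y] by linarith
  then show ?case using add by (auto intro!: continuous_intros)
next
  case (cmult p c)
  then obtain B where B: "\<And>y. cmod (p y) \<le> B" by blast
  have "cmod (c * p y) \<le> cmod c * B" for y
    using B[of y] by (simp add: norm_mult mult_left_mono)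
  then show ?case using cmult by (auto intro!: continuous_intros)
qed

lemma integrable_mult_bounded:
  fixes f g :: "'a \<Rightarrow> complex"
  assumes "integrable M f" "g \<in> borel_measurable M" "\<And>y. cmod (g y) \<le> B"
  shows "integrable M (\<lambda>y. f y * g y)"
proof (rule Bochner_Integration.integrable_bound[where f = "\<lambda>y. B * cmod (f y)"])
  show "integrable M (\<lambda>y. B * cmod (f y))" using assms(1) by simp
  show "AE y in M. norm (f y * g y) \<le> norm (B * cmod (f y))"
  proof (rule AE_I2)
    fix y
    have "cmod (f y) * cmod (g y) \<le> cmod (f y) * B" by (intro mult_left_mono assms) simp
    also have "\<dots> \<le> \<bar>B * cmod (f y)\<bar>" by (simp add: mult.commute)
    finally show "norm (f y * g y) \<le> norm (B * cmod (f y))" by (simp add: norm_mult)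
  qed
qed (use assms in auto)

lemma integral_trig_poly_zero:
  assumes f: "integrable lebesgue f" and z: "\<And>n. (LINT y|lebesgue. f y * echar n y) = 0"
    and "p \<in> trig_poly"
  shows "(LINT y|lebesgue. f y * p y) = 0"
  using assms(3)
proof induction
  case (add p q)
  have "integrable lebesgue (\<lambda>y. f y * p y)" if p: "p \<in> trig_poly" for p
  proof -
    obtain B where "\<And>y. cmod (p y) \<le> B" using trig_poly_bounded[OF p] by blast
    moreover have "p \<in> borel_measurable lebesgue"
      using trig_poly_bounded[OF p] by (simp add: borel_measurable_continuous_onI measurable_completion)
    ultimately show ?thesis by (intro integrable_mult_bounded[OF f])
  qed
  then show ?case using add by (simp add: distrib_left)
next
  case (cmult p c)
  then show ?case by (simp add: mult.left_commute)
qed (rule z)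

text \<open>On the compact torus \<open>g\<close> is uniformly close to a polynomial, whose
  composition with \<open>torus_map\<close> is a trigonometric polynomial and hence annihilated by
  \<open>f\<close>. The error is at most the accuracy times the L1 norm of \<open>f\<close>.\<close>

lemma integral_torus_continuous_zero:
  fixes f :: "real ^ 'd \<Rightarrow> complex"
  assumes f: "integrable lebesgue f" and z: "\<And>n. (LINT y|lebesgue. f y * echar n y) = 0"
    and g: "continuous_on UNIV (g :: complex ^ 'd \<Rightarrow> real)"
  shows "(LINT y|lebesgue. f y * of_real (g (torus_map y))) = 0"
proof -
  define T where "T = {z :: complex ^ 'd. \<forall>i. cmod (z $ i) = 1}"
  have "compact T"
  proof -
    have "closed T" unfolding T_def by (intro closed_Collect_all closed_Collect_eq continuous_intros)
    moreover have "bounded T"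
    proof (rule boundedI)
      fix z assume "z \<in> T"
      then show "norm z \<le> (\<Sum>i\<in>(UNIV :: 'd set). 1)"
        unfolding norm_vec_def T_def by (intro order_trans[OF L2_set_le_sum]) auto
    qed
    ultimately show ?thesis by (simp add: compact_eq_bounded_closed)
  qed
  have ET: "torus_map y \<in> T" for y by (simp add: T_def torus_map_def)
  have gm: "(\<lambda>y. complex_of_real (g (torus_map y))) \<in> borel_measurable lebesgue"
    using borel_measurable_continuous_onI[OF g] by measurable
  have small: "cmod (LINT y|lebesgue. f y * of_real (g (torus_map y))) \<le> e * (LINT y|lebesgue. cmod (f y))" if e: "e > 0" for e
  proof -
    obtain q where q: "real_polynomial_function q" "\<And>z. z \<in> T \<Longrightarrow> \<bar>g z - q z\<bar> < e"
      using Stone_Weierstrass_real_polynomial_function[OF \<open>compact T\<close> continuous_on_subset[OF g subset_UNIV] e] by blast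
    let ?p = "\<lambda>y. complex_of_real (q (torus_map y))"
    have p: "?p \<in> trig_poly" by (rule real_polynomial_trig_poly[OF q(1)])
    obtain B where B: "\<And>y. cmod (?p y) \<le> B" using trig_poly_bounded[OF p] by blast
    have pm: "?p \<in> borel_measurable lebesgue"
      using trig_poly_bounded[OF p] by (simp add: borel_measurable_continuous_onI measurable_completion)
    have close: "cmod (of_real (g (torus_map y)) - ?p y) \<le> e" for y
      using q(2)[OF ET[of y]] by (simp flip: of_real_diff)
    have i1: "integrable lebesgue (\<lambda>y. f y * (of_real (g (torus_map y)) - ?p y))"
      by (intro integrable_mult_bounded[OF f _ close] borel_measurable_diff gm pm)
    have i2: "integrable lebesgue (\<lambda>y. f y * ?p y)"
      by (intro integrable_mult_bounded[OF f pm B])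
    have "(LINT y|lebesgue. f y * of_real (g (torus_map y))) =
        (LINT y|lebesgue. f y * (of_real (g (torus_map y)) - ?p y) + f y * ?p y)"
      by (simp add: algebra_simps)
    also have "\<dots> = (LINT y|lebesgue. f y * (of_real (g (torus_map y)) - ?p y))"
      using integral_trig_poly_zero[OF f z p] by (subst Bochner_Integration.integral_add[OF i1 i2]) simp
    also have "cmod \<dots> \<le> (LINT y|lebesgue. cmod (f y * (of_real (g (torus_map y)) - ?p y)))"
      by (rule integral_norm_bound)
    also have "\<dots> \<le> (LINT y|lebesgue. e * cmod (f y))"
    proof (rule integral_mono)
      show "integrable lebesgue (\<lambda>y. cmod (f y * (of_real (g (torus_map y)) - ?p y)))" using i1 by simp
      show "integrable lebesgue (\<lambda>y. e * cmod (f y))" using f by simp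
      show "cmod (f y * (of_real (g (torus_map y)) - ?p y)) \<le> e * cmod (f y)" for y
        using mult_right_mono[OF close[of y], of "cmod (f y)"] by (simp add: norm_mult mult.commute)
    qed
    finally show ?thesis by simp
  qed
  have "cmod (LINT y|lebesgue. f y * of_real (g (torus_map y))) \<le> 0 + e" if "e > 0" for e
  proof -
    define N where "N = (LINT y|lebesgue. cmod (f y))"
    have N: "0 \<le> N" unfolding N_def by simp
    \<comment> \<open>Dividing by N + 1 covers the case N = 0.\<close>
    have "cmod (LINT y|lebesgue. f y * of_real (g (torus_map y))) \<le> e / (N + 1) * N"
      unfolding N_def[symmetric] using that N by (intro small[folded N_def]) (simp add: add_nonneg_pos)
    also have "\<dots> = e * (N / (N + 1))" by simp
    also have "\<dots> \<le> e * 1" using that N by (intro mult_left_mono) auto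
    finally show ?thesis by simp
  qed
  then have "cmod (LINT y|lebesgue. f y * of_real (g (torus_map y))) \<le> 0" by (rule field_le_epsilon)
  then show ?thesis by simp
qed

text \<open>Half-open, so that a shifted cell is, point by point, a rearrangement of the cell modulo
  2 pi. The orthogonality of the characters depends on this.\<close>

definition period_cell :: "(real ^ 'd) set" where
  "period_cell = {y. \<forall>i. - pi \<le> y $ i \<and> y $ i < pi}"

lemma period_cell_measurable[measurable]: "period_cell \<in> sets borel" "period_cell \<in> sets lebesgue"
proof -
  have [measurable]: "(\<lambda>y::real ^ 'd. y $ i) \<in> borel_measurable borel" for i
    by (intro borel_measurable_continuous_onI continuous_intros)
  show b: "period_cell \<in> sets (borel :: (real ^ 'd) measure)" unfolding period_cell_def by measurable
  show "period_cell \<in> sets (lebesgue :: (real ^ 'd) measure)" by (intro sets_completionI_sets) (simp add: b)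
qed

text \<open>Off the nonpositive reals \<open>Arg\<close> inverts \<open>cis\<close> continuously, so
  within the cell the part of \<open>U\<close> in the open cube is the preimage under
  \<open>torus_map\<close> of an open set \<open>G\<close>. Continuous functions converge to the
  indicator of \<open>G\<close>, and dominated convergence carries the vanishing of the integrals
  over.\<close>

lemma integral_open_subset_zero:
  fixes f :: "real ^ 'd \<Rightarrow> complex"
  assumes f: "integrable lebesgue f" and z: "\<And>n. (LINT y|lebesgue. f y * echar n y) = 0"
    and out: "\<And>y. y \<notin> period_cell \<Longrightarrow> f y = 0"
    and U: "open U"
  shows "(LINT y|lebesgue. f y * indicator (U \<inter> {y. \<forall>i. - pi < y $ i \<and> y $ i < pi}) y) = 0"
proof -
  \<comment> \<open>At a nonpositive real \<open>Arg\<close> is not continuous. On the torus this is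
    the seam -1, which corresponds to the faces left out of the open cube.\<close>
  define V where "V = {z :: complex ^ 'd. \<forall>i. z $ i \<notin> \<real>\<^sub>\<le>\<^sub>0}"
  define G where "G = (\<lambda>z. \<chi> i. Arg (z $ i)) -` U \<inter> V"
  have "V = (\<Inter>i. {z. z $ i \<in> - \<real>\<^sub>\<le>\<^sub>0})" by (auto simp: V_def)
  moreover have "open {z :: complex ^ 'd. z $ i \<in> - \<real>\<^sub>\<le>\<^sub>0}" for i
    using open_vimage[OF open_Compl[OF closed_nonpos_Reals_complex], of "\<lambda>z :: complex ^ 'd. z $ i"]
    by (simp add: vimage_def continuous_on_component continuous_on_id)
  ultimately have "open V" by auto
  moreover have "continuous_on V (\<lambda>z. \<chi> i. Arg (z $ i))"
    by (intro continuous_on_vec_lambda continuous_intros) (auto simp: V_def)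
  ultimately have "open G"
    using U unfolding G_def by (simp add: continuous_on_open_vimage)
  \<comment> \<open>\<open>infdist\<close> to the empty set is 0 by convention, which would spoil
    the approximation; the origin of C^d lies outside \<open>G\<close> and rules this out.\<close>
  have "0 \<in> - G" by (simp add: G_def V_def)
  then have ne: "- G \<noteq> {}" by blast
  have cG: "closed (- G)" using \<open>open G\<close> by (simp add: open_closed)
  \<comment> \<open>Urysohn-type functions: 0 off \<open>G\<close>, and 1 at a point of
    \<open>G\<close> as soon as \<open>k\<close> times its distance to the complement reaches
    1.\<close>
  define h where "h k z = min 1 (real k * infdist z (- G))" for k z
  have hc: "continuous_on UNIV (h k)" for k
    unfolding h_def[abs_def] by (intro continuous_intros)
  have hlim: "(\<lambda>k. h k z) \<longlonglongrightarrow> indicator G z" for z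
  proof (cases "z \<in> G")
    case True
    then have pos: "infdist z (- G) > 0"
      using in_closed_iff_infdist_zero[OF cG ne, of z] infdist_nonneg[of z "- G"] by (auto simp: less_le)
    obtain K :: nat where K: "1 / infdist z (- G) < K" using reals_Archimedean2 by blast
    have "h k z = 1" if "k \<ge> K" for k
    proof -
      have "1 / infdist z (- G) < real k" using K that by linarith
      then show ?thesis using pos by (simp add: h_def field_simps)
    qed
    then have "eventually (\<lambda>k. h k z = indicator G z) sequentially"
      using True by (auto simp: eventually_sequentially)
    then show ?thesis by (rule tendsto_eventually)
  next
    case False
    then show ?thesis by (simp add: h_def)
  qed
  have [measurable]: "f \<in> borel_measurable lebesgue" "G \<in> sets borel"
    using f \<open>open G\<close> by auto
  note [measurable] = borel_measurable_continuous_onI[OF hc]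
  have "(\<lambda>k. LINT y|lebesgue. f y * of_real (h k (torus_map y))) \<longlonglongrightarrow> (LINT y|lebesgue. f y * of_real (indicator G (torus_map y)))"
  proof (rule integral_dominated_convergence[where w = "\<lambda>y. cmod (f y)"])
    show "AE y in lebesgue. (\<lambda>k. f y * of_real (h k (torus_map y))) \<longlonglongrightarrow> f y * of_real (indicator G (torus_map y))"
      by (intro AE_I2 tendsto_intros hlim)
    show "AE y in lebesgue. norm (f y * of_real (h k (torus_map y))) \<le> cmod (f y)" for k
    proof (rule AE_I2)
      fix y
      have "\<bar>h k (torus_map y)\<bar> \<le> 1" by (auto simp: h_def infdist_nonneg)
      from mult_left_mono[OF this, of "cmod (f y)"]
      show "norm (f y * of_real (h k (torus_map y))) \<le> cmod (f y)" by (simp add: norm_mult)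
    qed
  qed (use f in auto)
  then have "(LINT y|lebesgue. f y * of_real (indicator G (torus_map y))) = 0"
    using integral_torus_continuous_zero[OF f z hc] by (simp add: LIMSEQ_const_iff)
  moreover have "f y * of_real (indicator G (torus_map y)) = f y * indicator (U \<inter> {y. \<forall>i. - pi < y $ i \<and> y $ i < pi}) y" for y
  proof (cases "y \<in> period_cell")
    case True
    \<comment> \<open>At a nonpositive real value on the circle \<open>Arg\<close> is pi, which the
      half-open interval excludes; within the cell the seam is therefore hit by the endpoint -pi
      only.\<close>
    have n: "cis (y $ i) \<notin> \<real>\<^sub>\<le>\<^sub>0 \<longleftrightarrow> - pi < y $ i" for i
    proof
      assume "cis (y $ i) \<notin> \<real>\<^sub>\<le>\<^sub>0"
      moreover have "cis (- pi) = of_real (- 1)" by (simp add: complex_eq_iff)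
      moreover have "complex_of_real (- 1) \<in> \<real>\<^sub>\<le>\<^sub>0" by (subst nonpos_Reals_of_real_iff) simp
      ultimately have "y $ i \<noteq> - pi" by auto
      then show "- pi < y $ i" using True by (auto simp: period_cell_def less_le)
    next
      assume a: "- pi < y $ i"
      then have A: "Arg (cis (y $ i)) = y $ i" using True by (intro Arg_cis) (auto simp: period_cell_def less_imp_le)
      show "cis (y $ i) \<notin> \<real>\<^sub>\<le>\<^sub>0"
      proof
        assume "cis (y $ i) \<in> \<real>\<^sub>\<le>\<^sub>0"
        then obtain r where r: "cis (y $ i) = of_real r" "r \<le> 0" by (auto elim: nonpos_Reals_cases)
        then have "r \<noteq> 0" using norm_cis[of "y $ i"] by auto
        then have "Arg (cis (y $ i)) = pi" using r by simp
        moreover have "y $ i < pi" using True by (simp add: period_cell_def)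
        ultimately show False using A by simp
      qed
    qed
    have "torus_map y \<in> G \<longleftrightarrow> y \<in> U \<inter> {y. \<forall>i. - pi < y $ i \<and> y $ i < pi}"
    proof (cases "\<forall>i. - pi < y $ i")
      case T: True
      then have "Arg (cis (y $ i)) = y $ i" for i using True by (intro Arg_cis) (auto simp: period_cell_def less_imp_le)
      then have "(\<chi> i. Arg (torus_map y $ i)) = y" by (simp add: torus_map_def vec_eq_iff)
      then show ?thesis using T True n by (auto simp: G_def V_def torus_map_def period_cell_def)
    next
      case False
      then show ?thesis using n by (auto simp: G_def V_def torus_map_def)
    qed
    then show ?thesis by (simp add: indicator_def)
  qed (simp add: out)
  ultimately show ?thesis by simp
qed

lemma period_cell_bounds:
  "{y. \<forall>i. - pi < y $ i \<and> y $ i < pi} = box (- vec pi) (vec pi :: real ^ 'd)"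
  "period_cell \<subseteq> cbox (- vec pi) (vec pi :: real ^ 'd)"
  "box (- vec pi) (vec pi :: real ^ 'd) \<subseteq> period_cell"
  by (auto simp: mem_box_cart period_cell_def less_imp_le)

text \<open>Open sets form an intersection-stable generator, so the vanishing of the integrals
  spreads to Borel sets by the pi-lambda argument and to Lebesgue sets by changing them on null
  sets. A function all of whose integrals over sets vanish is 0 almost everywhere.\<close>

theorem echar_complete:
  fixes f :: "real ^ 'd \<Rightarrow> complex"
  assumes f: "integrable lebesgue f" and z: "\<And>n. (LINT y|lebesgue. f y * echar n y) = 0"
    and out: "\<And>y. y \<notin> period_cell \<Longrightarrow> f y = 0"
  shows "AE y in lebesgue. f y = 0"
proof -
  let ?O = "box (- vec pi) (vec pi :: real ^ 'd)"
  \<comment> \<open>With \<open>f\<close> cut down to the open cube, an integral over an open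
    \<open>U\<close> only sees the part of \<open>U\<close> off the faces. The faces return at the
    end as a null set.\<close>
  define g where "g y = f y * indicator ?O y" for y
  have [measurable]: "f \<in> borel_measurable lebesgue" using f by auto
  have O[measurable]: "?O \<in> sets lebesgue" by simp
  have gi: "integrable lebesgue g"
    unfolding g_def using f
    by (intro integrable_mult_bounded[where B = 1]) (auto simp: indicator_def)
  have opn: "(LINT y|lebesgue. indicator U y *\<^sub>R g y) = 0" if "open U" for U
  proof -
    have "indicator U y *\<^sub>R g y = f y * indicator (U \<inter> ?O) y" for y
      by (simp add: g_def indicator_def)
    then show ?thesis using integral_open_subset_zero[OF f z out that] by (simp add: period_cell_bounds(1))
  qed
  have int_ind: "integrable lebesgue (\<lambda>y. indicator B y *\<^sub>R g y)" if "B \<in> sets lebesgue" for B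
    using that gi by (rule integrable_mult_indicator)
  have SB: "sigma_sets UNIV {U :: (real ^ 'd) set. open U} = sets borel"
    by (simp add: borel_def)
  have borel: "(LINT y|lebesgue. indicator B y *\<^sub>R g y) = 0" if B: "B \<in> sets borel" for B
  proof -
    have "Int_stable {U :: (real ^ 'd) set. open U}" by (auto simp: Int_stable_def)
    moreover have "{U :: (real ^ 'd) set. open U} \<subseteq> Pow UNIV" by simp
    moreover have "B \<in> sigma_sets UNIV {U :: (real ^ 'd) set. open U}"
      using B SB by simp
    ultimately show ?thesis
    proof (induction rule: sigma_sets_induct_disjoint)
      case (basic A)
      then show ?case using opn by simp
    next
      case empty
      then show ?case by simp
    next
      case (compl A)
      have A: "A \<in> sets lebesgue" using compl(1) unfolding SB by simp
      have "indicator (UNIV - A) y *\<^sub>R g y = indicator UNIV y *\<^sub>R g y - indicator A y *\<^sub>R g y" for y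
        by (simp add: indicator_def)
      then show ?case using compl(2) opn[of UNIV] int_ind[OF A] int_ind[of UNIV]
        by (simp add: Bochner_Integration.integral_diff)
    next
      case (union A)
      have A: "A i \<in> sets lebesgue" for i using union(2) unfolding SB by auto
      have "(LINT x:(\<Union>i. A i)|lebesgue. g x) = (\<Sum>i. LINT x:A i|lebesgue. g x)"
        using union(1) A by (intro lebesgue_integral_countable_add)
          (auto simp: disjoint_family_on_def set_integrable_def intro!: int_ind sets.countable_UN)
      then show ?case using union(3) by (simp add: set_lebesgue_integral_def)
    qed
  qed
  have "AE y in lebesgue. g y = 0"
  proof (rule sigma_finite_measure.density_zero[OF sigma_finite_lebesgue gi])
    fix A :: "(real ^ 'd) set" assume A[measurable]: "A \<in> sets lebesgue"
    then obtain S N N' where SN: "A = S \<union> N" "N \<subseteq> N'" "N' \<in> null_sets lborel" "S \<in> sets lborel"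
      by (rule sets_completionE)
    then have [measurable]: "S \<in> sets lebesgue" "g \<in> borel_measurable lebesgue" using gi by auto
    have "AE y in lebesgue. y \<notin> N'" using SN(3) by (intro AE_not_in null_sets_completionI)
    then have "AE y in lebesgue. indicator A y *\<^sub>R g y = indicator S y *\<^sub>R g y"
      by eventually_elim (use SN(1,2) in \<open>auto simp: indicator_def\<close>)
    then have "(LINT y|lebesgue. indicator A y *\<^sub>R g y) = (LINT y|lebesgue. indicator S y *\<^sub>R g y)"
      by (intro integral_cong_AE) measurable
    then show "set_lebesgue_integral lebesgue A g = 0"
      using borel[of S] SN(4) by (simp add: set_lebesgue_integral_def)
  qed
  moreover have "AE y in lebesgue. y \<notin> cbox (- vec pi) (vec pi) - ?O"
    using negligible_frontier_interval[of "- vec pi" "vec pi :: real ^ 'd"]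
    by (intro AE_not_in) (simp add: negligible_iff_null_sets)
  ultimately show ?thesis
  proof eventually_elim
    case (elim y)
    then show ?case using out[of y] period_cell_bounds(2) by (cases "y \<in> ?O") (auto simp: g_def)
  qed
qed

section \<open>Parseval's identity\<close>

lemma has_sum_nonneg_lub:
  fixes f :: "'a \<Rightarrow> real"
  assumes "\<And>x. x \<in> A \<Longrightarrow> 0 \<le> f x"
    and ub: "\<And>S. finite S \<Longrightarrow> S \<subseteq> A \<Longrightarrow> sum f S \<le> L"
    and lub: "\<And>y. y < L \<Longrightarrow> \<exists>S. finite S \<and> S \<subseteq> A \<and> y < sum f S"
  shows "(f has_sum L) A"
  unfolding has_sum_def
proof (rule order_tendstoI)
  fix y assume "y < L"
  then obtain S where S: "finite S" "S \<subseteq> A" "y < sum f S" using lub by blast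
  have "y < sum f T" if "finite T" "S \<subseteq> T" "T \<subseteq> A" for T
  proof -
    have "sum f S \<le> sum f T" using assms(1) that by (intro sum_mono2) auto
    then show ?thesis using S(3) by simp
  qed
  then show "eventually (\<lambda>T. y < sum f T) (finite_subsets_at_top A)"
    using S unfolding eventually_finite_subsets_at_top by blast
next
  fix y assume "L < y"
  then have "sum f T < y" if "finite T" "T \<subseteq> A" for T using ub[OF that] by simp
  then show "eventually (\<lambda>T. sum f T < y) (finite_subsets_at_top A)"
    unfolding eventually_finite_subsets_at_top by blast
qed

lemma integral_lebesgue_translation:
  fixes h :: "real ^ 'd \<Rightarrow> complex"
  assumes "h \<in> borel_measurable lebesgue"
  shows "(LINT x|lebesgue. h (x + t)) = (LINT x|lebesgue. h x)"
  using integral_lebesgue_affine[of "mat 1" h t] assms by simp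

lemma nn_integral_lebesgue_translation:
  fixes h :: "real ^ 'd \<Rightarrow> ennreal"
  assumes "h \<in> borel_measurable lebesgue"
  shows "(\<integral>\<^sup>+x. h (x + t) \<partial>lebesgue) = (\<integral>\<^sup>+x. h x \<partial>lebesgue)"
  using nn_integral_lebesgue_affine[of "mat 1" h t] assms by simp

text \<open>Squeezed between the open and the closed box, which have equal measure. Serves both the
  period cell and the unit cube of frequency shifts.\<close>

lemma emeasure_half_open_interval:
  fixes l u :: "real ^ 'd"
  assumes lu: "\<And>i. l $ i \<le> u $ i"
  shows "emeasure lebesgue {y. \<forall>i. l $ i \<le> y $ i \<and> y $ i < u $ i} = ennreal (\<Prod>i\<in>UNIV. u $ i - l $ i)"
proof -
  let ?H = "{y. \<forall>i. l $ i \<le> y $ i \<and> y $ i < u $ i}"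
  have H: "?H \<in> sets lebesgue"
  proof -
    have [measurable]: "(\<lambda>y::real ^ 'd. y $ i) \<in> borel_measurable borel" for i
      by (intro borel_measurable_continuous_onI continuous_intros)
    have "?H \<in> sets borel" by measurable
    then show ?thesis by (intro sets_completionI_sets) simp
  qed
  have 1: "emeasure lebesgue ?H \<le> emeasure lebesgue (cbox l u)"
    by (intro emeasure_mono) (auto simp: mem_box_cart less_imp_le)
  have 2: "emeasure lebesgue (box l u) \<le> emeasure lebesgue ?H"
    by (intro emeasure_mono H) (auto simp: mem_box_cart less_imp_le)
  have le: "l \<bullet> b \<le> u \<bullet> b" if "b \<in> Basis" for b :: "real ^ 'd"
    using that lu by (auto simp: Basis_vec_def inner_axis)
  have "emeasure lebesgue (box l u) = emeasure lebesgue (cbox l u)"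
    using le by simp
  with 1 2 have "emeasure lebesgue ?H = emeasure lebesgue (cbox l u)"
    by (intro antisym) auto
  also have "\<dots> = ennreal (measure lebesgue (cbox l u))"
    by (rule emeasure_eq_measure2) simp
  also have "measure lebesgue (cbox l u) = (\<Prod>i\<in>UNIV. u $ i - l $ i)"
  proof -
    have "cbox l u \<noteq> {}"
      using lu by (simp add: interval_ne_empty_cart)
    from content_cbox_cart[OF this] show ?thesis by simp
  qed
  finally show ?thesis .
qed

lemma emeasure_period_cell: "emeasure lebesgue (period_cell :: (real ^ 'd) set) = ennreal ((2 * pi) ^ CARD('d))"
  using emeasure_half_open_interval[of "- vec pi" "vec pi :: real ^ 'd"] by (simp add: period_cell_def)

lemma integrable_indicator_cell:
  fixes g :: "real ^ 'd \<Rightarrow> complex"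
  assumes "g \<in> borel_measurable lebesgue" "\<And>y. cmod (g y) \<le> B" and [measurable]: "S \<in> sets lebesgue" and "S \<subseteq> period_cell"
  shows "integrable lebesgue (\<lambda>y. indicator S y * g y)"
proof (rule integrable_mult_bounded[OF _ assms(1,2)])
  have "emeasure lebesgue S \<le> emeasure lebesgue (period_cell :: (real ^ 'd) set)"
    using assms by (intro emeasure_mono) auto
  then have "emeasure lebesgue S < \<infinity>" by (simp add: emeasure_period_cell le_less_trans less_top)
  then have "integrable lebesgue (indicator S :: real ^ 'd \<Rightarrow> real)" by simp
  then have "integrable lebesgue (\<lambda>y. complex_of_real (indicator S y))" by (rule integrable_of_real)
  then show "integrable lebesgue (indicator S :: real ^ 'd \<Rightarrow> complex)"
    by (simp add: of_real_indicator[abs_def])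
qed

lemma echar_shift: "echar n (y + t *\<^sub>R axis i 1) = echar n y * cis (of_int (n $ i) * t)"
  by (simp add: echar_def inner_add_right inner_axis cis_mult mult.commute)

text \<open>Where \<open>n $ i\<close> is nonzero, shifting coordinate \<open>i\<close> by half a
  period of the character changes its sign, while by periodicity the integral over the shifted cell
  stays the same. Hence the integral equals its own negative.\<close>

lemma integral_echar_cell_nonzero:
  fixes n :: "int ^ 'd"
  assumes "n \<noteq> 0"
  shows "(LINT y|lebesgue. indicator period_cell y * echar n y) = 0"
proof -
  obtain i where i: "n $ i \<noteq> 0" using assms by (auto simp: vec_eq_iff)
  \<comment> \<open>\<open>t\<close> times \<open>n $ i\<close> is pi or -pi, and t <= pi keeps the
    shift below the side-length 2 pi, so the shifted cell wraps around only once.\<close>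
  define t where "t = pi / \<bar>of_int (n $ i)\<bar>"
  have t: "0 < t" "t \<le> pi"
  proof -
    have "1 \<le> \<bar>real_of_int (n $ i)\<bar>" using i by linarith
    then show "0 < t" "t \<le> pi" using pi_gt_zero mult_left_mono[of 1 "\<bar>real_of_int (n $ i)\<bar>" pi] by (auto simp: t_def field_simps)
  qed
  have "of_int (n $ i) * t = pi \<or> of_int (n $ i) * t = - pi"
    using i by (auto simp: t_def abs_if)
  then have "cis (of_int (n $ i) * t) = -1" by (auto simp: complex_eq_iff)
  then have anti: "echar n (y + t *\<^sub>R axis i 1) = - echar n y" for y by (simp add: echar_shift)
  have per: "echar n (y + (- 2 * pi) *\<^sub>R axis i 1) = echar n y" for y
  proof -
    have "cis (of_int (n $ i) * (- 2 * pi)) = cis (2 * pi * of_int (- n $ i))" by (simp add: mult.commute)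
    also have "\<dots> = 1" by (rule cis_multiple_2pi) simp
    finally show ?thesis unfolding echar_shift by simp
  qed
  \<comment> \<open>The cell shifted up by \<open>t\<close> consists of \<open>Up\<close>, left in
    place, and of \<open>Lo\<close> moved up by the full period 2 pi.\<close>
  define Up where "Up = period_cell \<inter> {y :: real ^ 'd. - pi + t \<le> y $ i}"
  define Lo where "Lo = period_cell \<inter> {y :: real ^ 'd. y $ i < - pi + t}"
  have mb: "Up \<in> sets borel" "Lo \<in> sets borel"
  proof -
    have [measurable]: "(\<lambda>y::real ^ 'd. y $ i) \<in> borel_measurable borel"
      by (intro borel_measurable_continuous_onI continuous_intros)
    show "Up \<in> sets borel" "Lo \<in> sets borel" unfolding Up_def Lo_def by measurable
  qed
  then have m[measurable]: "Up \<in> sets lebesgue" "Lo \<in> sets lebesgue" by (auto intro: sets_completionI_sets)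
  have sub: "Up \<subseteq> period_cell" "Lo \<subseteq> period_cell" by (auto simp: Up_def Lo_def)
  have iU: "integrable lebesgue (\<lambda>y. indicator Up y * echar n y)" and iL: "integrable lebesgue (\<lambda>y. indicator Lo y * echar n y)"
    using sub by (auto intro!: integrable_indicator_cell[where B = 1])
  let ?h = "\<lambda>y. indicator Lo y * echar n y"
  let ?s = "\<lambda>y. y + (- 2 * pi) *\<^sub>R axis i 1"
  have shift_cell: "(indicator period_cell (y + (- t) *\<^sub>R axis i 1) :: complex) = indicator Up y + indicator Lo (?s y)" for y
  proof -
    have c: "(y + r *\<^sub>R axis i 1) $ k = (if k = i then y $ i + r else y $ k)" for r k
      by (simp add: axis_def)
    have "(\<forall>k. - pi \<le> (if k = i then y $ i + r else y $ k) \<and> (if k = i then y $ i + r else y $ k) < pi) \<longleftrightarrow>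
       (- pi \<le> y $ i + r \<and> y $ i + r < pi \<and> (\<forall>k. k \<noteq> i \<longrightarrow> - pi \<le> y $ k \<and> y $ k < pi))" for r by auto
    then have pc: "y + r *\<^sub>R axis i 1 \<in> period_cell \<longleftrightarrow>
       (- pi \<le> y $ i + r \<and> y $ i + r < pi \<and> (\<forall>k. k \<noteq> i \<longrightarrow> - pi \<le> y $ k \<and> y $ k < pi))" for r
      by (simp only: period_cell_def mem_Collect_eq c)
    define K where "K \<longleftrightarrow> (\<forall>k. k \<noteq> i \<longrightarrow> - pi \<le> y $ k \<and> y $ k < pi)"
    have 1: "y + (- t) *\<^sub>R axis i 1 \<in> period_cell \<longleftrightarrow> - pi \<le> y $ i - t \<and> y $ i - t < pi \<and> K"
      using pc[of "-t"] unfolding K_def by simp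
    have 2: "y \<in> Up \<longleftrightarrow> - pi \<le> y $ i \<and> y $ i < pi \<and> K \<and> - pi + t \<le> y $ i"
      using pc[of 0] unfolding K_def Up_def by auto
    have "?s y $ i = y $ i - 2 * pi" unfolding c by simp
    then have "?s y \<in> Lo \<longleftrightarrow> ?s y \<in> period_cell \<and> y $ i - 2 * pi < - pi + t"
      unfolding Lo_def by simp
    then have 3: "?s y \<in> Lo \<longleftrightarrow> - pi \<le> y $ i - 2 * pi \<and> y $ i - 2 * pi < pi \<and> K \<and> y $ i - 2 * pi < - pi + t"
      using pc[of "- 2 * pi"] unfolding K_def by simp
    have "y + (- t) *\<^sub>R axis i 1 \<in> period_cell \<longleftrightarrow> y \<in> Up \<or> ?s y \<in> Lo"
      unfolding 1 2 3 using t by (cases K) auto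
    moreover have "\<not> (y \<in> Up \<and> ?s y \<in> Lo)"
      unfolding 2 3 using t by (cases K) auto
    ultimately show ?thesis unfolding indicator_def by auto
  qed
  have iLs: "integrable lebesgue (\<lambda>y. ?h (?s y))"
    using integrable_lebesgue_affine[of "mat 1" ?h "(- 2 * pi) *\<^sub>R axis i 1"] iL by simp
  define I where "I = (LINT y|lebesgue. indicator period_cell y * echar n y)"
  have "I = (LINT y|lebesgue. indicator period_cell (y + (- t) *\<^sub>R axis i 1) * echar n (y + (- t) *\<^sub>R axis i 1))"
    unfolding I_def by (intro integral_lebesgue_translation[symmetric]) measurable
  also have "\<dots> = (LINT y|lebesgue. - (indicator Up y * echar n y + ?h (?s y)))"
  proof (intro Bochner_Integration.integral_cong refl)
    fix y
    have "echar n (y + (- t) *\<^sub>R axis i 1) = - echar n y" using anti[of "y + (- t) *\<^sub>R axis i 1"] by simp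
    then show "indicator period_cell (y + (- t) *\<^sub>R axis i 1) * echar n (y + (- t) *\<^sub>R axis i 1) = 
       - (indicator Up y * echar n y + ?h (?s y))"
      unfolding per shift_cell by (simp add: algebra_simps)
  qed
  also have "\<dots> = - ((LINT y|lebesgue. indicator Up y * echar n y) + (LINT y|lebesgue. ?h (?s y)))"
    unfolding integral_minus by (subst Bochner_Integration.integral_add[OF iU iLs]) simp
  also have "(LINT y|lebesgue. ?h (?s y)) = (LINT y|lebesgue. ?h y)"
    by (rule integral_lebesgue_translation) measurable
  also have "(LINT y|lebesgue. indicator Up y * echar n y) + (LINT y|lebesgue. ?h y) =
      (LINT y|lebesgue. indicator Up y * echar n y + ?h y)"
    by (rule Bochner_Integration.integral_add[symmetric, OF iU iL])
  also have "\<dots> = I" unfolding I_def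
    by (intro Bochner_Integration.integral_cong refl) (auto simp: Up_def Lo_def indicator_def)
  finally show ?thesis unfolding I_def by (simp add: eq_neg_iff_add_eq_0)
qed

lemma integral_echar_cell:
  fixes n :: "int ^ 'd"
  shows "(LINT y|lebesgue. indicator period_cell y * echar n y) = (if n = 0 then (2 * pi) ^ CARD('d) else 0)"
proof (cases "n = 0")
  case True
  have "(LINT y|lebesgue. (indicator (period_cell :: (real ^ 'd) set) y :: complex)) = (LINT y|lebesgue. complex_of_real (indicator (period_cell :: (real ^ 'd) set) y))"
    by (intro Bochner_Integration.integral_cong refl) (simp add: indicator_def)
  also have "\<dots> = of_real (LINT y|lebesgue. indicator (period_cell :: (real ^ 'd) set) y)"
    by (rule integral_complex_of_real)
  also have "(LINT y|lebesgue. indicator (period_cell :: (real ^ 'd) set) y) = measure lebesgue (period_cell :: (real ^ 'd) set)"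
    by simp
  also have "\<dots> = (2 * pi) ^ CARD('d)"
    by (simp add: measure_def emeasure_period_cell)
  finally show ?thesis using True by simp
qed (simp add: integral_echar_cell_nonzero)

lemma L2_norm_mono:
  assumes "f \<in> L2" "g \<in> borel_measurable lebesgue" "\<And>x. cmod (g x) \<le> cmod (f x)"
  shows "L2_norm g \<le> L2_norm f"
proof -
  have "g \<in> L2" using assms by (intro L2_bound[of f g 1]) auto
  then show ?thesis unfolding L2_norm_def
    by (intro real_sqrt_le_mono integral_mono L2_integrable assms power_mono) auto
qed

lemma
  fixes e :: "'n \<Rightarrow> real ^ 'd \<Rightarrow> complex"
  assumes e: "\<And>n. e n \<in> L2"
    and ortho: "\<And>m n. L2_inner (e m) (e n) = (if m = n then 1 else 0)"
    and S: "finite S"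
  shows L2_inner_orthonormal_sum: "L2_inner (\<lambda>x. \<Sum>n\<in>S. c n * e n x) (e m) = (if m \<in> S then c m else 0)"
    and L2_norm_orthonormal_sum: "(L2_norm (\<lambda>x. \<Sum>n\<in>S. c n * e n x))\<^sup>2 = (\<Sum>n\<in>S. (cmod (c n))\<^sup>2)"
proof -
  let ?p = "\<lambda>x. \<Sum>n\<in>S. c n * e n x"
  have ip: "L2_inner ?p h = (\<Sum>n\<in>S. c n * L2_inner (e n) h)" if "h \<in> L2" for h
    by (subst L2_inner_sum_left) (auto intro: L2_cmult e that simp: L2_inner_cmult_left)
  show 1: "L2_inner ?p (e m) = (if m \<in> S then c m else 0)" for m
    using S by (simp add: ip[OF e] ortho if_distrib cong: if_cong)
  have "complex_of_real ((L2_norm ?p)\<^sup>2) = (\<Sum>n\<in>S. c n * L2_inner (e n) ?p)"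
    unfolding L2_norm_sq_inner by (rule ip) (intro L2_sum L2_cmult e)
  also have "\<dots> = (\<Sum>n\<in>S. c n * cnj (c n))"
    by (intro sum.cong refl) (simp add: L2_inner_commute[of _ ?p] 1)
  also have "\<dots> = complex_of_real (\<Sum>n\<in>S. (cmod (c n))\<^sup>2)"
    by (simp only: complex_norm_square of_real_sum)
  finally show "(L2_norm ?p)\<^sup>2 = (\<Sum>n\<in>S. (cmod (c n))\<^sup>2)" by (simp only: of_real_eq_iff)
qed

text \<open>Bessel's inequality makes the partial sums Cauchy; their limit has the coefficients of
  \<open>f\<close>, so completeness identifies it with \<open>f\<close>, and norms pass to the
  limit. The set \<open>M\<close> is there because the exponentials are complete only among
  functions that vanish off the cell.\<close>

theorem Parseval_orthonormal:
  fixes e :: "'n :: countable \<Rightarrow> real ^ 'd \<Rightarrow> complex"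
  assumes e: "\<And>n. e n \<in> L2"
    and ortho: "\<And>m n. L2_inner (e m) (e n) = (if m = n then 1 else 0)"
    and M: "M \<in> sets lebesgue" and e_out: "\<And>n x. x \<notin> M \<Longrightarrow> e n x = 0"
    and complete: "\<And>h. h \<in> L2 \<Longrightarrow> (\<And>x. x \<notin> M \<Longrightarrow> h x = 0) \<Longrightarrow> (\<And>n. L2_inner h (e n) = 0) \<Longrightarrow> AE x in lebesgue. h x = 0"
    and f: "f \<in> L2" and f_out: "\<And>x. x \<notin> M \<Longrightarrow> f x = 0"
  shows "((\<lambda>n. (cmod (L2_inner f (e n)))\<^sup>2) has_sum (L2_norm f)\<^sup>2) UNIV"
proof -
  define c where "c n = L2_inner f (e n)" for n
  define p where "p S x = (\<Sum>n\<in>S. c n * e n x)" for S x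
  have p: "p S \<in> L2" for S unfolding p_def by (intro L2_sum L2_cmult e)
  have pn: "(L2_norm (p S))\<^sup>2 = (\<Sum>n\<in>S. (cmod (c n))\<^sup>2)" if "finite S" for S
    unfolding p_def by (rule L2_norm_orthonormal_sum[OF e ortho that])
  have pe: "L2_inner (p S) (e m) = (if m \<in> S then c m else 0)" if "finite S" for S m
    unfolding p_def by (rule L2_inner_orthonormal_sum[OF e ortho that])
  have fp: "(L2_norm (\<lambda>x. f x - p S x))\<^sup>2 = (L2_norm f)\<^sup>2 - (\<Sum>n\<in>S. (cmod (c n))\<^sup>2)" if "finite S" for S
  proof -
    have "L2_inner (p S) f = (\<Sum>n\<in>S. c n * L2_inner (e n) f)"
      unfolding p_def by (subst L2_inner_sum_left) (auto intro: L2_cmult e f simp: L2_inner_cmult_left)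
    also have "\<dots> = complex_of_real (\<Sum>n\<in>S. (cmod (c n))\<^sup>2)"
      by (simp only: L2_inner_commute[of _ f] c_def complex_norm_square of_real_sum)
    finally have "L2_inner f (p S) = complex_of_real (\<Sum>n\<in>S. (cmod (c n))\<^sup>2)"
      by (subst L2_inner_commute) simp
    then show ?thesis unfolding L2_norm_diff_sq[OF f p] pn[OF that] by simp
  qed
  have Bessel: "(\<Sum>n\<in>S. (cmod (c n))\<^sup>2) \<le> (L2_norm f)\<^sup>2" if "finite S" for S
    using fp[OF that] zero_le_power2[of "L2_norm (\<lambda>x. f x - p S x)"] by linarith
  \<comment> \<open>Exhausting the countable index set by finite sets turns the unordered sum into a
    sequence, to which \<open>L2_complete\<close> applies.\<close>
  define S where "S k = {n :: 'n. to_nat n < k}" for k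
  have Sfin: "finite (S k)" for k
    unfolding S_def by (rule finite_imageD[of to_nat]) (auto intro: finite_subset[of _ "{..<k}"] inj_on_subset[OF inj_to_nat])
  have Smono: "S k \<subseteq> S m" if "k \<le> m" for k m using that by (auto simp: S_def)
  define s where "s k = (\<Sum>n\<in>S k. (cmod (c n))\<^sup>2)" for k
  have "incseq s"
    unfolding s_def incseq_def by (intro allI impI sum_mono2 Sfin Smono) auto
  then have "convergent s"
    by (rule incseq_convergent[where B = "(L2_norm f)\<^sup>2"]) (auto simp: s_def intro: Bessel Sfin convergentI)
  then have Cs: "Cauchy s" by (simp add: Cauchy_convergent_iff)
  have pd: "(L2_norm (\<lambda>x. p (S m) x - p (S k) x))\<^sup>2 = s m - s k" if "k \<le> m" for k m
  proof -
    have "(\<lambda>x. p (S m) x - p (S k) x) = p (S m - S k)"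
      by (simp add: p_def fun_eq_iff sum_diff[OF Sfin Smono[OF that]])
    then show ?thesis
      using pn[of "S m - S k"] Sfin by (simp add: s_def sum_diff[OF Sfin Smono[OF that]])
  qed
  obtain g where g: "L2_tendsto (\<lambda>k. p (S k)) g sequentially"
  proof (rule L2_complete[of "\<lambda>k. p (S k)"])
    fix r :: real assume r: "0 < r"
    then obtain N where N: "\<And>m n. m \<ge> N \<Longrightarrow> n \<ge> N \<Longrightarrow> \<bar>s m - s n\<bar> < r\<^sup>2"
      using metric_CauchyD[OF Cs, of "r\<^sup>2"] by (auto simp: dist_real_def)
    have *: "L2_norm (\<lambda>x. p (S m) x - p (S k) x) \<le> r" if "k \<le> m" "N \<le> k" for k m
    proof (rule power2_le_imp_le)
      show "(L2_norm (\<lambda>x. p (S m) x - p (S k) x))\<^sup>2 \<le> r\<^sup>2"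
        using N[of m k] that unfolding pd[OF that(1)] by auto
    qed (use r in simp)
    have "L2_norm (\<lambda>x. p (S m) x - p (S k) x) \<le> r" if "N \<le> m" "N \<le> k" for k m
      using *[of k m] *[of m k] that L2_norm_minus_commute[of "p (S m)" "p (S k)"] by (cases "k \<le> m") auto
    then show "\<exists>N. \<forall>m\<ge>N. \<forall>n\<ge>N. L2_norm (\<lambda>x. p (S m) x - p (S n) x) \<le> r" by blast
  qed (auto intro: p)
  have gL: "g \<in> L2" using g by (simp add: L2_tendsto_def)
  \<comment> \<open>The limit is determined only almost everywhere, while \<open>complete\<close>
    demands vanishing at every point off \<open>M\<close>. The partial sums vanish there, so cutting
    off does not increase the distance to them.\<close>
  define g' where "g' x = indicator M x * g x" for x
  have g': "g' \<in> L2"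
    unfolding g'_def using M gL by (intro L2_bound[OF gL, where C = 1]) (auto simp: indicator_def)
  have pg': "L2_tendsto (\<lambda>k. p (S k)) g' sequentially"
    unfolding L2_tendsto_def
  proof (intro conjI)
    have "L2_norm (\<lambda>x. p (S k) x - g' x) \<le> L2_norm (\<lambda>x. p (S k) x - g x)" for k
      using L2_diff[OF p gL, of "S k"] L2_diff[OF p g', of "S k"]
      by (intro L2_norm_mono) (auto simp: g'_def p_def e_out indicator_def)
    then show "(\<lambda>k. L2_norm (\<lambda>x. p (S k) x - g' x)) \<longlonglongrightarrow> 0"
      using g unfolding L2_tendsto_def by (elim conjE) (rule Lim_null_comparison[rotated], auto)
  qed (use g' p in auto)
  have ge: "L2_inner g' (e n) = c n" for n
  proof (rule LIMSEQ_unique)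
    show "(\<lambda>k. L2_inner (p (S k)) (e n)) \<longlonglongrightarrow> L2_inner g' (e n)"
      by (rule L2_tendsto_inner[OF pg']) (simp add: L2_tendsto_def e L2_norm_def)
    have "eventually (\<lambda>k. L2_inner (p (S k)) (e n) = c n) sequentially"
      using eventually_gt_at_top[of "to_nat n"] by eventually_elim (simp add: pe[OF Sfin], simp add: S_def)
    then show "(\<lambda>k. L2_inner (p (S k)) (e n)) \<longlonglongrightarrow> c n" by (rule tendsto_eventually)
  qed
  have "AE x in lebesgue. f x - g' x = 0"
  proof (rule complete)
    show "(\<lambda>x. f x - g' x) \<in> L2" by (rule L2_diff[OF f g'])
    show "L2_inner (\<lambda>x. f x - g' x) (e n) = 0" for n
      using L2_inner_diff_left[OF f g' e[of n]] by (simp add: ge c_def)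
  qed (simp add: f_out g'_def)
  then have "AE x in lebesgue. (cmod (f x))\<^sup>2 = (cmod (g' x))\<^sup>2" by eventually_elim simp
  then have fg: "L2_norm f = L2_norm g'"
    using f g' unfolding L2_norm_def by (intro arg_cong[where f = sqrt] integral_cong_AE) auto
  have "(\<lambda>k. (L2_norm (p (S k)))\<^sup>2) \<longlonglongrightarrow> (L2_norm f)\<^sup>2"
    unfolding fg by (intro tendsto_intros L2_tendsto_norm pg')
  then have sl: "s \<longlonglongrightarrow> (L2_norm f)\<^sup>2" by (simp add: pn Sfin s_def[abs_def])
  show ?thesis
    unfolding c_def[symmetric]
  proof (rule has_sum_nonneg_lub)
    fix y assume "y < (L2_norm f)\<^sup>2"
    then obtain k where "y < s k"
      using order_tendstoD(1)[OF sl] by (auto simp: eventually_sequentially)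
    then show "\<exists>T. finite T \<and> T \<subseteq> UNIV \<and> y < (\<Sum>n\<in>T. (cmod (c n))\<^sup>2)"
      using Sfin[of k] unfolding s_def by blast
  qed (auto intro: Bessel)
qed

text \<open>The characters stay unnormalised, so that the coefficients are values of a Fourier
  integral; the factor (2 pi)^d is the volume of the cell.\<close>

theorem Parseval_period_cell:
  fixes f :: "real ^ 'd \<Rightarrow> complex"
  assumes f: "f \<in> L2" and out: "\<And>y. y \<notin> period_cell \<Longrightarrow> f y = 0"
  shows "((\<lambda>n. (cmod (LINT y|lebesgue. f y * cnj (echar n y)))\<^sup>2) has_sum (2 * pi) ^ CARD('d) * (L2_norm f)\<^sup>2) UNIV"
proof -
  \<comment> \<open>On the cell every character has norm equal to the square root of (2
    pi)^d.\<close>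
  define w where "w = 1 / sqrt ((2 * pi) ^ CARD('d))"
  have w2: "w\<^sup>2 * (2 * pi) ^ CARD('d) = 1" by (simp add: w_def power_divide)
  have w: "w > 0" by (simp add: w_def)
  define e :: "int ^ 'd \<Rightarrow> real ^ 'd \<Rightarrow> complex" where "e n y = of_real w * (indicator period_cell y * echar n y)" for n y
  have i1: "(indicator period_cell :: real ^ 'd \<Rightarrow> complex) \<in> L2"
  proof (rule L2I)
    have "(\<lambda>x. (cmod (indicator period_cell x))\<^sup>2) = (indicator (period_cell :: (real ^ 'd) set) :: _ \<Rightarrow> real)"
      by (auto simp: indicator_def)
    then show "integrable lebesgue (\<lambda>x::real ^ 'd. (cmod (indicator period_cell x))\<^sup>2)"
      by (simp add: emeasure_period_cell)
  qed measurable
  have e: "e n \<in> L2" for n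
    unfolding e_def by (intro L2_cmult L2_bound[OF i1, where C = 1]) (auto simp: norm_mult)
  have inner: "L2_inner h (e n) = of_real w * (LINT y|lebesgue. h y * cnj (echar n y))"
    if "\<And>y. y \<notin> period_cell \<Longrightarrow> h y = 0" for h n
  proof -
    have "L2_inner h (e n) = (LINT y|lebesgue. of_real w * (h y * cnj (echar n y)))"
      unfolding L2_inner_def e_def
      by (intro Bochner_Integration.integral_cong refl) (use that in \<open>auto simp: indicator_def\<close>)
    then show ?thesis by simp
  qed
  have "((\<lambda>n. (cmod (L2_inner f (e n)))\<^sup>2) has_sum (L2_norm f)\<^sup>2) UNIV"
  proof (rule Parseval_orthonormal[OF e _ _ _ _ f out])
    fix m n
    have "L2_inner (e m) (e n) = of_real w * (LINT y|lebesgue. of_real w * (indicator period_cell y * echar (m - n) y))"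
      by (subst inner) (auto simp: e_def cnj_echar echar_add diff_conv_add_uminus mult.assoc simp del: add_uminus_conv_diff)
    also have "\<dots> = (of_real w)\<^sup>2 * (if m = n then (2 * pi) ^ CARD('d) else 0)"
      by (simp add: integral_echar_cell power2_eq_square)
    also have "\<dots> = (if m = n then 1 else 0)"
      using w2 by (simp flip: of_real_power of_real_mult)
    finally show "L2_inner (e m) (e n) = (if m = n then 1 else 0)" .
  next
    fix h assume h: "h \<in> L2" "\<And>x. x \<notin> period_cell \<Longrightarrow> h x = 0" "\<And>n. L2_inner h (e n) = 0"
    have "integrable lebesgue (\<lambda>x. h x * indicator period_cell x)" by (rule L2_mult_integrable[OF h(1) i1])
    moreover have "(\<lambda>x. h x * indicator period_cell x) = h" using h(2) by (auto simp: indicator_def fun_eq_iff)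
    ultimately have "integrable lebesgue h" by simp
    then show "AE x in lebesgue. h x = 0"
    proof (rule echar_complete)
      fix n
      show "(LINT y|lebesgue. h y * echar n y) = 0"
        using h(3)[of "- n"] w by (simp add: inner[OF h(2)] cnj_echar)
    qed (rule h(2))
  qed (auto simp: e_def)
  then have "((\<lambda>n. w\<^sup>2 * (cmod (LINT y|lebesgue. f y * cnj (echar n y)))\<^sup>2) has_sum (L2_norm f)\<^sup>2) UNIV"
    using w by (simp add: inner[OF out] norm_mult power_mult_distrib)
  note has_sum_cmult_right[OF this, of "(2 * pi) ^ CARD('d)"]
  moreover have "(2 * pi) ^ CARD('d) * (w\<^sup>2 * r) = r" for r
    using w2 by (metis mult.assoc mult.commute mult_1)
  ultimately show ?thesis by (simp only:)
qed

section \<open>Plancherel's theorem on integrable functions\<close>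

text \<open>The constant is left out so that the values at integer points are exactly the
  coefficients in \<open>Parseval_period_cell\<close>.\<close>

definition fourier_kernel_integral :: "(real ^ 'd \<Rightarrow> complex) \<Rightarrow> real ^ 'd \<Rightarrow> complex" where
  "fourier_kernel_integral u \<xi> = (LINT x|lebesgue. u x * cis (- (x \<bullet> \<xi>)))"

lemma fourier_integral_kernel:
  fixes u :: "real ^ 'd \<Rightarrow> complex"
  shows "fourier_integral u \<xi> = of_real ((2 * pi) powr (- real CARD('d) / 2)) * fourier_kernel_integral u \<xi>"
  by (simp add: fourier_integral_def fourier_kernel_integral_def cis_conv_exp)

lemma fourier_constant_square: "((2 * pi) powr (- real n / 2))\<^sup>2 * (2 * pi) ^ n = 1"
proof -
  have "((2 * pi) powr (- real n / 2))\<^sup>2 = (2 * pi) powr (- real n)"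
    by (simp add: power2_eq_square flip: powr_add)
  then have "((2 * pi) powr (- real n / 2))\<^sup>2 * (2 * pi) ^ n = (2 * pi) powr (- real n) * (2 * pi) powr real n"
    by (simp add: powr_realpow)
  also have "\<dots> = 1" by (subst powr_add[symmetric]) simp
  finally show ?thesis .
qed

lemma borel_measurable_lebesgueI: "f \<in> borel_measurable borel \<Longrightarrow> f \<in> borel_measurable lebesgue"
  by (simp add: measurable_completion)

lemma measurable_lebesgue_borel_id[measurable]: "(\<lambda>x. x) \<in> lebesgue \<rightarrow>\<^sub>M borel"
  by (simp add: measurable_completion)

lemma continuous_on_kernel: "continuous_on S (\<lambda>x. cis (- (x \<bullet> \<xi>)))"
  unfolding cis_conv_exp by (intro continuous_intros)

lemma borel_measurable_kernel[measurable]: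
  "(\<lambda>x :: real ^ 'd. cis (- (x \<bullet> \<xi>))) \<in> borel_measurable lebesgue"
  by (rule borel_measurable_lebesgueI) (simp add: borel_measurable_continuous_onI continuous_on_kernel)

lemma borel_measurable_kernel_pair:
  assumes "f \<in> M \<rightarrow>\<^sub>M borel" "g \<in> M \<rightarrow>\<^sub>M borel"
  shows "(\<lambda>w. cis (- ((f w :: real ^ 'd) \<bullet> g w))) \<in> borel_measurable M"
proof -
  have "continuous_on UNIV (cis :: real \<Rightarrow> complex)"
    unfolding cis_conv_exp[abs_def] by (intro continuous_intros)
  then have [measurable]: "(cis :: real \<Rightarrow> complex) \<in> borel_measurable borel"
    by (rule borel_measurable_continuous_onI)
  show ?thesis using assms by measurable
qed

lemma kernel_integrable:
  assumes "integrable lebesgue u"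
  shows "integrable lebesgue (\<lambda>x :: real ^ 'd. u x * cis (- (x \<bullet> \<xi>)))"
  by (intro integrable_mult_bounded[OF assms, where B = 1]) auto

lemma fourier_kernel_integral_measurable:
  assumes u: "integrable lebesgue (u :: real ^ 'd \<Rightarrow> complex)"
  shows "fourier_kernel_integral u \<in> borel_measurable borel"
proof -
  have [measurable]: "u \<in> borel_measurable lebesgue" using u by auto
  have "snd \<in> (borel :: (real ^ 'd) measure) \<Otimes>\<^sub>M (lebesgue :: (real ^ 'd) measure) \<rightarrow>\<^sub>M lebesgue" by measurable
  from measurable_compose[OF this measurable_lebesgue_borel_id]
  have [measurable]: "(\<lambda>w. cis (- (snd w \<bullet> fst w))) \<in> borel_measurable ((borel :: (real ^ 'd) measure) \<Otimes>\<^sub>M (lebesgue :: (real ^ 'd) measure))"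
    by (intro borel_measurable_kernel_pair) auto
  have "(\<lambda>\<xi>. LINT x|lebesgue. u x * cis (- (x \<bullet> \<xi>))) \<in> borel_measurable borel"
  proof (rule sigma_finite_measure.borel_measurable_lebesgue_integral[OF sigma_finite_lebesgue])
    have "(\<lambda>w. u (snd w) * cis (- (snd w \<bullet> fst w))) \<in> borel_measurable ((borel :: (real ^ 'd) measure) \<Otimes>\<^sub>M (lebesgue :: (real ^ 'd) measure))"
      by measurable
    then show "(\<lambda>(\<xi>, x). u x * cis (- (x \<bullet> \<xi>))) \<in> borel_measurable ((borel :: (real ^ 'd) measure) \<Otimes>\<^sub>M (lebesgue :: (real ^ 'd) measure))"
      by (simp add: case_prod_beta)
  qed
  then show ?thesis by (simp add: fourier_kernel_integral_def[abs_def])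
qed

lemma fourier_integral_measurable:
  assumes "integrable lebesgue (u :: real ^ 'd \<Rightarrow> complex)"
  shows "fourier_integral u \<in> borel_measurable lebesgue"
  using fourier_kernel_integral_measurable[OF assms]
  by (simp add: fourier_integral_kernel[abs_def] measurable_completion)

text \<open>Every point lies in exactly one integer translate of the unit cube, the one given by the
  coordinatewise floor. The rest is Tonelli and translation invariance.\<close>

lemma nn_integral_unit_tiling:
  fixes g :: "real ^ 'd \<Rightarrow> ennreal"
  assumes g: "g \<in> borel_measurable borel"
  shows "(\<integral>\<^sup>+\<xi>. g \<xi> \<partial>lebesgue) =
    (\<integral>\<^sup>+\<theta>. indicator {\<theta>. \<forall>i. 0 \<le> \<theta> $ i \<and> \<theta> $ i < 1} \<theta> * (\<integral>\<^sup>+n. g (\<theta> + int_vec n) \<partial>count_space UNIV) \<partial>lebesgue)"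
proof -
  let ?U = "{\<theta> :: real ^ 'd. \<forall>i. 0 \<le> \<theta> $ i \<and> \<theta> $ i < 1}"
  have U: "?U \<in> sets borel"
  proof -
    have [measurable]: "(\<lambda>y::real ^ 'd. y $ i) \<in> borel_measurable borel" for i
      by (intro borel_measurable_continuous_onI continuous_intros)
    show ?thesis by measurable
  qed
  have gs: "(\<lambda>\<xi>. g \<xi> * indicator ?U (\<xi> - int_vec n)) \<in> borel_measurable borel" for n
    using g U by measurable
  have gt: "(\<lambda>\<xi>. g (\<xi> + int_vec n) * indicator ?U \<xi>) \<in> borel_measurable borel" for n
    using g U by measurable
  have fl: "\<xi> - int_vec n \<in> ?U \<longleftrightarrow> n = (\<chi> i. \<lfloor>\<xi> $ i\<rfloor>)" for \<xi> and n :: "int ^ 'd"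
    by (auto simp: vec_eq_iff floor_eq_iff eq_commute[of "n $ _"] algebra_simps)
  have "(\<integral>\<^sup>+\<xi>. g \<xi> \<partial>lebesgue) = (\<integral>\<^sup>+\<xi>. (\<integral>\<^sup>+n. g \<xi> * indicator ?U (\<xi> - int_vec n) \<partial>count_space UNIV) \<partial>lebesgue)"
  proof (rule nn_integral_cong)
    fix \<xi> :: "real ^ 'd"
    have "indicator ?U (\<xi> - int_vec n) = (indicator {\<chi> i. \<lfloor>\<xi> $ i\<rfloor>} n :: ennreal)" for n
      using fl[of \<xi> n] by (simp add: indicator_def)
    then show "g \<xi> = (\<integral>\<^sup>+n. g \<xi> * indicator ?U (\<xi> - int_vec n) \<partial>count_space UNIV)"
      by (simp add: nn_integral_cmult)
  qed
  also have "\<dots> = (\<integral>\<^sup>+n. (\<integral>\<^sup>+\<xi>. g \<xi> * indicator ?U (\<xi> - int_vec n) \<partial>lebesgue) \<partial>count_space UNIV)"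
    by (intro nn_integral_count_space_nn_integral) (use gs in \<open>auto intro!: borel_measurable_lebesgueI\<close>)
  also have "\<dots> = (\<integral>\<^sup>+n. (\<integral>\<^sup>+\<theta>. g (\<theta> + int_vec n) * indicator ?U \<theta> \<partial>lebesgue) \<partial>count_space UNIV)"
  proof (rule nn_integral_cong)
    fix n :: "int ^ 'd"
    show "(\<integral>\<^sup>+\<xi>. g \<xi> * indicator ?U (\<xi> - int_vec n) \<partial>lebesgue) = (\<integral>\<^sup>+\<theta>. g (\<theta> + int_vec n) * indicator ?U \<theta> \<partial>lebesgue)"
      using nn_integral_lebesgue_translation[of "\<lambda>\<xi>. g \<xi> * indicator ?U (\<xi> - int_vec n)" "int_vec n"] borel_measurable_lebesgueI[OF gs[of n]]
      by simp
  qed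
  also have "\<dots> = (\<integral>\<^sup>+\<theta>. (\<integral>\<^sup>+n. g (\<theta> + int_vec n) * indicator ?U \<theta> \<partial>count_space UNIV) \<partial>lebesgue)"
    by (intro nn_integral_count_space_nn_integral[symmetric]) (use gt in \<open>auto intro!: borel_measurable_lebesgueI\<close>)
  also have "\<dots> = (\<integral>\<^sup>+\<theta>. indicator ?U \<theta> * (\<integral>\<^sup>+n. g (\<theta> + int_vec n) \<partial>count_space UNIV) \<partial>lebesgue)"
    by (intro nn_integral_cong) (simp add: nn_integral_multc mult.commute)
  finally show ?thesis .
qed

text \<open>Reading an unordered sum of nonnegative terms as an integral over counting measure makes
  it exchangeable with Lebesgue integrals.\<close>

lemma nn_integral_count_space_has_sum:
  assumes "(f has_sum s) A" "\<And>x. x \<in> A \<Longrightarrow> 0 \<le> f x"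
  shows "(\<integral>\<^sup>+n. ennreal (f n) \<partial>count_space A) = ennreal s"
proof -
  have "(\<lambda>n. norm (f n)) summable_on A"
  proof -
    have "(\<lambda>n. norm (f n)) summable_on A \<longleftrightarrow> f summable_on A"
      by (rule summable_on_cong) (simp add: assms(2))
    then show ?thesis using has_sum_imp_summable[OF assms(1)] by blast
  qed
  then have "Infinite_Set_Sum.abs_summable_on f A" using abs_summable_equivalent by blast
  then show ?thesis
    using nn_integral_conv_infsetsum[of f A] assms(2) infsetsum_infsum[of f A] infsumI[OF assms(1)] by simp
qed

lemma has_sum_nn_integral_count_space:
  fixes f :: "'a \<Rightarrow> real"
  assumes "(\<integral>\<^sup>+n. ennreal (f n) \<partial>count_space A) = ennreal s" "\<And>x. x \<in> A \<Longrightarrow> 0 \<le> f x" "0 \<le> s"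
  shows "(f has_sum s) A"
proof -
  have "(\<integral>\<^sup>+n. ennreal (norm (f n)) \<partial>count_space A) = (\<integral>\<^sup>+n. ennreal (f n) \<partial>count_space A)"
    using assms(2) by (intro nn_integral_cong) simp
  then have "integrable (count_space A) f"
    using assms(1) by (intro integrableI_bounded) auto
  then have "Infinite_Set_Sum.abs_summable_on f A" by (simp add: Infinite_Set_Sum.abs_summable_on_def)
  then have "(\<lambda>n. norm (f n)) summable_on A" using abs_summable_equivalent by blast
  then have hs: "(f has_sum infsum f A) A" by (rule has_sum_infsum[OF abs_summable_summable])
  have "0 \<le> infsum f A" using assms(2) by (rule infsum_nonneg)
  with nn_integral_count_space_has_sum[OF hs assms(2)] assms(1,3) have "infsum f A = s" by simp
  with hs show ?thesis by simp
qed

lemma Plancherel_period_cell: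
  fixes f :: "real ^ 'd \<Rightarrow> complex"
  assumes f: "f \<in> L2" "integrable lebesgue f" and out: "\<And>y. y \<notin> period_cell \<Longrightarrow> f y = 0"
  shows "(\<integral>\<^sup>+\<xi>. ennreal ((cmod (fourier_kernel_integral f \<xi>))\<^sup>2) \<partial>lebesgue) = ennreal ((2 * pi) ^ CARD('d) * (L2_norm f)\<^sup>2)"
proof -
  let ?K = "(2 * pi) ^ CARD('d) * (L2_norm f)\<^sup>2"
  let ?U = "{\<theta> :: real ^ 'd. \<forall>i. 0 \<le> \<theta> $ i \<and> \<theta> $ i < 1}"
  have U: "?U \<in> sets lebesgue"
  proof -
    have [measurable]: "(\<lambda>y::real ^ 'd. y $ i) \<in> borel_measurable borel" for i
      by (intro borel_measurable_continuous_onI continuous_intros)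
    have "?U \<in> sets borel" by measurable
    then show ?thesis by (intro sets_completionI_sets) simp
  qed
  have s: "(\<integral>\<^sup>+n. ennreal ((cmod (fourier_kernel_integral f (\<theta> + int_vec n)))\<^sup>2) \<partial>count_space UNIV) = ennreal ?K" for \<theta>
  proof -
    \<comment> \<open>Modulation by \<open>\<theta>\<close> translates the transform, so the
      coefficients of \<open>g\<close> are the values of the transform of \<open>f\<close> on the
      shifted lattice, while the norm does not change.\<close>
    define g where "g y = f y * cis (- (y \<bullet> \<theta>))" for y
    have gm: "g \<in> borel_measurable lebesgue" unfolding g_def using f(1) by measurable
    have gn: "cmod (g y) = cmod (f y)" for y by (simp add: g_def norm_mult)
    have gL: "g \<in> L2" by (rule L2_bound[OF f(1) gm, of 1]) (simp add: gn)
    have "L2_norm g = L2_norm f" by (simp add: L2_norm_def gn)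
    then have "((\<lambda>n. (cmod (LINT y|lebesgue. g y * cnj (echar n y)))\<^sup>2) has_sum ?K) UNIV"
      using Parseval_period_cell[OF gL] out by (simp add: g_def)
    moreover have "g y * cnj (echar n y) = f y * cis (- (y \<bullet> (\<theta> + int_vec n)))" for y n
      by (simp add: g_def echar_def cis_cnj cis_mult mult.assoc inner_add_right inner_commute)
    ultimately have "((\<lambda>n. (cmod (fourier_kernel_integral f (\<theta> + int_vec n)))\<^sup>2) has_sum ?K) UNIV"
      by (simp add: fourier_kernel_integral_def)
    then show ?thesis by (rule nn_integral_count_space_has_sum) simp
  qed
  have m: "(\<lambda>\<xi>. ennreal ((cmod (fourier_kernel_integral f \<xi>))\<^sup>2)) \<in> borel_measurable borel"
    using fourier_kernel_integral_measurable[OF f(2)] by measurable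
  have "(\<integral>\<^sup>+\<xi>. ennreal ((cmod (fourier_kernel_integral f \<xi>))\<^sup>2) \<partial>lebesgue) = (\<integral>\<^sup>+\<theta>. indicator ?U \<theta> * ennreal ?K \<partial>lebesgue)"
    unfolding nn_integral_unit_tiling[OF m] s ..
  also have "\<dots> = emeasure lebesgue ?U * ennreal ?K"
    using U by (simp add: nn_integral_multc)
  also have "emeasure lebesgue ?U = 1"
    using emeasure_half_open_interval[of 0 "vec 1 :: real ^ 'd"] by simp
  finally show ?thesis by simp
qed

lemma det_mat: "det (mat r :: real ^ 'd ^ 'd) = r ^ CARD('d)"
  by (subst det_diagonal) (simp_all add: mat_def)

lemma mat_mult_vec: "(mat r :: real ^ 'd ^ 'd) *v x = r *\<^sub>R x"
proof -
  have "(\<Sum>j\<in>UNIV. (if i = j then r else 0) * x $ j) = (\<Sum>j\<in>UNIV. if j = i then r * x $ i else 0)" for i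
    by (intro sum.cong) auto
  then show ?thesis by (simp add: vec_eq_iff matrix_vector_mult_def mat_def)
qed

text \<open>A dilation brings the support into the period cell. The transform picks up r^d and the
  opposite dilation, and the powers of \<open>r\<close> cancel in the norms.\<close>

lemma Plancherel_compact_support:
  fixes f :: "real ^ 'd \<Rightarrow> complex"
  assumes f: "f \<in> L2" "integrable lebesgue f" and r: "0 < r"
    and out: "\<And>y. y \<notin> period_cell \<Longrightarrow> f (r *\<^sub>R y) = 0"
  shows "fourier_integral f \<in> L2" "L2_norm (fourier_integral f) = L2_norm f"
proof -
  let ?c = "(2 * pi) powr (- real CARD('d) / 2)"
  have fm[measurable]: "f \<in> borel_measurable lebesgue" using f(1) by measurable
  have d: "det (mat r :: real ^ 'd ^ 'd) \<noteq> 0" using r by (simp add: det_mat)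
  define g where "g y = f (r *\<^sub>R y)" for y
  have gi: "integrable lebesgue g"
    using integrable_lebesgue_affine[OF d fm, of 0] f(2) by (simp add: mat_mult_vec g_def[abs_def])
  have nn: "(\<integral>\<^sup>+x. h x \<partial>lebesgue) = r ^ CARD('d) * (\<integral>\<^sup>+x. h (r *\<^sub>R x) \<partial>lebesgue)"
    if "h \<in> borel_measurable lebesgue" for h :: "real ^ 'd \<Rightarrow> ennreal"
    using nn_integral_lebesgue_affine[OF d that, of 0] r by (simp add: mat_mult_vec det_mat)
  have n2: "ennreal ((L2_norm f)\<^sup>2) = r ^ CARD('d) * (\<integral>\<^sup>+x. ennreal ((cmod (g x))\<^sup>2) \<partial>lebesgue)"
    unfolding L2_nn_integral[OF f(1), symmetric] g_def by (rule nn) measurable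
  have gm[measurable]: "g \<in> borel_measurable lebesgue" using gi by auto
  have gL: "g \<in> L2"
  proof (rule L2I[OF gm], rule integrableI_bounded)
    have "r ^ CARD('d) * (\<integral>\<^sup>+x. ennreal ((cmod (g x))\<^sup>2) \<partial>lebesgue) < \<infinity>"
      unfolding n2[symmetric] by simp
    then show "(\<integral>\<^sup>+x. ennreal (norm ((cmod (g x))\<^sup>2)) \<partial>lebesgue) < \<infinity>"
      using zero_less_power[OF r, of "CARD('d)"] by (auto simp: ennreal_mult_less_top ennreal_eq_0_iff)
  qed measurable
  have nf: "(L2_norm f)\<^sup>2 = r ^ CARD('d) * (L2_norm g)\<^sup>2"
    using n2 r unfolding L2_nn_integral[OF gL] by (simp flip: ennreal_mult)
  have k: "fourier_kernel_integral f \<xi> = of_real (r ^ CARD('d)) * fourier_kernel_integral g (r *\<^sub>R \<xi>)" for \<xi>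
    unfolding fourier_kernel_integral_def g_def
    using integral_lebesgue_affine[OF d, of "\<lambda>x. f x * cis (- (x \<bullet> \<xi>))" 0] r
    by (simp add: mat_mult_vec det_mat)
  let ?N = "\<integral>\<^sup>+\<xi>. ennreal ((cmod (fourier_kernel_integral g (r *\<^sub>R \<xi>)))\<^sup>2) \<partial>lebesgue"
  have m: "(\<lambda>\<xi>. ennreal ((cmod (fourier_kernel_integral g \<xi>))\<^sup>2)) \<in> borel_measurable lebesgue"
  proof (rule borel_measurable_lebesgueI)
    note [measurable] = fourier_kernel_integral_measurable[OF gi]
    show "(\<lambda>\<xi>. ennreal ((cmod (fourier_kernel_integral g \<xi>))\<^sup>2)) \<in> borel_measurable borel"
      by measurable
  qed
  have m': "(\<lambda>\<xi>. ennreal ((cmod (fourier_kernel_integral g (r *\<^sub>R \<xi>)))\<^sup>2)) \<in> borel_measurable lebesgue"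
  proof (rule borel_measurable_lebesgueI)
    have [measurable]: "(\<lambda>\<xi>. fourier_kernel_integral g (r *\<^sub>R \<xi>)) \<in> borel_measurable borel"
      by (rule measurable_compose[OF _ fourier_kernel_integral_measurable[OF gi]]) simp
    show "(\<lambda>\<xi>. ennreal ((cmod (fourier_kernel_integral g (r *\<^sub>R \<xi>)))\<^sup>2)) \<in> borel_measurable borel"
      by measurable
  qed
  have "(\<integral>\<^sup>+\<xi>. ennreal ((cmod (fourier_integral f \<xi>))\<^sup>2) \<partial>lebesgue) =
      (\<integral>\<^sup>+\<xi>. ennreal (?c\<^sup>2 * (r ^ CARD('d))\<^sup>2) * ennreal ((cmod (fourier_kernel_integral g (r *\<^sub>R \<xi>)))\<^sup>2) \<partial>lebesgue)"
    using r by (intro nn_integral_cong) (simp add: fourier_integral_kernel k norm_mult norm_power power_mult_distrib ennreal_mult'[symmetric] mult.assoc)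
  also have "\<dots> = ennreal (?c\<^sup>2 * (r ^ CARD('d))\<^sup>2) * ?N"
    by (rule nn_integral_cmult[OF m'])
  \<comment> \<open>Of the two factors r^d one undoes the dilation in frequency, the other turns the
    norm of \<open>g\<close> into that of \<open>f\<close>. The square of the constant then cancels
    the (2 pi)^d from Parseval.\<close>
  also have "\<dots> = ennreal (?c\<^sup>2 * r ^ CARD('d)) * (r ^ CARD('d) * ?N)"
    using r by (simp add: ennreal_mult power2_eq_square mult.assoc)
  also have "r ^ CARD('d) * ?N = ennreal ((2 * pi) ^ CARD('d) * (L2_norm g)\<^sup>2)"
    unfolding nn[OF m, symmetric] using out by (intro Plancherel_period_cell gL gi) (simp add: g_def)
  also have "ennreal (?c\<^sup>2 * r ^ CARD('d)) * \<dots> = ennreal ((?c\<^sup>2 * (2 * pi) ^ CARD('d)) * (r ^ CARD('d) * (L2_norm g)\<^sup>2))"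
    using r by (subst ennreal_mult[symmetric]) (auto simp: mult_ac)
  finally have *: "(\<integral>\<^sup>+\<xi>. ennreal ((cmod (fourier_integral f \<xi>))\<^sup>2) \<partial>lebesgue) = ennreal ((L2_norm f)\<^sup>2)"
    by (simp only: fourier_constant_square nf mult_1)
  show L: "fourier_integral f \<in> L2"
    using L2_nn_integralI(1)[OF fourier_integral_measurable[OF f(2)], of "L2_norm f"] * by simp
  show "L2_norm (fourier_integral f) = L2_norm f"
    using * unfolding L2_nn_integral[OF L] by simp
qed

text \<open>Cuts off to \<open>k + 1\<close> times the period cell; \<open>Suc k\<close> keeps the
  dilation factor positive at \<open>k = 0\<close>, as \<open>Plancherel_compact_support\<close>
  requires.\<close>

definition truncate_L2 :: "nat \<Rightarrow> (real ^ 'd \<Rightarrow> complex) \<Rightarrow> real ^ 'd \<Rightarrow> complex" where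
  "truncate_L2 k f x = indicator period_cell ((1 / real (Suc k)) *\<^sub>R x) * f x"

lemma truncate_L2_out: "y \<notin> period_cell \<Longrightarrow> truncate_L2 k f (real (Suc k) *\<^sub>R y) = 0"
  by (simp add: truncate_L2_def)

lemma truncate_L2_measurable:
  assumes "f \<in> borel_measurable lebesgue" shows "truncate_L2 k f \<in> borel_measurable lebesgue"
proof -
  have "(\<lambda>x :: real ^ 'd. indicator period_cell ((1 / real (Suc k)) *\<^sub>R x) :: complex) \<in> borel_measurable borel"
    by measurable
  then have "(\<lambda>x :: real ^ 'd. indicator period_cell ((1 / real (Suc k)) *\<^sub>R x) :: complex) \<in> borel_measurable lebesgue"
    by (rule borel_measurable_lebesgueI)
  then show ?thesis using assms unfolding truncate_L2_def[abs_def] by measurable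
qed

lemma truncate_L2_norm_le: "cmod (truncate_L2 k f x) \<le> cmod (f x)"
  by (simp add: truncate_L2_def indicator_def)

lemma truncate_L2_eventually: "eventually (\<lambda>k. truncate_L2 k f x = f x) sequentially"
proof -
  obtain K :: nat where K: "norm x < K" using reals_Archimedean2 by blast
  have mem: "(1 / real (Suc k)) *\<^sub>R x \<in> period_cell" if "k \<ge> K" for k
  proof -
    have small: "\<bar>((1 / real (Suc k)) *\<^sub>R x) $ i\<bar> < 1" for i
    proof -
      have "\<bar>x $ i\<bar> < real (Suc k)" using component_le_norm_cart[of x i] K that by linarith
      then show ?thesis by (simp add: divide_less_eq)
    qed
    have "- pi \<le> ((1 / real (Suc k)) *\<^sub>R x) $ i \<and> ((1 / real (Suc k)) *\<^sub>R x) $ i < pi" for i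
    proof -
      from small[of i] have "\<bar>((1 / real (Suc k)) *\<^sub>R x) $ i\<bar> < pi" using pi_gt3 by linarith
      then show ?thesis unfolding abs_less_iff by linarith
    qed
    then show ?thesis unfolding period_cell_def by blast
  qed
  show ?thesis
    by (rule eventually_sequentiallyI[of K]) (use mem in \<open>simp add: truncate_L2_def\<close>)
qed

lemma truncate_L2_in_L2: "f \<in> L2 \<Longrightarrow> truncate_L2 k f \<in> L2"
  by (rule L2_bound[of f _ 1]) (auto intro: truncate_L2_measurable truncate_L2_norm_le)

text \<open>On a bounded set a square-integrable function is integrable: the truncation is the
  product of two square-integrable functions, \<open>f\<close> and the indicator of the dilated
  cell.\<close>

lemma truncate_L2_integrable:
  fixes f :: "real ^ 'd \<Rightarrow> complex"
  assumes "f \<in> L2" shows "integrable lebesgue (truncate_L2 k f)"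
proof -
  have d: "det (mat (real (Suc k)) :: real ^ 'd ^ 'd) \<noteq> 0" by (simp add: det_mat)
  define g where "g y = truncate_L2 k f (real (Suc k) *\<^sub>R y)" for y
  have iff: "integrable lebesgue (truncate_L2 k f) \<longleftrightarrow> integrable lebesgue g"
    using integrable_lebesgue_affine[OF d truncate_L2_measurable[OF L2_measurable[OF assms]], of k 0]
    by (simp add: mat_mult_vec g_def[abs_def])
  define h :: "real ^ 'd \<Rightarrow> complex" where "h x = indicator period_cell ((1 / real (Suc k)) *\<^sub>R x)" for x
  have h: "h \<in> L2"
  proof -
    have hm: "h \<in> borel_measurable lebesgue"
      using truncate_L2_measurable[of "\<lambda>_. 1" k] by (simp add: truncate_L2_def[abs_def] h_def[abs_def])
    have "integrable lebesgue h"
    proof -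
      have "integrable lebesgue (\<lambda>y :: real ^ 'd. indicator period_cell y * 1 :: complex)"
        by (intro integrable_indicator_cell[where B = 1]) auto
      then show ?thesis
        using integrable_lebesgue_affine[OF d hm, of 0] by (simp add: mat_mult_vec h_def[abs_def])
    qed
    then have "integrable lebesgue (\<lambda>x. cmod (h x))" by simp
    moreover have "cmod (h x) = (cmod (h x))\<^sup>2" for x by (simp add: h_def indicator_def)
    ultimately show ?thesis by (intro L2I[OF hm]) simp
  qed
  have "integrable lebesgue (\<lambda>x. h x * f x)" by (rule L2_mult_integrable[OF h assms])
  then show ?thesis by (simp add: truncate_L2_def[abs_def] h_def)
qed

lemma L2_dominated_convergence:
  assumes g: "g \<in> L2" and u: "\<And>k. u k \<in> borel_measurable lebesgue" "\<And>k x. cmod (u k x) \<le> cmod (g x)"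
    and lim: "\<And>x. (\<lambda>k. u k x) \<longlonglongrightarrow> f x"
  shows "L2_tendsto u f sequentially"
proof -
  note [measurable] = u(1)
  have [measurable]: "f \<in> borel_measurable lebesgue"
    by (rule borel_measurable_LIMSEQ_metric[OF u(1) lim])
  have fb: "cmod (f x) \<le> cmod (g x)" for x
    by (rule LIMSEQ_le_const2[OF tendsto_norm[OF lim]]) (use u(2) in auto)
  have f: "f \<in> L2" by (rule L2_bound[OF g, of f 1]) (use fb in auto)
  have uL: "u k \<in> L2" for k by (rule L2_bound[OF g, of _ 1]) (use u in auto)
  have "(\<lambda>k. LINT x|lebesgue. (cmod (u k x - f x))\<^sup>2) \<longlonglongrightarrow> (LINT x|(lebesgue :: (real ^ 'a) measure). 0)"
  proof (rule integral_dominated_convergence[where w = "\<lambda>x. 4 * (cmod (g x))\<^sup>2"])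
    show "AE x in lebesgue. norm ((cmod (u k x - f x))\<^sup>2) \<le> 4 * (cmod (g x))\<^sup>2" for k
    proof (rule AE_I2)
      fix x
      have "cmod (u k x - f x) \<le> 2 * cmod (g x)"
        using norm_triangle_ineq4[of "u k x" "f x"] u(2)[of k x] fb[of x] by linarith
      then have "(cmod (u k x - f x))\<^sup>2 \<le> (2 * cmod (g x))\<^sup>2" by (intro power_mono) auto
      then show "norm ((cmod (u k x - f x))\<^sup>2) \<le> 4 * (cmod (g x))\<^sup>2" by (simp add: power_mult_distrib)
    qed
    have "(\<lambda>k. (cmod (u k x - f x))\<^sup>2) \<longlonglongrightarrow> (cmod (f x - f x))\<^sup>2" for x
      by (intro tendsto_intros lim)
    then show "AE x in lebesgue. (\<lambda>k. (cmod (u k x - f x))\<^sup>2) \<longlonglongrightarrow> 0" by simp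
  qed (use L2_integrable[OF g] in auto)
  then have "(\<lambda>k. L2_norm (\<lambda>x. u k x - f x)) \<longlonglongrightarrow> sqrt 0"
    unfolding L2_norm_def by (intro tendsto_real_sqrt) simp
  then show ?thesis using f uL by (simp add: L2_tendsto_def)
qed

lemma truncate_L2_tendsto:
  assumes "f \<in> L2" shows "L2_tendsto (\<lambda>k. truncate_L2 k f) f sequentially"
  by (rule L2_dominated_convergence[OF assms])
    (auto intro: truncate_L2_measurable L2_measurable assms truncate_L2_norm_le tendsto_eventually truncate_L2_eventually)

lemma fourier_integral_diff:
  assumes "integrable lebesgue u" "integrable lebesgue v"
  shows "fourier_integral (\<lambda>x. u x - v x) \<xi> = fourier_integral u \<xi> - fourier_integral v \<xi>"
  unfolding fourier_integral_kernel fourier_kernel_integral_def left_diff_distrib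
  by (subst Bochner_Integration.integral_diff) (auto intro: kernel_integrable assms simp: right_diff_distrib)

lemma fourier_integral_cmult: "fourier_integral (\<lambda>x. c * u x) \<xi> = c * fourier_integral u \<xi>"
  by (simp add: fourier_integral_kernel fourier_kernel_integral_def mult.assoc)

text \<open>The isometry on truncations yields, by Fatou's lemma, a contraction on all functions
  that are integrable and in \<open>L2\<close>. Applied to the differences between \<open>u\<close>
  and its truncations, the contraction makes their transforms converge in norm, and so the equality
  of norms passes to the limit.\<close>

theorem Plancherel_L1_L2:
  fixes u :: "real ^ 'd \<Rightarrow> complex"
  assumes u: "u \<in> L2" "integrable lebesgue u"
  shows "fourier_integral u \<in> L2" "L2_norm (fourier_integral u) = L2_norm u"
proof -
  have T: "fourier_integral (truncate_L2 k v) \<in> L2" "L2_norm (fourier_integral (truncate_L2 k v)) = L2_norm (truncate_L2 k v)"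
    if "v \<in> L2" for k and v :: "real ^ 'd \<Rightarrow> complex"
  proof -
    note P = truncate_L2_in_L2[OF that] truncate_L2_integrable[OF that]
    show "fourier_integral (truncate_L2 k v) \<in> L2"
      by (rule Plancherel_compact_support(1)[OF P _ truncate_L2_out]) simp_all
    show "L2_norm (fourier_integral (truncate_L2 k v)) = L2_norm (truncate_L2 k v)"
      by (rule Plancherel_compact_support(2)[OF P _ truncate_L2_out]) simp_all
  qed
  have contr: "fourier_integral v \<in> L2 \<and> L2_norm (fourier_integral v) \<le> L2_norm v"
    if v: "v \<in> L2" "integrable lebesgue v" for v :: "real ^ 'd \<Rightarrow> complex"
  proof -
    \<comment> \<open>Convergence at each single frequency, dominated by the integrable function
      |v|.\<close>
    have lim: "(\<lambda>k. fourier_integral (truncate_L2 k v) \<xi>) \<longlonglongrightarrow> fourier_integral v \<xi>" for \<xi>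
      unfolding fourier_integral_kernel fourier_kernel_integral_def
    proof (intro tendsto_intros integral_dominated_convergence[where w = "\<lambda>x. cmod (v x)"])
      note [measurable] = truncate_L2_measurable[OF L2_measurable[OF v(1)]]
      show "(\<lambda>x. truncate_L2 k v x * cis (- (x \<bullet> \<xi>))) \<in> borel_measurable lebesgue" for k by measurable
      show "(\<lambda>x. v x * cis (- (x \<bullet> \<xi>))) \<in> borel_measurable lebesgue" using L2_measurable[OF v(1)] by measurable
      show "AE x in lebesgue. (\<lambda>k. truncate_L2 k v x * cis (- (x \<bullet> \<xi>))) \<longlonglongrightarrow> v x * cis (- (x \<bullet> \<xi>))"
        by (intro AE_I2 tendsto_intros tendsto_eventually truncate_L2_eventually)
      show "AE x in lebesgue. norm (truncate_L2 k v x * cis (- (x \<bullet> \<xi>))) \<le> cmod (v x)" for k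
        by (simp add: norm_mult truncate_L2_norm_le)
    qed (use v in auto)
    have "L2_norm (truncate_L2 k v) \<le> L2_norm v" for k
      by (intro L2_norm_mono v truncate_L2_measurable L2_measurable truncate_L2_norm_le)
    then have bd: "eventually (\<lambda>k. fourier_integral (truncate_L2 k v) \<in> L2 \<and>
        L2_norm (fourier_integral (truncate_L2 k v)) \<le> L2_norm v) sequentially"
      using T[OF v(1)] by simp
    note F = L2_Fatou[OF fourier_integral_measurable[OF truncate_L2_integrable[OF v(1)]]
        fourier_integral_measurable[OF v(2)] AE_I2[OF lim] bd L2_norm_nonneg]
    show ?thesis using F by blast
  qed
  show L: "fourier_integral u \<in> L2" using contr[OF u] by blast
  let ?t = "\<lambda>k. truncate_L2 k u"
  have "L2_norm (\<lambda>\<xi>. fourier_integral (?t k) \<xi> - fourier_integral u \<xi>) \<le> L2_norm (\<lambda>x. ?t k x - u x)" for k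
  proof -
    have "fourier_integral (\<lambda>x. ?t k x - u x) = (\<lambda>\<xi>. fourier_integral (?t k) \<xi> - fourier_integral u \<xi>)"
      by (intro ext fourier_integral_diff truncate_L2_integrable u)
    moreover have "(\<lambda>x. ?t k x - u x) \<in> L2"
      by (rule L2_diff[OF truncate_L2_in_L2[OF u(1)] u(1)])
    moreover have "integrable lebesgue (\<lambda>x. ?t k x - u x)"
      by (rule Bochner_Integration.integrable_diff[OF truncate_L2_integrable[OF u(1)] u(2)])
    ultimately show ?thesis using contr[of "\<lambda>x. ?t k x - u x"] by simp
  qed
  then have "(\<lambda>k. L2_norm (\<lambda>\<xi>. fourier_integral (?t k) \<xi> - fourier_integral u \<xi>)) \<longlonglongrightarrow> 0"
    using truncate_L2_tendsto[OF u(1)] unfolding L2_tendsto_def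
    by (elim conjE) (rule Lim_null_comparison[rotated], auto)
  then have "L2_tendsto (\<lambda>k. fourier_integral (?t k)) (fourier_integral u) sequentially"
    using L T[OF u(1)] by (simp add: L2_tendsto_def)
  from L2_tendsto_norm[OF this] have "(\<lambda>k. L2_norm (?t k)) \<longlonglongrightarrow> L2_norm (fourier_integral u)"
    using T[OF u(1)] by simp
  with L2_tendsto_norm[OF truncate_L2_tendsto[OF u(1)]]
  show "L2_norm (fourier_integral u) = L2_norm u" by (rule LIMSEQ_unique[symmetric])
qed

section \<open>The Fourier transform of square-integrable functions\<close>

lemma has_L2_fourierE:
  assumes "has_L2_fourier f F"
  obtains u where "\<And>k. integrable lebesgue (u k)" "L2_tendsto u f sequentially"
    "L2_tendsto (\<lambda>k. fourier_integral (u k)) F sequentially"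
  using assms unfolding has_L2_fourier_def by blast

lemma has_L2_fourier_L2: "has_L2_fourier f F \<Longrightarrow> f \<in> L2" "has_L2_fourier f F \<Longrightarrow> F \<in> L2"
  by (auto simp: has_L2_fourier_def L2_tendsto_def)

text \<open>The truncations are integrable and converge in norm; by the isometry their transforms
  form a Cauchy sequence, and completeness supplies the limit.\<close>

lemma has_L2_fourier_exists:
  fixes f :: "real ^ 'd \<Rightarrow> complex"
  assumes f: "f \<in> L2"
  shows "\<exists>F. has_L2_fourier f F"
proof -
  let ?t = "\<lambda>k. truncate_L2 k f"
  have t: "?t k \<in> L2" "integrable lebesgue (?t k)" for k
    using f by (auto intro: truncate_L2_in_L2 truncate_L2_integrable)
  have dist: "L2_norm (\<lambda>\<xi>. fourier_integral (?t m) \<xi> - fourier_integral (?t n) \<xi>) = L2_norm (\<lambda>x. ?t m x - ?t n x)" for m n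
  proof -
    have "fourier_integral (\<lambda>x. ?t m x - ?t n x) = (\<lambda>\<xi>. fourier_integral (?t m) \<xi> - fourier_integral (?t n) \<xi>)"
      by (intro ext fourier_integral_diff t)
    then show ?thesis
      using Plancherel_L1_L2(2)[OF L2_diff[OF t(1) t(1)] Bochner_Integration.integrable_diff[OF t(2) t(2)], of m n] by simp
  qed
  obtain F where "L2_tendsto (\<lambda>k. fourier_integral (?t k)) F sequentially"
  proof (rule L2_complete[of "\<lambda>k. fourier_integral (?t k)"])
    show "fourier_integral (?t k) \<in> L2" for k by (rule Plancherel_L1_L2(1)[OF t])
    fix e :: real assume "0 < e"
    have "(\<lambda>k. L2_norm (\<lambda>x. ?t k x - f x)) \<longlonglongrightarrow> 0"
      using truncate_L2_tendsto[OF f] by (simp add: L2_tendsto_def)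
    then obtain N where N: "\<And>k. k \<ge> N \<Longrightarrow> L2_norm (\<lambda>x. ?t k x - f x) < e / 2"
      using LIMSEQ_D[of _ 0 "e / 2"] \<open>0 < e\<close> by force
    have "L2_norm (\<lambda>x. ?t m x - ?t n x) \<le> e" if "m \<ge> N" "n \<ge> N" for m n
      using L2_norm_triangle3[OF t(1) f t(1), of m n] N[OF that(1)] N[OF that(2)] by linarith
    then show "\<exists>N. \<forall>m\<ge>N. \<forall>n\<ge>N. L2_norm (\<lambda>\<xi>. fourier_integral (?t m) \<xi> - fourier_integral (?t n) \<xi>) \<le> e"
      unfolding dist by blast
  qed
  then have "has_L2_fourier f F"
    unfolding has_L2_fourier_def using truncate_L2_tendsto[OF f] t(2) by (intro exI[of _ ?t]) blast
  then show ?thesis by (rule exI[of "\<lambda>F. has_L2_fourier f F" F])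
qed

lemma has_L2_fourier_norm:
  fixes f :: "real ^ 'd \<Rightarrow> complex"
  assumes "has_L2_fourier f F"
  shows "L2_norm F = L2_norm f"
proof -
  obtain u where u: "\<And>k. integrable lebesgue (u k)" "L2_tendsto u f sequentially"
    "L2_tendsto (\<lambda>k. fourier_integral (u k)) F sequentially"
    using assms by (rule has_L2_fourierE) blast
  \<comment> \<open>The approximants are known to be in \<open>L2\<close> only eventually, and
    \<open>Plancherel_L1_L2\<close> needs both integrability and membership in
    \<open>L2\<close>.\<close>
  have "eventually (\<lambda>k. L2_norm (u k) = L2_norm (fourier_integral (u k))) sequentially"
    using u(2) unfolding L2_tendsto_def
    by (elim conjE, elim eventually_mono) (simp add: Plancherel_L1_L2 u(1))
  from Lim_transform_eventually[OF L2_tendsto_norm[OF u(2)] this]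
  show ?thesis by (rule LIMSEQ_unique[OF L2_tendsto_norm[OF u(3)]])
qed

lemma has_L2_fourier_diff:
  assumes "has_L2_fourier f F" "has_L2_fourier g G"
  shows "has_L2_fourier (\<lambda>x. f x - g x) (\<lambda>x. F x - G x)"
proof -
  obtain u where u: "\<And>k. integrable lebesgue (u k)" "L2_tendsto u f sequentially"
    "L2_tendsto (\<lambda>k. fourier_integral (u k)) F sequentially"
    using assms(1) by (rule has_L2_fourierE) blast
  obtain v where v: "\<And>k. integrable lebesgue (v k)" "L2_tendsto v g sequentially"
    "L2_tendsto (\<lambda>k. fourier_integral (v k)) G sequentially"
    using assms(2) by (rule has_L2_fourierE) blast
  have eq: "fourier_integral (\<lambda>x. u k x - v k x) = (\<lambda>\<xi>. fourier_integral (u k) \<xi> - fourier_integral (v k) \<xi>)" for k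
    by (intro ext fourier_integral_diff u v)
  show ?thesis
    unfolding has_L2_fourier_def
  proof (intro exI conjI allI)
    show "integrable lebesgue (\<lambda>x. u k x - v k x)" for k using u v by simp
    show "L2_tendsto (\<lambda>k x. u k x - v k x) (\<lambda>x. f x - g x) sequentially"
      by (rule L2_tendsto_diff[OF u(2) v(2)])
    show "L2_tendsto (\<lambda>k. fourier_integral (\<lambda>x. u k x - v k x)) (\<lambda>x. F x - G x) sequentially"
      unfolding eq by (rule L2_tendsto_diff[OF u(3) v(3)])
  qed
qed

lemma has_L2_fourier_cmult:
  assumes "has_L2_fourier f F"
  shows "has_L2_fourier (\<lambda>x. c * f x) (\<lambda>x. c * F x)"
proof -
  obtain u where u: "\<And>k. integrable lebesgue (u k)" "L2_tendsto u f sequentially"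
    "L2_tendsto (\<lambda>k. fourier_integral (u k)) F sequentially"
    using assms by (rule has_L2_fourierE) blast
  have eq: "fourier_integral (\<lambda>x. c * u k x) = (\<lambda>\<xi>. c * fourier_integral (u k) \<xi>)" for k
    by (intro ext fourier_integral_cmult)
  show ?thesis
    unfolding has_L2_fourier_def
  proof (intro exI conjI allI)
    show "integrable lebesgue (\<lambda>x. c * u k x)" for k using u by simp
    show "L2_tendsto (\<lambda>k x. c * u k x) (\<lambda>x. c * f x) sequentially"
      by (rule L2_tendsto_cmult[OF u(2)])
    show "L2_tendsto (\<lambda>k. fourier_integral (\<lambda>x. c * u k x)) (\<lambda>x. c * F x) sequentially"
      unfolding eq by (rule L2_tendsto_cmult[OF u(3)])
  qed
qed

lemma has_L2_fourier_unique:
  assumes "has_L2_fourier f F" "has_L2_fourier f G"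
  shows "AE \<xi> in lebesgue. F \<xi> = G \<xi>"
proof -
  note d = has_L2_fourier_diff[OF assms]
  \<comment> \<open>By linearity the difference is a transform of \<open>f x - f x\<close>, that is,
    of the zero function.\<close>
  have "L2_norm (\<lambda>x. F x - G x) = 0"
    using has_L2_fourier_norm[OF d] by (simp add: L2_norm_def)
  from L2_norm_eq_0[OF has_L2_fourier_L2(2)[OF d] this] show ?thesis by simp
qed

text \<open>Polarisation: equal norms give equal real parts, and replacing \<open>f\<close> by i
  times \<open>f\<close> gives the imaginary parts.\<close>

theorem has_L2_fourier_inner:
  assumes "has_L2_fourier f F" "has_L2_fourier g G"
  shows "L2_inner F G = L2_inner f g"
proof -
  have re: "Re (L2_inner F G) = Re (L2_inner f g)" if "has_L2_fourier f F" for f F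
    using has_L2_fourier_norm[OF has_L2_fourier_diff[OF that assms(2)]]
      L2_norm_diff_sq[of F G] L2_norm_diff_sq[of f g]
      has_L2_fourier_norm[OF that] has_L2_fourier_norm[OF assms(2)]
      has_L2_fourier_L2[OF that] has_L2_fourier_L2[OF assms(2)] by simp
  have "Re (L2_inner (\<lambda>x. \<i> * F x) G) = Re (L2_inner (\<lambda>x. \<i> * f x) g)"
    by (rule re[OF has_L2_fourier_cmult[OF assms(1)]])
  then have "Im (L2_inner F G) = Im (L2_inner f g)" by (simp add: L2_inner_cmult_left)
  with re[OF assms(1)] show ?thesis by (simp add: complex_eq_iff)
qed

text \<open>Fubini for u(x) v(xi) times the kernel, an integrand whose absolute value is a product
  of integrable functions. The formula says that the transform is its own transpose, and
  surjectivity will rest on it.\<close>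

lemma fourier_integral_multiplication:
  fixes u v :: "real ^ 'd \<Rightarrow> complex"
  assumes u: "integrable lebesgue u" and v: "integrable lebesgue v"
  shows "(LINT \<xi>|lebesgue. fourier_integral u \<xi> * v \<xi>) = (LINT x|lebesgue. u x * fourier_integral v x)"
proof -
  let ?L = "lebesgue :: (real ^ 'd) measure"
  interpret pair_sigma_finite ?L ?L
    by (simp add: pair_sigma_finite_def sigma_finite_lebesgue)
  have [measurable]: "u \<in> borel_measurable lebesgue" "v \<in> borel_measurable lebesgue" using u v by auto
  have fst: "fst \<in> ?L \<Otimes>\<^sub>M ?L \<rightarrow>\<^sub>M ?L" and snd: "snd \<in> ?L \<Otimes>\<^sub>M ?L \<rightarrow>\<^sub>M ?L" by measurable
  have [measurable]: "(\<lambda>w. cis (- (fst w \<bullet> snd w))) \<in> borel_measurable (?L \<Otimes>\<^sub>M ?L)"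
    by (rule borel_measurable_kernel_pair[OF measurable_compose[OF fst measurable_lebesgue_borel_id]
      measurable_compose[OF snd measurable_lebesgue_borel_id]])
  let ?f = "\<lambda>x \<xi>. u x * v \<xi> * cis (- (x \<bullet> \<xi>))"
  have m: "case_prod ?f \<in> borel_measurable (?L \<Otimes>\<^sub>M ?L)"
  proof -
    have "(\<lambda>w. u (fst w) * v (snd w) * cis (- (fst w \<bullet> snd w))) \<in> borel_measurable (?L \<Otimes>\<^sub>M ?L)" by measurable
    then show ?thesis by (simp add: case_prod_beta)
  qed
  have "integrable (?L \<Otimes>\<^sub>M ?L) (case_prod ?f)"
  proof (rule Fubini_integrable[OF m])
    show "integrable ?L (\<lambda>x. LINT \<xi>|?L. norm (case_prod ?f (x, \<xi>)))"
      using u by (simp add: norm_mult)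
    have "integrable ?L (\<lambda>\<xi>. u x * (v \<xi> * cis (- (\<xi> \<bullet> x))))" for x
      by (intro integrable_mult_right kernel_integrable v)
    then show "AE x in ?L. integrable ?L (\<lambda>\<xi>. case_prod ?f (x, \<xi>))"
      by (simp add: mult.assoc inner_commute)
  qed
  note Fubini = Fubini_integral[OF this]
  have 1: "(LINT x|?L. u x * cis (- (x \<bullet> \<xi>))) * v \<xi> = (LINT x|?L. ?f x \<xi>)" for \<xi>
  proof -
    have "?f x \<xi> = u x * cis (- (x \<bullet> \<xi>)) * v \<xi>" for x by simp
    then show ?thesis by (simp only: integral_mult_left_zero)
  qed
  have 2: "u x * (LINT \<xi>|?L. v \<xi> * cis (- (\<xi> \<bullet> x))) = (LINT \<xi>|?L. ?f x \<xi>)" for x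
  proof -
    have "?f x \<xi> = u x * (v \<xi> * cis (- (\<xi> \<bullet> x)))" for \<xi> by (simp add: inner_commute)
    then show ?thesis by (simp only: integral_mult_right_zero)
  qed
  have "(LINT \<xi>|?L. fourier_kernel_integral u \<xi> * v \<xi>) = (LINT x|?L. u x * fourier_kernel_integral v x)"
    unfolding fourier_kernel_integral_def 1 2 by (rule Fubini)
  then have "c * (LINT \<xi>|?L. fourier_kernel_integral u \<xi> * v \<xi>) = c * (LINT x|?L. u x * fourier_kernel_integral v x)" for c
    by simp
  then show ?thesis
    unfolding fourier_integral_kernel mult.assoc mult.left_commute[of "u _"] integral_mult_right_zero .
qed

text \<open>The conjugations turn the sesquilinear inner product into the bilinear pairing of the
  multiplication formula.\<close>

lemma has_L2_fourier_multiplication: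
  assumes "has_L2_fourier f F" "has_L2_fourier g G"
  shows "L2_inner F (\<lambda>x. cnj (g x)) = L2_inner f (\<lambda>x. cnj (G x))"
proof -
  obtain u where u: "\<And>k. integrable lebesgue (u k)" "L2_tendsto u f sequentially"
    "L2_tendsto (\<lambda>k. fourier_integral (u k)) F sequentially"
    using assms(1) by (rule has_L2_fourierE) blast
  obtain v where v: "\<And>k. integrable lebesgue (v k)" "L2_tendsto v g sequentially"
    "L2_tendsto (\<lambda>k. fourier_integral (v k)) G sequentially"
    using assms(2) by (rule has_L2_fourierE) blast
  have eq: "L2_inner (fourier_integral (u k)) (\<lambda>x. cnj (v k x)) = L2_inner (u k) (\<lambda>x. cnj (fourier_integral (v k) x))" for k
    unfolding L2_inner_def by (simp add: fourier_integral_multiplication u v)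
  show ?thesis
    by (rule LIMSEQ_unique[OF L2_tendsto_inner[OF u(3) L2_tendsto_cnj[OF v(2)]]])
      (unfold eq, rule L2_tendsto_inner[OF u(2) L2_tendsto_cnj[OF v(3)]])
qed

text \<open>With \<open>\<F>\<^sup>* h = cnj (\<F> (cnj h))\<close> the adjoint of the isometry \<open>\<F>\<close>, which is again isometric,
  \<open>\<parallel>\<F> (\<F>\<^sup>* h) - h\<parallel>\<^sup>2 = \<parallel>h\<parallel>\<^sup>2 - 2 \<parallel>\<F>\<^sup>* h\<parallel>\<^sup>2 + \<parallel>h\<parallel>\<^sup>2 = 0\<close>.\<close>

theorem has_L2_fourier_surj:
  fixes h :: "real ^ 'd \<Rightarrow> complex"
  assumes h: "h \<in> L2"
  obtains f F where "has_L2_fourier f F" "AE \<xi> in lebesgue. F \<xi> = h \<xi>"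
proof -
  obtain K where K: "has_L2_fourier (\<lambda>x. cnj (h x)) K"
    using has_L2_fourier_exists[OF L2_cnj[OF h]] by blast
  define f where "f = (\<lambda>x. cnj (K x))"
  have "f \<in> L2" unfolding f_def by (intro L2_cnj has_L2_fourier_L2(2)[OF K])
  then obtain F where F: "has_L2_fourier f F" using has_L2_fourier_exists by blast
  have nK: "L2_norm K = L2_norm h" using has_L2_fourier_norm[OF K] by (simp add: L2_norm_cnj)
  have nf: "L2_norm f = L2_norm h" unfolding f_def L2_norm_cnj nK ..
  have nF: "L2_norm F = L2_norm h" using has_L2_fourier_norm[OF F] nf by simp
  \<comment> \<open>The multiplication formula for \<open>f\<close> and the conjugate of
    \<open>h\<close> makes \<open>f\<close>, the value of the adjoint at \<open>h\<close>, appear in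
    both slots.\<close>
  have "L2_inner F h = L2_inner f f"
    using has_L2_fourier_multiplication[OF F K] by (simp add: f_def)
  also have "\<dots> = of_real ((L2_norm h)\<^sup>2)"
    unfolding L2_norm_sq_inner[symmetric] nf ..
  finally have "Re (L2_inner F h) = (L2_norm h)\<^sup>2" by (simp only: Re_complex_of_real)
  then have "(L2_norm (\<lambda>x. F x - h x))\<^sup>2 = 0"
    unfolding L2_norm_diff_sq[OF has_L2_fourier_L2(2)[OF F] h] nF by simp
  then have "L2_norm (\<lambda>x. F x - h x) = 0" by simp
  from L2_norm_eq_0[OF L2_diff[OF has_L2_fourier_L2(2)[OF F] h] this]
  have "AE \<xi> in lebesgue. F \<xi> = h \<xi>" by simp
  then show ?thesis using that F by blast
qed

lemma has_L2_fourier_fourier_L2: "f \<in> L2 \<Longrightarrow> has_L2_fourier f (fourier_L2 f)"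
  unfolding fourier_L2_def by (rule someI_ex[OF has_L2_fourier_exists])

lemma
  fixes h :: "real ^ 'd \<Rightarrow> complex"
  assumes h: "h \<in> L2"
  shows inv_fourier_L2_in_L2: "inv_fourier_L2 h \<in> L2"
    and fourier_inv_fourier_L2: "AE \<xi> in lebesgue. fourier_L2 (inv_fourier_L2 h) \<xi> = h \<xi>"
proof -
  obtain f F where f: "has_L2_fourier f F" "AE \<xi> in lebesgue. F \<xi> = h \<xi>"
    using has_L2_fourier_surj[OF h] by blast
  have L: "f \<in> L2" by (rule has_L2_fourier_L2(1)[OF f(1)])
  \<comment> \<open>\<open>fourier_L2 f\<close> and \<open>F\<close> may be different choices of a
    transform of the same function, so they are compared through uniqueness.\<close>
  have "AE \<xi> in lebesgue. fourier_L2 f \<xi> = h \<xi>"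
    using has_L2_fourier_unique[OF has_L2_fourier_fourier_L2[OF L] f(1)] f(2) by eventually_elim simp
  then have "\<exists>f. f \<in> L2 \<and> (AE \<xi> in lebesgue. fourier_L2 f \<xi> = h \<xi>)" using L by blast
  from someI_ex[OF this, folded inv_fourier_L2_def]
  show "inv_fourier_L2 h \<in> L2" "AE \<xi> in lebesgue. fourier_L2 (inv_fourier_L2 h) \<xi> = h \<xi>" by blast+
qed

text \<open>Lets the frame coefficients be computed on the frequency side.\<close>

lemma L2_inner_inv_fourier_L2:
  fixes f h :: "real ^ 'd \<Rightarrow> complex"
  assumes f: "f \<in> L2" and h: "h \<in> L2"
  shows "L2_inner f (inv_fourier_L2 h) = L2_inner (fourier_L2 f) h"
proof -
  note H = has_L2_fourier_fourier_L2[OF f] has_L2_fourier_fourier_L2[OF inv_fourier_L2_in_L2[OF h]]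
  have "L2_inner f (inv_fourier_L2 h) = L2_inner (fourier_L2 f) (fourier_L2 (inv_fourier_L2 h))"
    by (rule has_L2_fourier_inner[OF H, symmetric])
  also have "\<dots> = L2_inner (fourier_L2 f) h"
    using fourier_inv_fourier_L2[OF h] has_L2_fourier_L2(2)[OF H(1)] has_L2_fourier_L2(2)[OF H(2)] h
    by (intro L2_inner_AE_cong) auto
  finally show ?thesis .
qed

section \<open>The tight frame\<close>

text \<open>Let q_i be the coefficients of a partial sum p. Parseval gives sum |q_i|^2 <= ||p||^2,
  while ||p||^2 = sum Re (c_i cnj q_i). Inserting both into 0 <= sum |c_i - q_i|^2 yields ||p||^2 <=
  sum |c_i|^2 without orthogonality. Expanding ||p - F||^2 then leaves at most ||F||^2 - sum
  |c_i|^2, which tends to 0.\<close>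

theorem tight_frame_reconstruction:
  fixes e :: "'i \<Rightarrow> real ^ 'd \<Rightarrow> complex"
  assumes e: "\<And>i. i \<in> I \<Longrightarrow> e i \<in> L2"
    and tight: "\<And>F. F \<in> L2 \<Longrightarrow> ((\<lambda>i. (cmod (L2_inner F (e i)))\<^sup>2) has_sum (L2_norm F)\<^sup>2) I"
    and F: "F \<in> L2"
  shows "L2_tendsto (\<lambda>S \<xi>. \<Sum>i\<in>S. L2_inner F (e i) * e i \<xi>) F (finite_subsets_at_top I)"
proof -
  define c where "c i = L2_inner F (e i)" for i
  define p where "p S \<xi> = (\<Sum>i\<in>S. c i * e i \<xi>)" for S \<xi>
  have p: "p S \<in> L2" if "S \<subseteq> I" for S
    unfolding p_def using that by (intro L2_sum L2_cmult e) auto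
  have ip: "L2_inner (p S) h = (\<Sum>i\<in>S. c i * L2_inner (e i) h)" if "S \<subseteq> I" "h \<in> L2" for S h
    unfolding p_def using that by (subst L2_inner_sum_left) (auto intro!: L2_cmult e simp: L2_inner_cmult_left)
  have bound: "(L2_norm (\<lambda>\<xi>. p S \<xi> - F \<xi>))\<^sup>2 \<le> (L2_norm F)\<^sup>2 - (\<Sum>i\<in>S. (cmod (c i))\<^sup>2)"
    if S: "finite S" "S \<subseteq> I" for S
  proof -
    define q where "q i = L2_inner (p S) (e i)" for i
    have "(\<Sum>i\<in>S. (cmod (q i))\<^sup>2) \<le> (L2_norm (p S))\<^sup>2"
      unfolding q_def using S by (intro finite_sum_le_has_sum[OF tight[OF p]]) auto
    moreover have "(\<Sum>i\<in>S. Re (c i * cnj (q i))) = (L2_norm (p S))\<^sup>2"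
    proof -
      have "complex_of_real ((L2_norm (p S))\<^sup>2) = (\<Sum>i\<in>S. c i * cnj (q i))"
        unfolding L2_norm_sq_inner ip[OF S(2) p[OF S(2)]] q_def
        by (intro sum.cong refl) (simp add: L2_inner_commute[of "e _" "p S"])
      from arg_cong[OF this, of Re] show ?thesis by (simp only: Re_sum Re_complex_of_real)
    qed
    moreover have "0 \<le> (\<Sum>i\<in>S. (cmod (c i - q i))\<^sup>2)" by (intro sum_nonneg) auto
    moreover have "(cmod (c i - q i))\<^sup>2 = (cmod (c i))\<^sup>2 - 2 * Re (c i * cnj (q i)) + (cmod (q i))\<^sup>2" for i
      by (simp add: cmod_power2 power2_diff algebra_simps)
    ultimately have pS: "(L2_norm (p S))\<^sup>2 \<le> (\<Sum>i\<in>S. (cmod (c i))\<^sup>2)"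
      by (simp add: sum.distrib sum_subtractf sum_distrib_left[symmetric])
    have "L2_inner (p S) F = complex_of_real (\<Sum>i\<in>S. (cmod (c i))\<^sup>2)"
      unfolding ip[OF S(2) F] by (simp only: L2_inner_commute[of "e _" F] c_def complex_norm_square of_real_sum)
    then have "Re (L2_inner (p S) F) = (\<Sum>i\<in>S. (cmod (c i))\<^sup>2)" by (simp only: Re_complex_of_real)
    with pS show ?thesis unfolding L2_norm_diff_sq[OF p[OF S(2)] F] by simp
  qed
  have "((\<lambda>S. (L2_norm F)\<^sup>2 - (\<Sum>i\<in>S. (cmod (c i))\<^sup>2)) \<longlongrightarrow> (L2_norm F)\<^sup>2 - (L2_norm F)\<^sup>2) (finite_subsets_at_top I)"
    using tight[OF F] unfolding has_sum_def c_def by (intro tendsto_intros)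
  then have z: "((\<lambda>S. (L2_norm F)\<^sup>2 - (\<Sum>i\<in>S. (cmod (c i))\<^sup>2)) \<longlongrightarrow> 0) (finite_subsets_at_top I)" by simp
  have "eventually (\<lambda>S. norm ((L2_norm (\<lambda>\<xi>. p S \<xi> - F \<xi>))\<^sup>2) \<le> (L2_norm F)\<^sup>2 - (\<Sum>i\<in>S. (cmod (c i))\<^sup>2)) (finite_subsets_at_top I)"
    by (rule eventually_finite_subsets_at_top_weakI) (use bound in simp)
  then have "((\<lambda>S. (L2_norm (\<lambda>\<xi>. p S \<xi> - F \<xi>))\<^sup>2) \<longlongrightarrow> 0) (finite_subsets_at_top I)"
    using z by (rule Lim_null_comparison)
  then have "((\<lambda>S. sqrt ((L2_norm (\<lambda>\<xi>. p S \<xi> - F \<xi>))\<^sup>2)) \<longlongrightarrow> sqrt 0) (finite_subsets_at_top I)"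
    by (rule tendsto_real_sqrt)
  moreover have "eventually (\<lambda>S. p S \<in> L2) (finite_subsets_at_top I)"
    by (rule eventually_finite_subsets_at_top_weakI) (rule p)
  ultimately show ?thesis using F by (simp add: L2_tendsto_def p_def[abs_def] c_def)
qed

lemma has_sum_finite_support:
  assumes "finite S" "S \<subseteq> A" "\<And>x. x \<in> A - S \<Longrightarrow> f x = 0"
  shows "(f has_sum sum f S) A"
proof -
  have "(f has_sum sum f S) S" using assms(1) by (rule has_sum_finite)
  then show ?thesis
    using has_sum_cong_neutral[of A S f f "sum f S"] assms by blast
qed

section \<open>The square-root system and the sum of its squares\<close>

locale covering_bump =
  fixes J :: "'j set"
    and A :: "'j \<Rightarrow> real ^ 'd ^ 'd"
    and b :: "'j \<Rightarrow> real ^ 'd"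
    and P Q :: "(real ^ 'd) set"
    and \<Phi> :: "real ^ 'd \<Rightarrow> real"
    and c :: "real ^ 'd"
    and a :: real
  assumes covering: "structured_admissible_covering J A b P Q"
    and bump: "bump_function P Q \<Phi>"
    and a_pos: "0 < a"
    and Q_cube: "Q \<subseteq> cube c a"
begin

abbreviation "T j \<equiv> affine_map (A j) (b j)"

lemma J_countable: "countable J"
  using covering by (simp add: structured_admissible_covering_def)

lemma det_A: "j \<in> J \<Longrightarrow> det (A j) \<noteq> 0"
  using covering by (simp add: structured_admissible_covering_def invertible_det_nz)

lemma T_inverse:
  assumes "j \<in> J"
  obtains B where "\<And>\<xi>. inv (T j) \<xi> = B *v (\<xi> - b j)" "\<And>x. inv (T j) (T j x) = x" "\<And>\<xi>. T j (inv (T j) \<xi>) = \<xi>"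
proof -
  have "invertible (A j)" using covering assms by (simp add: structured_admissible_covering_def)
  then obtain B where B: "A j ** B = mat 1" "B ** A j = mat 1"
    unfolding invertible_def by blast
  have 1: "B *v (T j x - b j) = x" for x
    by (simp add: affine_map_def matrix_vector_mul_assoc B)
  have 2: "T j (B *v (\<xi> - b j)) = \<xi>" for \<xi>
    by (simp add: affine_map_def matrix_vector_mul_assoc B)
  have "inv (T j) = (\<lambda>\<xi>. B *v (\<xi> - b j))"
    by (rule inv_unique_comp) (auto simp: fun_eq_iff 1 2)
  then show ?thesis using that[of B] 1 2 by simp
qed

lemma continuous_inv_T: "j \<in> J \<Longrightarrow> continuous_on UNIV (inv (T j))"
proof -
  assume "j \<in> J"
  then obtain B where B: "\<And>\<xi>. inv (T j) \<xi> = B *v (\<xi> - b j)" by (rule T_inverse) blast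
  have "continuous_on UNIV (\<lambda>\<xi>. B *v (\<xi> - b j))"
    by (intro continuous_on_compose2[OF linear_continuous_on[OF matrix_vector_mul_bounded_linear]] continuous_intros) auto
  then show ?thesis using B by (simp add: ext[of "inv (T j)"] B[abs_def] cong: continuous_on_cong)
qed

lemma \<Phi>_continuous: "continuous_on UNIV \<Phi>"
proof -
  have "C_k 0 \<Phi>" using bump unfolding bump_function_def C_infinity_def by blast
  then show ?thesis by simp
qed

lemma \<Phi>_support: "\<Phi> x \<noteq> 0 \<Longrightarrow> x \<in> Q"
  using bump closure_subset[of "{x. \<Phi> x \<noteq> 0}"] by (auto simp: bump_function_def)

abbreviation "g \<equiv> dilated_bump A b \<Phi>"

lemma g_continuous: "j \<in> J \<Longrightarrow> continuous_on UNIV (g j)"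
  unfolding dilated_bump_def[abs_def]
  by (rule continuous_on_compose2[OF \<Phi>_continuous continuous_inv_T]) auto

lemma g_support: "j \<in> J \<Longrightarrow> g j \<xi> \<noteq> 0 \<Longrightarrow> \<xi> \<in> T j ` Q"
proof -
  assume j: "j \<in> J" and "g j \<xi> \<noteq> 0"
  then have "inv (T j) \<xi> \<in> Q" by (simp add: dilated_bump_def \<Phi>_support)
  moreover have "T j (inv (T j) \<xi>) = \<xi>" by (rule T_inverse[OF j])
  ultimately show "\<xi> \<in> T j ` Q" by (metis image_eqI)
qed

lemma g_zero: "j \<in> J \<Longrightarrow> g j 0 = 0"
proof -
  assume j: "j \<in> J"
  then have "T j ` Q \<subseteq> - {0}"
    using covering by (simp add: structured_admissible_covering_def admissible_covering_def)
  then show "g j 0 = 0" using g_support[OF j] by blast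
qed

text \<open>A point other than the origin lies in some set of the covering, which only finitely many
  others meet; at the origin all bumps vanish.\<close>

lemma g_finite_support: "finite {k \<in> J. g k \<xi> \<noteq> 0}"
proof (cases "\<xi> = 0")
  case True
  then have "{k \<in> J. g k \<xi> \<noteq> 0} = {}" using g_zero by blast
  then show ?thesis by (simp only: finite.emptyI)
next
  case False
  then have "\<xi> \<in> (\<Union>j\<in>J. T j ` Q)"
    using covering by (simp add: structured_admissible_covering_def admissible_covering_def)
  then obtain j where j: "j \<in> J" "\<xi> \<in> T j ` Q" by blast
  then have "{k \<in> J. g k \<xi> \<noteq> 0} \<subseteq> {k \<in> J. T k ` Q \<inter> T j ` Q \<noteq> {}}" using g_support by blast
  moreover have "finite {k \<in> J. T k ` Q \<inter> T j ` Q \<noteq> {}}"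
    using covering j(1) by (auto simp: structured_admissible_covering_def admissible_covering_def)
  ultimately show ?thesis by (rule finite_subset)
qed

text \<open>A finite sum over an index set that depends on the point. It spares the convergence
  questions of the infinite sum in \<open>sqrt_system\<close>.\<close>

definition bump_square_sum :: "real ^ 'd \<Rightarrow> real" where
  "bump_square_sum \<xi> = (\<Sum>k | k \<in> J \<and> g k \<xi> \<noteq> 0. (g k \<xi>)\<^sup>2)"

lemma has_sum_g_square: "((\<lambda>k. (g k \<xi>)\<^sup>2) has_sum bump_square_sum \<xi>) J"
  unfolding bump_square_sum_def by (rule has_sum_finite_support) (use g_finite_support in auto)

lemma sqrt_system_eq: "sqrt_system J A b \<Phi> j \<xi> = g j \<xi> / sqrt (bump_square_sum \<xi>)"
  by (simp add: sqrt_system_def infsumI[OF has_sum_g_square])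

text \<open>The images of \<open>P\<close> cover as well, and there a bump equals 1. This keeps the
  denominator of the square-root system away from 0.\<close>

lemma bump_square_sum_pos:
  assumes "\<xi> \<noteq> 0" shows "1 \<le> bump_square_sum \<xi>"
proof -
  have "\<xi> \<in> (\<Union>j\<in>J. T j ` P)"
    using covering assms by (simp add: structured_admissible_covering_def admissible_covering_def)
  then obtain j x where j: "j \<in> J" "x \<in> P" "\<xi> = T j x" by blast
  have "inv (T j) (T j x) = x" by (rule T_inverse[OF j(1)])
  then have "g j \<xi> = 1"
    using bump j by (simp add: dilated_bump_def bump_function_def)
  then show ?thesis
    using finite_sum_le_has_sum[OF has_sum_g_square, of "{j}" \<xi>] j(1) by simp
qed

text \<open>Since the index set varies with the point, measurability comes from fixed finite partial
  sums along an enumeration of \<open>J\<close>, which are eventually constant at each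
  point.\<close>

lemma bump_square_sum_measurable: "bump_square_sum \<in> borel_measurable borel"
proof (rule borel_measurable_LIMSEQ_real)
  let ?S = "\<lambda>n. {k \<in> J. to_nat_on J k < n}"
  have fin: "finite (?S n)" for n
    by (rule finite_imageD[of "to_nat_on J"])
      (auto intro: finite_subset[of _ "{..<n}"] inj_on_subset[OF inj_on_to_nat_on[OF J_countable]])
  show "(\<lambda>n. \<Sum>k\<in>?S n. (g k \<xi>)\<^sup>2) \<longlonglongrightarrow> bump_square_sum \<xi>" for \<xi>
  proof (rule tendsto_eventually)
    \<comment> \<open>From \<open>N\<close> on the enumeration meets no index whose bump is nonzero
      at \<open>\<xi>\<close>.\<close>
    define N where "N = Suc (Max (to_nat_on J ` {k \<in> J. g k \<xi> \<noteq> 0}))"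
    have N: "to_nat_on J k < N" if "k \<in> J" "g k \<xi> \<noteq> 0" for k
      unfolding N_def using g_finite_support[of \<xi>] that by (auto simp: less_Suc_eq_le intro!: Max_ge)
    show "eventually (\<lambda>n. (\<Sum>k\<in>?S n. (g k \<xi>)\<^sup>2) = bump_square_sum \<xi>) sequentially"
    proof (rule eventually_sequentiallyI[of N])
      fix n assume "N \<le> n"
      then show "(\<Sum>k\<in>?S n. (g k \<xi>)\<^sup>2) = bump_square_sum \<xi>"
        unfolding bump_square_sum_def
        by (intro sum.mono_neutral_right fin) (auto dest: N)
    qed
  qed
  show "(\<lambda>\<xi>. \<Sum>k\<in>?S n. (g k \<xi>)\<^sup>2) \<in> borel_measurable borel" for n
    by (intro borel_measurable_sum borel_measurable_power borel_measurable_continuous_onI g_continuous) auto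
qed

abbreviation "\<phi> \<equiv> sqrt_system J A b \<Phi>"

lemma \<phi>_measurable: "j \<in> J \<Longrightarrow> \<phi> j \<in> borel_measurable borel"
  unfolding sqrt_system_eq[abs_def]
  using borel_measurable_continuous_onI[OF g_continuous] bump_square_sum_measurable by measurable

lemma \<phi>_square_has_sum: "\<xi> \<noteq> 0 \<Longrightarrow> ((\<lambda>j. (\<phi> j \<xi>)\<^sup>2) has_sum 1) J"
proof -
  assume "\<xi> \<noteq> 0"
  then have p: "0 < bump_square_sum \<xi>" using bump_square_sum_pos[of \<xi>] by simp
  have "((\<lambda>k. (g k \<xi>)\<^sup>2 * (1 / bump_square_sum \<xi>)) has_sum bump_square_sum \<xi> * (1 / bump_square_sum \<xi>)) J"
    by (rule has_sum_cmult_left[OF has_sum_g_square])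
  then show ?thesis using p by (simp add: sqrt_system_eq power_divide)
qed

lemma \<phi>_le_1: "j \<in> J \<Longrightarrow> \<bar>\<phi> j \<xi>\<bar> \<le> 1"
proof (cases "\<xi> = 0")
  case True
  assume j: "j \<in> J"
  then have "g j \<xi> = 0" using True g_zero by simp
  then show ?thesis by (simp add: sqrt_system_eq)
next
  case False
  assume j: "j \<in> J"
  have "(\<phi> j \<xi>)\<^sup>2 \<le> 1"
    using finite_sum_le_has_sum[OF \<phi>_square_has_sum[OF False], of "{j}"] j by simp
  then show ?thesis by (simp add: abs_square_le_1)
qed

section \<open>The frame functions on the frequency side\<close>

abbreviation "\<eta> \<equiv> eta_hat J A b \<Phi> c a"

abbreviation "weight j \<equiv> (2 * a) powr (- real CARD('d) / 2) * \<bar>det (A j)\<bar> powr (- 1 / 2)"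

text \<open>Openness keeps \<open>Q\<close> off the faces of the closed cube, so that after
  rescaling the support falls inside the half-open \<open>period_cell\<close>.\<close>

lemma Q_box: "Q \<subseteq> {x. \<forall>i. c $ i - a < x $ i \<and> x $ i < c $ i + a}"
proof -
  have "open Q" using covering by (simp add: structured_admissible_covering_def)
  then have "Q \<subseteq> interior (cbox (c - vec a) (c + vec a))"
    using Q_cube by (intro interior_maximal) (simp_all add: cube_def)
  then show ?thesis by (auto simp: interior_cbox mem_box_cart)
qed

lemma \<eta>_eq:
  assumes "j \<in> J"
  shows "\<eta> n j \<xi> = of_real (\<phi> j \<xi> * weight j) * cis (pi / a * (int_vec n \<bullet> inv (T j) \<xi>))"
proof (cases "\<phi> j \<xi> = 0")
  case False
  then have "inv (T j) \<xi> \<in> Q" by (intro \<Phi>_support) (auto simp: sqrt_system_eq dilated_bump_def)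
  then have "inv (T j) \<xi> \<in> cube c a" using Q_cube by blast
  then show ?thesis by (simp add: eta_hat_def local_exponential_def cis_conv_exp int_vec_def)
qed (simp add: eta_hat_def)

text \<open>The modulus is at most \<open>weight j\<close>, and the support lies in a bounded set,
  the affine image of \<open>Q\<close>.\<close>

lemma \<eta>_in_L2:
  assumes j: "j \<in> J"
  shows "\<eta> n j \<in> L2"
proof -
  have "continuous_on UNIV (\<lambda>\<xi>. cis (pi / a * (int_vec n \<bullet> inv (T j) \<xi>)))"
    unfolding cis_conv_exp by (intro continuous_intros continuous_inv_T j)
  then have m1: "(\<lambda>\<xi>. cis (pi / a * (int_vec n \<bullet> inv (T j) \<xi>))) \<in> borel_measurable borel"
    by (rule borel_measurable_continuous_onI)
  have m: "\<eta> n j \<in> borel_measurable lebesgue"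
  proof (rule borel_measurable_lebesgueI)
    note [measurable] = m1 \<phi>_measurable[OF j]
    show "\<eta> n j \<in> borel_measurable borel" unfolding \<eta>_eq[OF j, abs_def] by measurable
  qed
  have bd: "bounded (T j ` Q)"
  proof -
    have "T j ` Q = (\<lambda>x. x + b j) ` ((*v) (A j) ` Q)" by (simp add: affine_map_def image_image)
    moreover have "bounded ((*v) (A j) ` Q)"
      using covering by (intro bounded_linear_image matrix_vector_mul_bounded_linear)
        (simp add: structured_admissible_covering_def)
    ultimately show ?thesis using bounded_translation[of "(*v) (A j) ` Q" "b j"] by (simp add: add.commute)
  qed
  have Qm: "T j ` Q \<in> sets lebesgue"
    using covering j by (simp add: structured_admissible_covering_def admissible_covering_def)
  have "emeasure lebesgue (T j ` Q) < \<infinity>"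
    using bounded_set_imp_lmeasurable[OF bd Qm] unfolding fmeasurable_def by blast
  then have i: "integrable lebesgue (\<lambda>\<xi>. indicator (T j ` Q) \<xi> * (weight j)\<^sup>2)"
    using Qm by simp
  show ?thesis
  proof (rule L2I[OF m], rule Bochner_Integration.integrable_bound[OF i])
    show "AE \<xi> in lebesgue. norm ((cmod (\<eta> n j \<xi>))\<^sup>2) \<le> norm (indicator (T j ` Q) \<xi> * (weight j)\<^sup>2)"
    proof (rule AE_I2)
      fix \<xi>
      show "norm ((cmod (\<eta> n j \<xi>))\<^sup>2) \<le> norm (indicator (T j ` Q) \<xi> * (weight j)\<^sup>2)"
      proof (cases "\<phi> j \<xi> = 0")
        case False
        then have "\<xi> \<in> T j ` Q" using g_support[OF j] by (auto simp: sqrt_system_eq)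
        moreover have "(\<phi> j \<xi>)\<^sup>2 \<le> 1" using \<phi>_le_1[OF j, of \<xi>] by (simp add: abs_square_le_1)
        then have "(\<phi> j \<xi>)\<^sup>2 * (weight j)\<^sup>2 \<le> 1 * (weight j)\<^sup>2" by (intro mult_right_mono) auto
        ultimately show ?thesis by (simp add: \<eta>_eq[OF j] norm_mult power_mult_distrib del: of_real_mult)
      qed (simp add: \<eta>_eq[OF j])
    qed
  qed (use m in measurable)
qed

text \<open>The volume of the affine image of the cube is |det A_j| (2a)^d, and the squared weight
  is its reciprocal. The factor (2a)^d is split because the substitution to the period cell has
  Jacobian |det A_j| (a/pi)^d and Parseval there contributes (2 pi)^d.\<close>

lemma weight_normalisation:
  assumes "j \<in> J"
  shows "\<bar>det (A j)\<bar> * (a / pi) ^ CARD('d) * (weight j)\<^sup>2 * (2 * pi) ^ CARD('d) = 1"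
proof -
  have d: "0 < \<bar>det (A j)\<bar>" using det_A[OF assms] by simp
  have "(\<bar>det (A j)\<bar> powr (- 1 / 2))\<^sup>2 = \<bar>det (A j)\<bar> powr (- 1)"
    by (simp add: power2_eq_square flip: powr_add)
  then have 1: "\<bar>det (A j)\<bar> * (\<bar>det (A j)\<bar> powr (- 1 / 2))\<^sup>2 = 1"
    using d by (simp add: powr_minus)
  have "((2 * a) powr (- real CARD('d) / 2))\<^sup>2 = (2 * a) powr (- real CARD('d))"
    by (simp add: power2_eq_square flip: powr_add)
  then have "(2 * a) ^ CARD('d) * ((2 * a) powr (- real CARD('d) / 2))\<^sup>2 = (2 * a) powr real CARD('d) * (2 * a) powr (- real CARD('d))"
    using a_pos by (simp add: powr_realpow)
  also have "\<dots> = 1" using a_pos by (subst powr_add[symmetric]) simp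
  finally have 2: "(2 * a) ^ CARD('d) * ((2 * a) powr (- real CARD('d) / 2))\<^sup>2 = 1" .
  have 3: "(a / pi) ^ CARD('d) * (2 * pi) ^ CARD('d) = (2 * a) ^ CARD('d)"
    by (subst power_mult_distrib[symmetric]) simp
  have "\<bar>det (A j)\<bar> * (a / pi) ^ CARD('d) * (weight j)\<^sup>2 * (2 * pi) ^ CARD('d) =
     (\<bar>det (A j)\<bar> * (\<bar>det (A j)\<bar> powr (- 1 / 2))\<^sup>2) * (((a / pi) ^ CARD('d) * (2 * pi) ^ CARD('d)) * ((2 * a) powr (- real CARD('d) / 2))\<^sup>2)"
    by (simp only: power_mult_distrib mult_ac)
  then show ?thesis by (simp only: 1 2 3 mult_1)
qed

lemma Parseval_at_scale:
  assumes j: "j \<in> J" and F: "F \<in> L2"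
  shows "((\<lambda>n. (cmod (L2_inner F (\<eta> n j)))\<^sup>2) has_sum (L2_norm (\<lambda>\<xi>. F \<xi> * of_real (\<phi> j \<xi>)))\<^sup>2) UNIV"
proof -
  \<comment> \<open>\<open>M\<close> and \<open>t\<close> are chosen so that M y + t = T_j (c +
    (a/pi) y). This substitution carries the closed cube from -pi to pi onto the image of the cube
    around \<open>c\<close>.\<close>
  define M where "M = A j ** mat (a / pi)"
  define t where "t = A j *v c + b j"
  define h where "h \<xi> = F \<xi> * of_real (\<phi> j \<xi>)" for \<xi>
  define G where "G y = h (M *v y + t)" for y
  have dM: "\<bar>det M\<bar> = \<bar>det (A j)\<bar> * (a / pi) ^ CARD('d)"
    using a_pos by (simp add: M_def det_mul det_mat abs_mult)
  have dM0: "det M \<noteq> 0" using det_A[OF j] a_pos by (simp add: M_def det_mul det_mat)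
  have Tinv: "inv (T j) (M *v y + t) = c + (a / pi) *\<^sub>R y" for y
  proof -
    have "M *v y + t = T j (c + (a / pi) *\<^sub>R y)"
      by (simp add: M_def t_def affine_map_def matrix_vector_mul_assoc[symmetric] mat_mult_vec matrix_vector_right_distrib)
    moreover have "inv (T j) (T j x) = x" for x by (rule T_inverse[OF j])
    ultimately show ?thesis by simp
  qed
  have hm: "h \<in> borel_measurable lebesgue"
    using L2_measurable[OF F] borel_measurable_lebesgueI[OF \<phi>_measurable[OF j]] unfolding h_def by measurable
  have hL: "h \<in> L2"
    by (rule L2_bound[OF F hm, of 1])
      (use \<phi>_le_1[OF j] in \<open>simp add: h_def norm_mult mult_left_le\<close>)
  have h2: "integrable lebesgue (\<lambda>x. complex_of_real ((cmod (h x))\<^sup>2))"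
    using L2_integrable[OF hL] by (rule integrable_of_real)
  have Gm: "G \<in> borel_measurable lebesgue"
    unfolding G_def by (rule measurable_compose[OF measurable_affine_matrix[OF dM0] hm])
  have m2: "(\<lambda>x. complex_of_real ((cmod (h x))\<^sup>2)) \<in> borel_measurable lebesgue"
    using hm by measurable
  have G2: "integrable lebesgue (\<lambda>y. complex_of_real ((cmod (G y))\<^sup>2))"
    using integrable_lebesgue_affine[OF dM0 m2, of t] h2 by (simp add: G_def)
  have GL: "G \<in> L2"
    using Gm integrable_Re[OF G2] by (simp add: L2I)
  have "complex_of_real ((L2_norm h)\<^sup>2) = of_real \<bar>det M\<bar> * of_real ((L2_norm G)\<^sup>2)"
    unfolding L2_norm_sq G_def
    using integral_lebesgue_affine[OF dM0 m2, of t] by (simp only: integral_complex_of_real)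
  then have nh: "(L2_norm h)\<^sup>2 = \<bar>det M\<bar> * (L2_norm G)\<^sup>2"
    by (simp only: of_real_mult[symmetric] of_real_eq_iff)
  have out: "G y = 0" if "y \<notin> period_cell" for y
  proof (rule ccontr)
    assume "G y \<noteq> 0"
    then have "\<phi> j (M *v y + t) \<noteq> 0" by (auto simp: G_def h_def)
    then have "c + (a / pi) *\<^sub>R y \<in> Q"
      using Tinv by (intro \<Phi>_support) (auto simp: sqrt_system_eq dilated_bump_def)
    then have "c $ i - a < (c + (a / pi) *\<^sub>R y) $ i \<and> (c + (a / pi) *\<^sub>R y) $ i < c $ i + a" for i
      using Q_box by blast
    then have "- pi < y $ i \<and> y $ i < pi" for i
    proof -
      have "- a < a * (y $ i / pi) \<and> a * (y $ i / pi) < a"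
        using \<open>\<And>i. c $ i - a < (c + (a / pi) *\<^sub>R y) $ i \<and> (c + (a / pi) *\<^sub>R y) $ i < c $ i + a\<close>[of i] by simp
      then have "a * (-1) < a * (y $ i / pi) \<and> a * (y $ i / pi) < a * 1" by simp
      then have "-1 < y $ i / pi \<and> y $ i / pi < 1" using a_pos by (simp only: mult_less_cancel_left_pos)
      then show ?thesis by (simp add: field_simps)
    qed
    then show False using that by (auto simp: period_cell_def less_imp_le)
  qed
  have inner: "L2_inner F (\<eta> n j) = of_real (\<bar>det M\<bar> * weight j) * cis (- (pi / a * (int_vec n \<bullet> c))) * (LINT y|lebesgue. G y * cnj (echar n y))" for n
  proof -
    have m: "(\<lambda>\<xi>. F \<xi> * cnj (\<eta> n j \<xi>)) \<in> borel_measurable lebesgue"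
      using L2_measurable[OF F] L2_measurable[OF \<eta>_in_L2[OF j]] by measurable
    \<comment> \<open>The centre \<open>c\<close> of the cube contributes only a phase, which
      disappears in the absolute value of the coefficient.\<close>
    have "F (M *v y + t) * cnj (\<eta> n j (M *v y + t)) =
        (of_real (weight j) * cis (- (pi / a * (int_vec n \<bullet> c)))) * (G y * cnj (echar n y))" for y
    proof -
      have "cis (- (pi / a * (int_vec n \<bullet> (c + (a / pi) *\<^sub>R y)))) = cis (- (pi / a * (int_vec n \<bullet> c))) * cis (- (int_vec n \<bullet> y))"
        using a_pos by (simp add: cis_mult inner_add_right distrib_left)
      then show ?thesis
        by (simp add: \<eta>_eq[OF j] Tinv G_def h_def echar_def cis_cnj mult_ac)
    qed
    then have "(LINT y|lebesgue. F (M *v y + t) * cnj (\<eta> n j (M *v y + t))) =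
        (of_real (weight j) * cis (- (pi / a * (int_vec n \<bullet> c)))) * (LINT y|lebesgue. G y * cnj (echar n y))"
      by (simp only: integral_mult_right_zero)
    then show ?thesis
      unfolding L2_inner_def integral_lebesgue_affine[OF dM0 m, of t] by (simp add: mult.assoc)
  qed
  have sq: "(cmod (L2_inner F (\<eta> n j)))\<^sup>2 = (\<bar>det M\<bar> * weight j)\<^sup>2 * (cmod (LINT y|lebesgue. G y * cnj (echar n y)))\<^sup>2" for n
    unfolding inner by (simp only: norm_mult norm_cis norm_of_real power_mult_distrib mult_1_right power2_abs)
  have "((\<lambda>n. (\<bar>det M\<bar> * weight j)\<^sup>2 * (cmod (LINT y|lebesgue. G y * cnj (echar n y)))\<^sup>2) has_sum
      (\<bar>det M\<bar> * weight j)\<^sup>2 * ((2 * pi) ^ CARD('d) * (L2_norm G)\<^sup>2)) UNIV"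
    by (rule has_sum_cmult_right[OF Parseval_period_cell[OF GL out]])
  \<comment> \<open>One of the two factors |det M| enters the normalisation of the weight; the other
    converts the norm of \<open>G\<close> into that of \<open>h\<close>.\<close>
  moreover have "(\<bar>det M\<bar> * weight j)\<^sup>2 * ((2 * pi) ^ CARD('d) * (L2_norm G)\<^sup>2) =
      (\<bar>det (A j)\<bar> * (a / pi) ^ CARD('d) * (weight j)\<^sup>2 * (2 * pi) ^ CARD('d)) * (\<bar>det M\<bar> * (L2_norm G)\<^sup>2)"
    unfolding dM[symmetric] by (simp only: power2_eq_square mult_ac)
  ultimately show ?thesis
    unfolding sq h_def[symmetric] weight_normalisation[OF j] nh by (simp only: mult_1)
qed

text \<open>Tonelli exchanges the sum over \<open>j\<close> with the integral, where the squares of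
  the \<open>\<phi> j\<close> add up to 1.\<close>

lemma norm_square_decomposition:
  assumes F: "F \<in> L2"
  shows "((\<lambda>j. (L2_norm (\<lambda>\<xi>. F \<xi> * of_real (\<phi> j \<xi>)))\<^sup>2) has_sum (L2_norm F)\<^sup>2) J"
proof (rule has_sum_nn_integral_count_space)
  have Fj: "(\<lambda>\<xi>. F \<xi> * of_real (\<phi> j \<xi>)) \<in> L2" if j: "j \<in> J" for j
  proof (rule L2_bound[OF F, of _ 1])
    show "(\<lambda>\<xi>. F \<xi> * of_real (\<phi> j \<xi>)) \<in> borel_measurable lebesgue"
      using L2_measurable[OF F] borel_measurable_lebesgueI[OF \<phi>_measurable[OF j]] by measurable
  qed (use \<phi>_le_1[OF j] in \<open>simp add: norm_mult mult_left_le\<close>)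
  have "(\<integral>\<^sup>+j. ennreal ((L2_norm (\<lambda>\<xi>. F \<xi> * of_real (\<phi> j \<xi>)))\<^sup>2) \<partial>count_space J) =
      (\<integral>\<^sup>+j. (\<integral>\<^sup>+\<xi>. ennreal ((cmod (F \<xi> * of_real (\<phi> j \<xi>)))\<^sup>2) \<partial>lebesgue) \<partial>count_space J)"
    by (intro nn_integral_cong) (simp only: L2_nn_integral[OF Fj] space_count_space)
  also have "\<dots> = (\<integral>\<^sup>+\<xi>. (\<integral>\<^sup>+j. ennreal ((cmod (F \<xi> * of_real (\<phi> j \<xi>)))\<^sup>2) \<partial>count_space J) \<partial>lebesgue)"
    by (intro nn_integral_count_space_nn_integral[symmetric] J_countable) (use Fj[THEN L2_measurable] in measurable)
  also have "\<dots> = (\<integral>\<^sup>+\<xi>. ennreal ((cmod (F \<xi>))\<^sup>2) \<partial>lebesgue)"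
  proof (rule nn_integral_cong_AE)
    \<comment> \<open>At the origin the squares add up to 0 instead of 1, but a single point is a
      null set.\<close>
    have "AE \<xi> in lebesgue. \<xi> \<notin> {0 :: real ^ 'd}" by (rule AE_not_in) (simp add: null_sets_def)
    then show "AE \<xi> in lebesgue. (\<integral>\<^sup>+j. ennreal ((cmod (F \<xi> * of_real (\<phi> j \<xi>)))\<^sup>2) \<partial>count_space J) = ennreal ((cmod (F \<xi>))\<^sup>2)"
    proof eventually_elim
      case (elim \<xi>)
      have "((\<lambda>j. (cmod (F \<xi>))\<^sup>2 * (\<phi> j \<xi>)\<^sup>2) has_sum (cmod (F \<xi>))\<^sup>2 * 1) J"
        using elim by (intro has_sum_cmult_right \<phi>_square_has_sum) simp
      then have "((\<lambda>j. (cmod (F \<xi> * of_real (\<phi> j \<xi>)))\<^sup>2) has_sum (cmod (F \<xi>))\<^sup>2) J"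
        by (simp add: norm_mult power_mult_distrib)
      then show ?case by (rule nn_integral_count_space_has_sum) simp
    qed
  qed
  also have "\<dots> = ennreal ((L2_norm F)\<^sup>2)" by (rule L2_nn_integral[OF F])
  finally show "(\<integral>\<^sup>+j. ennreal ((L2_norm (\<lambda>\<xi>. F \<xi> * of_real (\<phi> j \<xi>)))\<^sup>2) \<partial>count_space J) = ennreal ((L2_norm F)\<^sup>2)" .
qed auto

text \<open>The terms are nonnegative, so convergence of the iterated sums makes the double sum
  summable, and it may be evaluated over \<open>n\<close> first and then over
  \<open>j\<close>.\<close>

theorem tight_frame:
  assumes F: "F \<in> L2"
  shows "((\<lambda>(j, n). (cmod (L2_inner F (\<eta> n j)))\<^sup>2) has_sum (L2_norm F)\<^sup>2) (J \<times> UNIV)"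
proof -
  let ?g = "\<lambda>j. (L2_norm (\<lambda>\<xi>. F \<xi> * of_real (\<phi> j \<xi>)))\<^sup>2"
  have in1: "((\<lambda>n. case (j, n) of (j, n) \<Rightarrow> (cmod (L2_inner F (\<eta> n j)))\<^sup>2) has_sum ?g j) UNIV" if "j \<in> J" for j
    using Parseval_at_scale[OF that F] by simp
  show ?thesis
  proof (rule has_sum_SigmaI[OF in1 norm_square_decomposition[OF F]])
    show "(\<lambda>(j, n). (cmod (L2_inner F (\<eta> n j)))\<^sup>2) summable_on J \<times> UNIV"
      by (rule summable_on_SigmaI[OF in1 has_sum_imp_summable[OF norm_square_decomposition[OF F]]]) auto
  qed
qed

end

text \<open>\<open>eta\<close> and \<open>fourier_L2\<close> are chosen by \<open>SOME\<close>, so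
  the conclusion also certifies the choices: without the clauses on \<open>eta\<close> and on
  \<open>has_L2_fourier\<close> the two identities could speak of arbitrary functions. The
  reconstruction is unconditional, a limit over all finite subsets of the index set.\<close>

theorem mainTheorem3:
  fixes J :: "'j set"
    and A :: "'j \<Rightarrow> real ^ 'd ^ 'd"
    and b :: "'j \<Rightarrow> real ^ 'd"
    and P Q :: "(real ^ 'd) set"
    and \<Phi> :: "real ^ 'd \<Rightarrow> real"
    and c :: "real ^ 'd"
    and a :: real
  assumes "structured_admissible_covering J A b P Q"
    and "bump_function P Q \<Phi>"
    and "0 < a"
    and "Q \<subseteq> cube c a"
  shows "(\<forall>n. \<forall>j\<in>J. eta J A b \<Phi> c a n j \<in> L2 \<and>
            (AE \<xi> in lebesgue. fourier_L2 (eta J A b \<Phi> c a n j) \<xi> = eta_hat J A b \<Phi> c a n j \<xi>)) \<and>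
         (\<forall>f\<in>L2.
            ((\<lambda>(j, n). (cmod (L2_inner f (eta J A b \<Phi> c a n j)))\<^sup>2) has_sum (L2_norm f)\<^sup>2)
              (J \<times> UNIV) \<and>
            has_L2_fourier f (fourier_L2 f) \<and>
            L2_tendsto
              (\<lambda>S \<xi>. \<Sum>(j, n)\<in>S.
                 L2_inner (fourier_L2 f) (eta_hat J A b \<Phi> c a n j) * eta_hat J A b \<Phi> c a n j \<xi>)
              (fourier_L2 f) (finite_subsets_at_top (J \<times> UNIV)))"
proof -
  interpret covering_bump J A b P Q \<Phi> c a by unfold_locales fact+
  show ?thesis
  proof (intro conjI allI ballI)
    fix n j assume j: "j \<in> J"
    show "eta J A b \<Phi> c a n j \<in> L2"
      unfolding eta_def by (rule inv_fourier_L2_in_L2[OF \<eta>_in_L2[OF j]])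
    show "AE \<xi> in lebesgue. fourier_L2 (eta J A b \<Phi> c a n j) \<xi> = eta_hat J A b \<Phi> c a n j \<xi>"
      unfolding eta_def by (rule fourier_inv_fourier_L2[OF \<eta>_in_L2[OF j]])
  next
    fix f :: "real ^ 'd \<Rightarrow> complex" assume f: "f \<in> L2"
    show H: "has_L2_fourier f (fourier_L2 f)" by (rule has_L2_fourier_fourier_L2[OF f])
    have F: "fourier_L2 f \<in> L2" by (rule has_L2_fourier_L2(2)[OF H])
    have "(\<lambda>(j, n). (cmod (L2_inner f (eta J A b \<Phi> c a n j)))\<^sup>2) x = (\<lambda>(j, n). (cmod (L2_inner (fourier_L2 f) (\<eta> n j)))\<^sup>2) x"
      if "x \<in> J \<times> UNIV" for x
      using that by (auto simp: eta_def L2_inner_inv_fourier_L2[OF f \<eta>_in_L2])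
    then show "((\<lambda>(j, n). (cmod (L2_inner f (eta J A b \<Phi> c a n j)))\<^sup>2) has_sum (L2_norm f)\<^sup>2) (J \<times> UNIV)"
      using tight_frame[OF F] has_L2_fourier_norm[OF H] by (subst has_sum_cong) auto
    have "L2_tendsto (\<lambda>S \<xi>. \<Sum>i\<in>S. L2_inner (fourier_L2 f) (\<eta> (snd i) (fst i)) * \<eta> (snd i) (fst i) \<xi>)
        (fourier_L2 f) (finite_subsets_at_top (J \<times> UNIV))"
    proof (rule tight_frame_reconstruction[OF _ _ F])
      show "i \<in> J \<times> UNIV \<Longrightarrow> \<eta> (snd i) (fst i) \<in> L2" for i by (auto intro: \<eta>_in_L2)
      show "((\<lambda>i. (cmod (L2_inner F (\<eta> (snd i) (fst i))))\<^sup>2) has_sum (L2_norm F)\<^sup>2) (J \<times> UNIV)" if "F \<in> L2" for F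
        using tight_frame[OF that] by (simp add: case_prod_unfold)
    qed
    then show "L2_tendsto (\<lambda>S \<xi>. \<Sum>(j, n)\<in>S. L2_inner (fourier_L2 f) (\<eta> n j) * \<eta> n j \<xi>)
        (fourier_L2 f) (finite_subsets_at_top (J \<times> UNIV))"
      by (simp add: case_prod_unfold)
  qed
qed

end
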